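(* Let $t\ge 2$ be an integer and let $G$ be any $t$-uniform hypergraph, and let $H'=G^{(t-1)}$ be its $(t-1)$-blown-up hypergraph. Then \[ \tau(H')\le \left(\frac{t}{2}+2\sqrt{t\ln t}\right)\tau^*(H'). \] Furthermore, there is an efficient algorithm that approximates the minimum vertex cover of $(t-1)$-blown-up hypergraphs within a factor $\frac{t}{2}+2\sqrt{t\ln t}$.
   Context: For a $t$-uniform hypergraph $G=(V,E)$ and an integer $1\le k<t$, the $k$-blown-up hypergraph $G^{(k)}$ has vertex set consisting of all $k$-element subsets $U\subseteq V$ contained in at least one edge of $G$, and for each edge $e\in E$ it has the edge $\binom{e}{k}$ (the set of all $k$-element subsets of $e$). For a hypergraph $H$, $\tau(H)$ is the minimum size of a vertex cover (a set of vertices meeting every edge), and $\tau^*(H)=\min\{\sum_v x_v : x_v\ge 0,\ \sum_{v\in e}x_v\ge 1\ \forall e\}$ is the fractional vertex cover number. *)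

theory Defs
  imports Complex_Main "HOL-Library.Ramsey" "HOL-Library.Log_Nat"
    "HOL-Computational_Algebra.Polynomial"
begin

section \<open>Hypergraphs and vertex covers\<close>

record 'a hypergraph =
  verts :: "'a set"
  edges :: "'a set set"

definition finite_hypergraph :: "'a hypergraph \<Rightarrow> bool" where
  "finite_hypergraph H \<longleftrightarrow> finite (verts H) \<and> (\<forall>e\<in>edges H. e \<subseteq> verts H)"

definition uniform :: "nat \<Rightarrow> 'a hypergraph \<Rightarrow> bool" where
  "uniform t H \<longleftrightarrow> (\<forall>e\<in>edges H. card e = t)"

text \<open>\<open>nsets A k\<close> (from \<open>HOL-Library.Ramsey\<close>) is the set of all \<open>k\<close>-element subsets of \<open>A\<close>.\<close>

definition blowup :: "nat \<Rightarrow> 'a hypergraph \<Rightarrow> 'a set hypergraph" where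
  "blowup k G =
     \<lparr> verts = {U \<in> nsets (verts G) k. \<exists>e\<in>edges G. U \<subseteq> e},
       edges = {nsets e k | e. e \<in> edges G} \<rparr>"

definition vertex_cover :: "'a hypergraph \<Rightarrow> 'a set \<Rightarrow> bool" where
  "vertex_cover H C \<longleftrightarrow> C \<subseteq> verts H \<and> (\<forall>e\<in>edges H. C \<inter> e \<noteq> {})"

definition cover_number :: "'a hypergraph \<Rightarrow> nat" where
  "cover_number H = Min {card C | C. vertex_cover H C}"

definition fractional_cover :: "'a hypergraph \<Rightarrow> ('a \<Rightarrow> real) \<Rightarrow> bool" where
  "fractional_cover H x \<longleftrightarrow>
     (\<forall>v\<in>verts H. 0 \<le> x v) \<and> (\<forall>e\<in>edges H. 1 \<le> (\<Sum>v\<in>e. x v))"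

text \<open>For a finite hypergraph without empty edges this infimum is the optimum of a feasible linear
  program bounded below by 0, hence a minimum.\<close>

definition fractional_cover_number :: "'a hypergraph \<Rightarrow> real" where
  "fractional_cover_number H = Inf {(\<Sum>v\<in>verts H. x v) | x. fractional_cover H x}"


section \<open>Polynomial-time computation\<close>

text \<open>The machine model is a deterministic first-order call-by-value functional language.  Data are
  binary trees with natural numbers at the leaves, and size is measured in bits.  Every evaluation
  step is charged at least the bit size of the value it produces, and a primitive never
  produces a value larger than its operands together by more than a constant.  A Turing machine can therefore simulate an
  evaluation in time polynomial in its cost, and conversely, so that polynomial cost means polynomial
  time in the usual sense.\<close>

datatype val = Atom nat | Cell val val

fun bit_size :: "val \<Rightarrow> nat" where
  "bit_size (Atom n) = 1 + floorlog 2 n"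
| "bit_size (Cell v w) = 1 + bit_size v + bit_size w"

datatype primop = Plus | Minus | Times | Divide | Less

fun apply_op :: "primop \<Rightarrow> nat \<Rightarrow> nat \<Rightarrow> nat" where
  "apply_op Plus m n = m + n"
| "apply_op Minus m n = m - n"
| "apply_op Times m n = m * n"
| "apply_op Divide m n = m div n"
| "apply_op Less m n = (if m < n then 1 else 0)"

text \<open>Variables are de Bruijn indices into the environment: \<open>Bind e1 e2\<close> evaluates \<open>e2\<close> with the value
  of \<open>e1\<close> as variable 0, and \<open>Call f e\<close> evaluates the body of the \<open>f\<close>-th function of the program with
  the value of \<open>e\<close> as its only variable.  In \<open>Ite\<close>, the value \<open>Atom 0\<close> counts as false and all others
  as true.\<close>

datatype exp =
  Var nat
| Lit nat
| MkCell exp exp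
| Left exp
| Right exp
| IsCell exp
| Op primop exp exp
| Ite exp exp exp
| Bind exp exp
| Call nat exp

type_synonym program = "exp list"

text \<open>\<open>eval p env e v c\<close>: in program \<open>p\<close> and environment \<open>env\<close>, the expression \<open>e\<close> evaluates to \<open>v\<close> at
  cost \<open>c\<close>.  Ill-typed and diverging expressions have no value.\<close>

inductive eval :: "program \<Rightarrow> val list \<Rightarrow> exp \<Rightarrow> val \<Rightarrow> nat \<Rightarrow> bool" for p :: program where
  Var: "i < length env \<Longrightarrow> eval p env (Var i) (env ! i) (bit_size (env ! i))"
| Lit: "eval p env (Lit n) (Atom n) (bit_size (Atom n))"
| MkCell: "eval p env e1 v1 c1 \<Longrightarrow> eval p env e2 v2 c2 \<Longrightarrow>
    eval p env (MkCell e1 e2) (Cell v1 v2) (c1 + c2 + bit_size (Cell v1 v2))"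
| Left: "eval p env e (Cell v1 v2) c \<Longrightarrow> eval p env (Left e) v1 (c + bit_size v1)"
| Right: "eval p env e (Cell v1 v2) c \<Longrightarrow> eval p env (Right e) v2 (c + bit_size v2)"
| IsCell_Atom: "eval p env e (Atom n) c \<Longrightarrow>
    eval p env (IsCell e) (Atom 0) (c + bit_size (Atom 0))"
| IsCell_Cell: "eval p env e (Cell v1 v2) c \<Longrightarrow>
    eval p env (IsCell e) (Atom 1) (c + bit_size (Atom 1))"
| Op: "eval p env e1 (Atom m) c1 \<Longrightarrow> eval p env e2 (Atom n) c2 \<Longrightarrow>
    eval p env (Op f e1 e2) (Atom (apply_op f m n)) (c1 + c2 + bit_size (Atom (apply_op f m n)))"
| Ite_True: "eval p env e v c \<Longrightarrow> v \<noteq> Atom 0 \<Longrightarrow> eval p env e1 v1 c1 \<Longrightarrow>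
    eval p env (Ite e e1 e2) v1 (c + c1 + bit_size v1)"
| Ite_False: "eval p env e (Atom 0) c \<Longrightarrow> eval p env e2 v2 c2 \<Longrightarrow>
    eval p env (Ite e e1 e2) v2 (c + c2 + bit_size v2)"
| Bind: "eval p env e1 v1 c1 \<Longrightarrow> eval p (v1 # env) e2 v2 c2 \<Longrightarrow>
    eval p env (Bind e1 e2) v2 (c1 + c2 + bit_size v2)"
| Call: "eval p env e v c \<Longrightarrow> f < length p \<Longrightarrow> eval p [v] (p ! f) w d \<Longrightarrow>
    eval p env (Call f e) w (c + d + bit_size w)"

lemma eval_deterministic:
  assumes "eval p env e v c" "eval p env e v' c'"
  shows "v' = v \<and> c' = c"
  using assms
proof (induction arbitrary: v' c' rule: eval.induct)
  case (Var i env) from Var.prems show ?case by cases auto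
next
  case (Lit env n) from Lit.prems show ?case by cases auto
next
  case MkCell from MkCell.prems show ?case by cases (use MkCell.IH in blast)
next
  case Left from Left.prems show ?case by cases (use Left.IH in blast)
next
  case Right from Right.prems show ?case by cases (use Right.IH in blast)
next
  case IsCell_Atom from IsCell_Atom.prems show ?case by cases (use IsCell_Atom.IH in blast)+
next
  case IsCell_Cell from IsCell_Cell.prems show ?case by cases (use IsCell_Cell.IH in blast)+
next
  case Op from Op.prems show ?case by cases (use Op.IH in blast)
next
  case Ite_True from Ite_True.prems show ?case by cases (use Ite_True.IH Ite_True.hyps in blast)+
next
  case Ite_False from Ite_False.prems show ?case by cases (use Ite_False.IH in blast)+
next
  case Bind from Bind.prems show ?case by cases (use Bind.IH in blast)
next
  case Call from Call.prems show ?case by cases (use Call.IH in blast)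
qed

text \<open>The main function of a program is its first one.\<close>

definition runs :: "program \<Rightarrow> val \<Rightarrow> val \<Rightarrow> nat \<Rightarrow> bool" where
  "runs p inp out c \<longleftrightarrow> p \<noteq> [] \<and> eval p [inp] (p ! 0) out c"

text \<open>Finite sets are given by listing their elements without repetition, in any order.  As an
  element may have several encodings (sets do), an encoding is a relation.\<close>

definition encodes_nat :: "val \<Rightarrow> nat \<Rightarrow> bool" where
  "encodes_nat v n \<longleftrightarrow> v = Atom n"

definition encodes_set :: "(val \<Rightarrow> 'a \<Rightarrow> bool) \<Rightarrow> val \<Rightarrow> 'a set \<Rightarrow> bool" where
  "encodes_set enc v A \<longleftrightarrow>
     (\<exists>vs xs. distinct xs \<and> set xs = A \<and> list_all2 enc vs xs \<and> v = foldr Cell vs (Atom 0))"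

definition encodes_hypergraph ::
    "(val \<Rightarrow> 'a \<Rightarrow> bool) \<Rightarrow> val \<Rightarrow> 'a hypergraph \<Rightarrow> bool" where
  "encodes_hypergraph enc v H \<longleftrightarrow>
     (\<exists>a b. v = Cell a b \<and> encodes_set enc a (verts H) \<and> encodes_set (encodes_set enc) b (edges H))"

text \<open>There is a polynomial-time algorithm that approximates the minimum vertex cover within factor
  \<open>\<alpha>\<close> on the hypergraphs in \<open>\<H>\<close>, whose vertices are encoded by \<open>enc\<close>.\<close>

definition poly_time_cover_approx ::
    "(val \<Rightarrow> 'a \<Rightarrow> bool) \<Rightarrow> 'a hypergraph set \<Rightarrow> real \<Rightarrow> bool" where
  "poly_time_cover_approx enc \<H> \<alpha> \<longleftrightarrow>
     (\<exists>(p :: program) (q :: nat poly).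
        \<forall>H\<in>\<H>. \<forall>inp. encodes_hypergraph enc inp H \<longrightarrow>
          (\<exists>out c C. runs p inp out c \<and> c \<le> poly q (bit_size inp) \<and>
             encodes_set enc out C \<and> vertex_cover H C \<and>
             real (card C) \<le> \<alpha> * real (cover_number H)))"

end

theory Submission
  imports Defs
begin

text \<open>Let \<open>\<alpha>\<close> be the factor and \<open>h < \<alpha>\<close> the largest such integer.  Take a nearly optimal fractional
  cover \<open>x\<close>.  If some vertices have \<open>x \<ge> 1 / h\<close>, put them into the cover and delete the edges that
  they meet: this lowers the fractional optimum by at least \<open>1 / \<alpha>\<close> per vertex.  Otherwise every edge
  contains at least \<open>h\<close> vertices at which \<open>x\<close> is not negligible.  By approximate complementary
  slackness these are nearly saturated by a fractional matching, so there are hardly more than \<open>t\<close>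
  times the fractional optimum of them.  Colour the vertices of the \<open>t\<close>-uniform hypergraph at random
  with two colours and keep a non-negligible \<open>(t - 1)\<close>-set if it has an even number of red elements,
  or if the colouring is unbalanced on it.  The sets kept are hardly more than half of them, by a
  Chernoff bound.  Of the \<open>t\<close> subsets of an edge about half have an even number of red elements, so
  that with \<open>h\<close> non-negligible subsets one is kept.

  The cover \<open>x\<close> and the matching come from the multiplicative weights method: at a step where
  the total weight is smallest relative to the lightest edge, the normalised weights are \<open>x\<close>, and the
  numbers of times that edges were chosen form the matching.  The colouring is derandomised by
  conditional expectations.  The same algorithm, on vertices of any type, gives the bound on the
  cover number.\<close>

section \<open>Polynomial-time functions\<close>

text \<open>The multiplicative weights give only a nearly optimal cover, so the exact form of
  complementary slackness, that an optimal matching saturates every vertex of positive value, is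
  lost. Two things make up for this. Weights are exponential in loads, so a vertex whose weight is
  within a factor \<open>t\<close> of the largest has nearly maximal load. And both cases have
  slack: \<open>heavy t < cover_factor t\<close> pays for the additive error of the cover, and the
  strict inequality of \<open>bad_count_bound\<close> pays for the surplus of saturated vertices.
  For fixed \<open>t\<close> both gaps are constants, so polynomially many steps suffice. Progress
  is measured by the size of the partial cover plus \<open>cover_factor t\<close> times the
  fractional optimum of the uncovered edges, which does not increase. The square root arises as
  follows: if none of \<open>heavy t\<close> saturated subsets of an edge has an even number of red
  elements, the edge has at least \<open>heavy t\<close> elements of one colour, hence at most about
  \<open>t / 2 - 2 * sqrt (t * ln t)\<close> of the other. When
  \<open>cover_factor t \<le> t\<close>, a random colouring is so unbalanced on a given
  \<open>(t - 1)\<close>-set with probability at most \<open>2 / t ^ 2\<close>.\<close>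

class encodable =
  fixes enc :: "'a \<Rightarrow> val"

instantiation nat :: encodable
begin
definition "enc_nat = Atom"
instance ..
end

instantiation bool :: encodable
begin
definition "enc_bool b = Atom (of_bool b)"
instance ..
end

instantiation prod :: (encodable, encodable) encodable
begin
definition "enc_prod x = Cell (enc (fst x)) (enc (snd x))"
instance ..
end

instantiation list :: (encodable) encodable
begin
definition "enc_list xs = foldr (\<lambda>x. Cell (enc x)) xs (Atom 0)"
instance ..
end

lemma enc_simps [simp]:
  "enc (n :: nat) = Atom n"
  "enc b = Atom (of_bool b)"
  "enc (x, y) = Cell (enc x) (enc y)"
  "enc [] = Atom 0"
  "enc (x # xs) = Cell (enc x) (enc xs)"
  by (simp_all add: enc_nat_def enc_bool_def enc_prod_def enc_list_def)

section \<open>Sizes of encoded values\<close>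

abbreviation sz :: "'a::encodable \<Rightarrow> nat" where
  "sz x \<equiv> bit_size (enc x)"

lemma sz_pair [simp]: "sz (x, y) = 1 + sz x + sz y"
  by simp

lemma sz_fst: "sz (fst p) \<le> sz p" and sz_snd: "sz (snd p) \<le> sz p"
  by (cases p; simp)+

lemma sz_mem: "x \<in> set xs \<Longrightarrow> sz x \<le> sz xs"
  by (induction xs) auto

lemma length_le_sz: "length xs \<le> sz xs"
  by (induction xs) auto

lemma sz_append: "sz (xs @ ys) + 1 = sz xs + sz ys"
  by (induction xs) (auto simp: floorlog_def)

lemma sz_filter: "sz (filter P xs) \<le> sz xs"
  by (induction xs) auto

lemma floorlog2_small [simp]: "floorlog 2 0 = 0" "floorlog 2 (Suc 0) = Suc 0"
  by (simp_all add: floorlog_def)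

lemma sz_bool: "sz (b :: bool) \<le> 2"
  by (cases b) auto

lemma sz_list_bound:
  assumes "\<And>x. x \<in> set xs \<Longrightarrow> sz x \<le> b"
  shows "sz xs \<le> 1 + length xs * (b + 1)"
  using assms by (induction xs) (auto simp: floorlog_def, fastforce)

lemma floorlog2_le_iff: "floorlog 2 n \<le> k \<longleftrightarrow> n < 2 ^ k"
  by (simp add: floorlog_le_iff)

lemma less_2_floorlog: "n < 2 ^ floorlog 2 n"
  using floorlog2_le_iff by blast

lemma sz_nat_mono: "m \<le> n \<Longrightarrow> sz (m :: nat) \<le> sz n"
  by (simp add: floorlog_mono)

lemma floorlog2_mult: "floorlog 2 (m * n) \<le> floorlog 2 m + floorlog 2 n"
proof -
  have "m * n < 2 ^ (floorlog 2 m + floorlog 2 n)"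
    unfolding power_add by (intro mult_strict_mono less_2_floorlog) auto
  then show ?thesis by (simp add: floorlog2_le_iff)
qed

lemma sz_nat_mult: "sz (m * n :: nat) \<le> sz m + sz n"
  using floorlog2_mult[of m n] by simp

lemma sz_nat_add: "sz (m + n :: nat) \<le> sz m + sz n"
proof (cases "m = 0 \<or> n = 0")
  case False
  then have "m + n \<le> (m * n) * 2"
    by (cases m; cases n) auto
  then have "sz (m + n) \<le> sz (m * n * 2)" by (rule sz_nat_mono)
  also have "\<dots> \<le> sz (m * n) + 1"
    using less_2_floorlog[of "m * n"] by (simp add: floorlog2_le_iff)
  finally have *: "floorlog 2 (m + n) \<le> floorlog 2 (m * n) + 1" by simp
  with floorlog2_mult[of m n] show ?thesis by simp
qed auto

lemma sz_nat_power: "sz (n ^ k :: nat) \<le> 2 + k * sz n"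
proof (induction k)
  case (Suc k)
  then show ?case using sz_nat_mult[of n "n ^ k"] by simp
qed simp

section \<open>Polynomial bounds\<close>

lemma poly_nat_mono:
  fixes q :: "nat poly"
  assumes "a \<le> b" shows "poly q a \<le> poly q b"
  using assms by (induction q) (auto intro!: add_mono mult_mono)

text \<open>Natural coefficients make these polynomials monotone, so an upper bound for a size may
  be inserted into them; closure under composition rests on this.\<close>

definition poly_bounded :: "('a::encodable \<Rightarrow> nat) \<Rightarrow> bool" where
  "poly_bounded f \<longleftrightarrow> (\<exists>q :: nat poly. \<forall>x. f x \<le> poly q (sz x))"

lemma poly_boundedI: "(\<And>x. f x \<le> poly q (sz x)) \<Longrightarrow> poly_bounded f"
  by (auto simp: poly_bounded_def)

lemma poly_boundedE:
  assumes "poly_bounded f" obtains q where "\<And>x. f x \<le> poly q (sz x)"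
  using assms unfolding poly_bounded_def by blast

lemma poly_bounded_mono: "poly_bounded g \<Longrightarrow> (\<And>x. f x \<le> g x) \<Longrightarrow> poly_bounded f"
  unfolding poly_bounded_def by (meson order_trans)

named_theorems poly_bounded_intros

lemma poly_bounded_const [poly_bounded_intros]: "poly_bounded (\<lambda>x. c)"
  by (rule poly_boundedI[of _ "[:c:]"]) simp

lemma poly_bounded_sz [poly_bounded_intros]: "poly_bounded (\<lambda>x. sz x)"
  by (rule poly_boundedI[of _ "[:0, 1:]"]) simp

lemma poly_bounded_add [poly_bounded_intros]: "poly_bounded f \<Longrightarrow> poly_bounded g \<Longrightarrow> poly_bounded (\<lambda>x. f x + g x)"
  unfolding poly_bounded_def by (metis add_mono poly_add)

lemma poly_bounded_mult [poly_bounded_intros]: "poly_bounded f \<Longrightarrow> poly_bounded g \<Longrightarrow> poly_bounded (\<lambda>x. f x * g x)"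
  unfolding poly_bounded_def by (metis mult_le_mono poly_mult)

lemma poly_bounded_poly [poly_bounded_intros]: "poly_bounded f \<Longrightarrow> poly_bounded (\<lambda>x. poly q (f x))"
  unfolding poly_bounded_def by (metis poly_nat_mono poly_pcompose)

text \<open>De Bruijn indices count from the front, so variables appended at the end are invisible.
  Code written for one variable can thus run under \<open>Bind\<close>, where the older input stays
  behind the new value.\<close>

lemma eval_env_append:
  assumes "eval p env e v c" shows "eval p (env @ env') e v c"
  using assms
proof (induction arbitrary: env' rule: eval.induct)
  case (Var i env)
  then show ?case using eval.Var[of i "env @ env'" p] by (simp add: nth_append)
qed (auto intro: eval.intros simp del: bit_size.simps One_nat_def)

text \<open>\<open>Call\<close> refers to absolute positions in the program, so code placed behind
  \<open>k\<close> other functions must have its calls shifted when two programs are linked.\<close>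

fun shift_calls :: "nat \<Rightarrow> exp \<Rightarrow> exp" where
  "shift_calls k (Var i) = Var i"
| "shift_calls k (Lit n) = Lit n"
| "shift_calls k (MkCell a b) = MkCell (shift_calls k a) (shift_calls k b)"
| "shift_calls k (Left a) = Left (shift_calls k a)"
| "shift_calls k (Right a) = Right (shift_calls k a)"
| "shift_calls k (IsCell a) = IsCell (shift_calls k a)"
| "shift_calls k (Op f a b) = Op f (shift_calls k a) (shift_calls k b)"
| "shift_calls k (Ite a b c) = Ite (shift_calls k a) (shift_calls k b) (shift_calls k c)"
| "shift_calls k (Bind a b) = Bind (shift_calls k a) (shift_calls k b)"
| "shift_calls k (Call f a) = Call (k + f) (shift_calls k a)"

lemma eval_link:
  assumes "eval p env e v c"
  shows "eval (pre @ map (shift_calls (length pre)) p @ post) env (shift_calls (length pre) e) v c"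
  using assms
proof (induction rule: eval.induct)
  case (Call env e v c f w d)
  then show ?case by (auto intro!: eval.intros simp: nth_append simp del: bit_size.simps One_nat_def)
qed (auto intro: eval.intros simp del: bit_size.simps One_nat_def)

lemma eval_program_append:
  assumes "eval p env e v c" shows "eval (p @ post) env e v c"
  using assms
proof (induction rule: eval.induct)
  case (Call env e v c f w d)
  then show ?case by (auto intro!: eval.intros simp: nth_append simp del: bit_size.simps One_nat_def)
qed (auto intro: eval.intros simp del: bit_size.simps One_nat_def)

lemma eval_size_le: "eval p env e v c \<Longrightarrow> bit_size v \<le> c"
  by (induction rule: eval.induct) auto

text \<open>The main expression is kept outside the function list \<open>p\<close>, so that closure
  proofs can link two lists and combine the expressions. The cost is only bounded, by a function of
  the input whose growth is polynomial, which spares exact cost formulas.\<close>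

definition poly_time :: "('a::encodable \<Rightarrow> 'b::encodable) \<Rightarrow> bool" where
  "poly_time f \<longleftrightarrow> (\<exists>p e b. poly_bounded b \<and> (\<forall>x. \<exists>c\<le>b x. eval p [enc x] e (enc (f x)) c))"

lemma poly_timeI:
  assumes "poly_bounded b" "\<And>x. \<exists>c\<le>b x. eval p [enc x] e (enc (f x)) c"
  shows "poly_time f"
  unfolding poly_time_def using assms by blast

lemma poly_timeE:
  assumes "poly_time f"
  obtains p e b where "poly_bounded b" "\<And>x. \<exists>c\<le>b x. eval p [enc x] e (enc (f x)) c"
  using assms unfolding poly_time_def by blast

lemma poly_time_size: "poly_time f \<Longrightarrow> poly_bounded (\<lambda>x. sz (f x))"
  by (erule poly_timeE, erule poly_bounded_mono) (meson eval_size_le order_trans)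

lemma poly_time_E2:
  assumes "poly_time f" "poly_time g"
  obtains p e e' b b' where "poly_bounded b" "poly_bounded b'"
    "\<And>x. \<exists>c\<le>b x. eval p [enc x] e (enc (f x)) c" "\<And>x. \<exists>c\<le>b' x. eval p [enc x] e' (enc (g x)) c"
proof -
  from assms(1) obtain p e b where 1: "poly_bounded b"
    "\<And>x. \<exists>c\<le>b x. eval p [enc x] e (enc (f x)) c" by (rule poly_timeE) blast
  from assms(2) obtain p' e' b' where 2: "poly_bounded b'"
    "\<And>x. \<exists>c\<le>b' x. eval p' [enc x] e' (enc (g x)) c" by (rule poly_timeE) blast
  show thesis
  proof (rule that[of b b' "p @ map (shift_calls (length p)) p'" e "shift_calls (length p) e'"])
    show "\<exists>c\<le>b x. eval (p @ map (shift_calls (length p)) p') [enc x] e (enc (f x)) c" for x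
      using 1(2)[of x] eval_program_append by blast
    show "\<exists>c\<le>b' x. eval (p @ map (shift_calls (length p)) p') [enc x] (shift_calls (length p) e')
        (enc (g x)) c" for x
      using 2(2)[of x] eval_link[of p' _ e' _ _ p "[]"] by auto
  qed fact+
qed

lemma poly_time_E3:
  assumes "poly_time f" "poly_time g" "poly_time h"
  obtains p e e' e'' b b' b'' where
    "poly_bounded b" "poly_bounded b'" "poly_bounded b''"
    "\<And>x. \<exists>c\<le>b x. eval p [enc x] e (enc (f x)) c"
    "\<And>x. \<exists>c\<le>b' x. eval p [enc x] e' (enc (g x)) c"
    "\<And>x. \<exists>c\<le>b'' x. eval p [enc x] e'' (enc (h x)) c"
proof -
  from assms(1,2) obtain p e e' b b' where 1: "poly_bounded b" "poly_bounded b'"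
    "\<And>x. \<exists>c\<le>b x. eval p [enc x] e (enc (f x)) c"
    "\<And>x. \<exists>c\<le>b' x. eval p [enc x] e' (enc (g x)) c" by (rule poly_time_E2) blast
  from assms(3) obtain p' e'' b'' where 2: "poly_bounded b''"
    "\<And>x. \<exists>c\<le>b'' x. eval p' [enc x] e'' (enc (h x)) c" by (rule poly_timeE) blast
  show thesis
  proof (rule that[of b b' b'' "p @ map (shift_calls (length p)) p'" e e' "shift_calls (length p) e''"])
    show "\<exists>c\<le>b x. eval (p @ map (shift_calls (length p)) p') [enc x] e (enc (f x)) c" for x
      using 1(3)[of x] eval_program_append by blast
    show "\<exists>c\<le>b' x. eval (p @ map (shift_calls (length p)) p') [enc x] e' (enc (g x)) c" for x
      using 1(4)[of x] eval_program_append by blast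
    show "\<exists>c\<le>b'' x. eval (p @ map (shift_calls (length p)) p') [enc x] (shift_calls (length p) e'')
        (enc (h x)) c" for x
      using 2(2)[of x] eval_link[of p' _ e'' _ _ p "[]"] by auto
  qed fact+
qed

section \<open>Closure properties of polynomial-time functions\<close>

named_theorems poly_time_intros

lemma poly_time_id [poly_time_intros]: "poly_time (\<lambda>x. x)"
proof (rule poly_timeI)
  show "\<exists>c\<le>sz x. eval [] [enc x] (Var 0) (enc x) c" for x
    using eval.Var[of 0 "[enc x]" "[]"] by auto
qed (rule poly_bounded_intros)

fun const_exp :: "val \<Rightarrow> exp" where
  "const_exp (Atom n) = Lit n"
| "const_exp (Cell v w) = MkCell (const_exp v) (const_exp w)"

lemma eval_const_exp: "\<exists>c. \<forall>env. eval p env (const_exp v) v c"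
proof (induction v)
  case (Atom n)
  then show ?case by (metis const_exp.simps(1) eval.Lit)
next
  case (Cell v w)
  then show ?case by (metis const_exp.simps(2) eval.MkCell)
qed

lemma poly_time_const [poly_time_intros]: "poly_time (\<lambda>x. a)"
proof -
  obtain c where "\<And>env. eval [] env (const_exp (enc a)) (enc a) c"
    using eval_const_exp by blast
  then show ?thesis
    by (intro poly_timeI[of "\<lambda>_. c" "[]" "const_exp (enc a)"] poly_bounded_intros) auto
qed

lemma poly_time_pair [poly_time_intros]:
  assumes "poly_time f" "poly_time g" shows "poly_time (\<lambda>x. (f x, g x))"
proof -
  from assms obtain p e e' b b' where b: "poly_bounded b" "poly_bounded b'"
    and ev: "\<And>x. \<exists>c\<le>b x. eval p [enc x] e (enc (f x)) c"
      "\<And>x. \<exists>c\<le>b' x. eval p [enc x] e' (enc (g x)) c" by (rule poly_time_E2) blast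
  show ?thesis
  proof (rule poly_timeI[where p = p and e = "MkCell e e'"])
    show "poly_bounded (\<lambda>x. b x + b' x + sz (f x, g x))"
      unfolding sz_pair using assms by (intro poly_bounded_intros poly_time_size b)
    show "\<exists>c\<le>b x + b' x + sz (f x, g x). eval p [enc x] (MkCell e e') (enc (f x, g x)) c" for x
    proof -
      obtain c c' where "c \<le> b x" "eval p [enc x] e (enc (f x)) c"
        "c' \<le> b' x" "eval p [enc x] e' (enc (g x)) c'" using ev by meson
      then show ?thesis
        by (intro exI[of _ "c + c' + sz (f x, g x)"]) (auto intro!: eval.MkCell simp del: bit_size.simps One_nat_def)
    qed
  qed
qed

text \<open>The cost of \<open>f\<close> is at most a polynomial in the size of \<open>g x\<close>,
  which is in turn polynomial in the size of \<open>x\<close>.\<close>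

lemma poly_time_comp:
  assumes "poly_time f" "poly_time g" shows "poly_time (\<lambda>x. f (g x))"
proof -
  from assms obtain p e e' b b' where b: "poly_bounded b" "poly_bounded b'"
    and ev: "\<And>x. \<exists>c\<le>b x. eval p [enc x] e (enc (f x)) c"
      "\<And>x. \<exists>c\<le>b' x. eval p [enc x] e' (enc (g x)) c" by (rule poly_time_E2) blast
  from b(1) obtain q where q: "\<And>y. b y \<le> poly q (sz y)" by (auto simp: poly_bounded_def)
  have pf: "poly_bounded (\<lambda>x. sz (f (g x)))"
  proof (rule poly_bounded_mono[of "\<lambda>x. poly q (sz (g x))"])
    show "sz (f (g x)) \<le> poly q (sz (g x))" for x
      by (meson ev(1) eval_size_le order_trans q)
  qed (intro poly_bounded_intros poly_time_size assms)
  show ?thesis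
  proof (rule poly_timeI[where p = p and e = "Bind e' e"])
    show "poly_bounded (\<lambda>x. b' x + poly q (sz (g x)) + sz (f (g x)))"
      using assms by (intro poly_bounded_intros poly_time_size b pf)
    show "\<exists>c\<le>b' x + poly q (sz (g x)) + sz (f (g x)). eval p [enc x] (Bind e' e) (enc (f (g x))) c" for x
    proof -
      obtain c c' where "c \<le> b (g x)" "eval p [enc (g x)] e (enc (f (g x))) c"
        and c': "c' \<le> b' x" "eval p [enc x] e' (enc (g x)) c'" using ev by meson
      with q[of "g x"] have "c \<le> poly q (sz (g x))"
        "eval p (enc (g x) # [enc x]) e (enc (f (g x))) c"
        using eval_env_append[of p "[enc (g x)]" e _ c "[enc x]"] by auto
      with c' show ?thesis
        by (intro exI[of _ "c' + c + sz (f (g x))"]) (auto intro!: eval.Bind)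
    qed
  qed
qed

lemma poly_time_comp2: "poly_time (\<lambda>z. f (fst z) (snd z)) \<Longrightarrow> poly_time a \<Longrightarrow> poly_time b \<Longrightarrow> poly_time (\<lambda>x. f (a x) (b x))"
  using poly_time_comp[OF _ poly_time_pair, of "\<lambda>z. f (fst z) (snd z)" a b] by simp

lemma poly_time_fst [poly_time_intros]: assumes "poly_time g" shows "poly_time (\<lambda>x. fst (g x))"
proof (rule poly_time_comp[OF _ assms])
  show "poly_time (fst :: 'b \<times> 'c \<Rightarrow> 'b)"
  proof (rule poly_timeI[where p = "[]" and e = "Left (Var 0)" and b = "\<lambda>x. sz x + sz x"])
    fix x :: "'b \<times> 'c"
    have "eval [] [enc x] (Left (Var 0)) (enc (fst x)) (sz x + sz (fst x))"
      using eval.Var[of 0 "[enc x]" "[]"] by (intro eval.Left[where ?v2.0 = "enc (snd x)"]) (auto simp: enc_prod_def)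
    then show "\<exists>c\<le>sz x + sz x. eval [] [enc x] (Left (Var 0)) (enc (fst x)) c"
      using sz_fst[of x] by (meson add_left_mono)
  qed (intro poly_bounded_intros)
qed

lemma poly_time_snd [poly_time_intros]: assumes "poly_time g" shows "poly_time (\<lambda>x. snd (g x))"
proof (rule poly_time_comp[OF _ assms])
  show "poly_time (snd :: 'b \<times> 'c \<Rightarrow> 'c)"
  proof (rule poly_timeI[where p = "[]" and e = "Right (Var 0)" and b = "\<lambda>x. sz x + sz x"])
    fix x :: "'b \<times> 'c"
    have "eval [] [enc x] (Right (Var 0)) (enc (snd x)) (sz x + sz (snd x))"
      using eval.Var[of 0 "[enc x]" "[]"] by (intro eval.Right[where ?v1.0 = "enc (fst x)"]) (auto simp: enc_prod_def)
    then show "\<exists>c\<le>sz x + sz x. eval [] [enc x] (Right (Var 0)) (enc (snd x)) c"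
      using sz_snd[of x] by (meson add_left_mono)
  qed (intro poly_bounded_intros)
qed

lemma poly_time_if [poly_time_intros]:
  assumes "poly_time c" "poly_time f" "poly_time g" shows "poly_time (\<lambda>x. if c x then f x else g x)"
proof -
  from assms obtain p e0 e e' b0 b b' where b: "poly_bounded b0" "poly_bounded b" "poly_bounded b'"
    and ev: "\<And>x. \<exists>k\<le>b0 x. eval p [enc x] e0 (enc (c x)) k"
      "\<And>x. \<exists>c\<le>b x. eval p [enc x] e (enc (f x)) c"
      "\<And>x. \<exists>c\<le>b' x. eval p [enc x] e' (enc (g x)) c" by (rule poly_time_E3) blast
  show ?thesis
  proof (rule poly_timeI[where p = p and e = "Ite e0 e e'"])
    show "poly_bounded (\<lambda>x. b0 x + (b x + sz (f x)) + (b' x + sz (g x)))"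
      using assms by (intro poly_bounded_intros poly_time_size b)
    fix x
    obtain k c1 c2 where k: "k \<le> b0 x" "eval p [enc x] e0 (enc (c x)) k"
      "c1 \<le> b x" "eval p [enc x] e (enc (f x)) c1" "c2 \<le> b' x" "eval p [enc x] e' (enc (g x)) c2"
      using ev by meson
    show "\<exists>ca\<le>b0 x + (b x + sz (f x)) + (b' x + sz (g x)).
       eval p [enc x] (Ite e0 e e') (enc (if c x then f x else g x)) ca"
    proof (cases "c x")
      case True
      with k have "eval p [enc x] (Ite e0 e e') (enc (f x)) (k + c1 + sz (f x))"
        by (intro eval.Ite_True[where v = "Atom 1"]) auto
      with True k show ?thesis by (intro exI[of _ "k + c1 + sz (f x)"]) auto
    next
      case False
      with k have "eval p [enc x] (Ite e0 e e') (enc (g x)) (k + c2 + sz (g x))"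
        by (intro eval.Ite_False) auto
      with False k show ?thesis by (intro exI[of _ "k + c2 + sz (g x)"]) auto
    qed
  qed
qed

lemma poly_time_op:
  assumes "poly_time f" "poly_time g" shows "poly_time (\<lambda>x. apply_op opr (f x) (g x))"
proof -
  from assms obtain p e e' b b' where b: "poly_bounded b" "poly_bounded b'"
    and ev: "\<And>x. \<exists>c\<le>b x. eval p [enc x] e (enc (f x)) c"
      "\<And>x. \<exists>c\<le>b' x. eval p [enc x] e' (enc (g x)) c" by (rule poly_time_E2) blast
  have le: "sz (apply_op opr m n) \<le> sz m + sz n + 2" for m n
  proof (cases opr)
    case Divide
    then show ?thesis using sz_nat_mono[of "m div n" m] by simp
  next
    case Minus
    then show ?thesis using sz_nat_mono[of "m - n" m] by simp
  qed (use sz_nat_add[of m n] sz_nat_mult[of m n] in \<open>auto simp: floorlog_eq_if\<close>)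
  show ?thesis
  proof (rule poly_timeI[where p = p and e = "Op opr e e'"])
    show "poly_bounded (\<lambda>x. b x + b' x + (sz (f x) + sz (g x) + 2))"
      using assms by (intro poly_bounded_intros poly_time_size b)
    fix x
    obtain c1 c2 where k: "c1 \<le> b x" "eval p [enc x] e (enc (f x)) c1"
      "c2 \<le> b' x" "eval p [enc x] e' (enc (g x)) c2"
      using ev by meson
    then have "eval p [enc x] (Op opr e e') (enc (apply_op opr (f x) (g x))) (c1 + c2 + sz (apply_op opr (f x) (g x)))"
      by (auto intro!: eval.Op simp del: bit_size.simps One_nat_def)
    with k le[of "f x" "g x"] show "\<exists>c\<le>b x + b' x + (sz (f x) + sz (g x) + 2).
       eval p [enc x] (Op opr e e') (enc (apply_op opr (f x) (g x))) c"
      by (meson add_mono)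
  qed
qed

lemma poly_time_plus [poly_time_intros]: "poly_time f \<Longrightarrow> poly_time g \<Longrightarrow> poly_time (\<lambda>x. f x + g x :: nat)"
  using poly_time_op[of f g Plus] by simp

lemma poly_time_times [poly_time_intros]: "poly_time f \<Longrightarrow> poly_time g \<Longrightarrow> poly_time (\<lambda>x. f x * g x :: nat)"
  using poly_time_op[of f g Times] by simp

lemma poly_time_less [poly_time_intros]: assumes "poly_time f" "poly_time g" shows "poly_time (\<lambda>x. f x < (g x :: nat))"
proof -
  have "enc (m < n) = enc (apply_op Less m n)" for m n
    by simp
  then show ?thesis using poly_time_op[OF assms, of Less] unfolding poly_time_def by simp
qed

lemma poly_time_not [poly_time_intros]: "poly_time f \<Longrightarrow> poly_time (\<lambda>x. \<not> f x)"
  using poly_time_if[of f "\<lambda>_. False" "\<lambda>_. True"] unfolding if_bool_eq_conj by (simp add: poly_time_const)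

lemma poly_time_conj [poly_time_intros]: "poly_time f \<Longrightarrow> poly_time g \<Longrightarrow> poly_time (\<lambda>x. f x \<and> g x)"
  using poly_time_if[of f g "\<lambda>_. False"] unfolding if_bool_eq_disj by (simp add: poly_time_const)

lemma poly_time_disj [poly_time_intros]: "poly_time f \<Longrightarrow> poly_time g \<Longrightarrow> poly_time (\<lambda>x. f x \<or> g x)"
  using poly_time_if[of f "\<lambda>_. True" g] unfolding if_bool_eq_conj by (simp add: poly_time_const disj_imp)

lemma poly_time_le [poly_time_intros]: "poly_time f \<Longrightarrow> poly_time g \<Longrightarrow> poly_time (\<lambda>x. f x \<le> (g x :: nat))"
  using poly_time_not[OF poly_time_less, of g f] by (simp add: not_less)

lemma poly_time_eq [poly_time_intros]: "poly_time f \<Longrightarrow> poly_time g \<Longrightarrow> poly_time (\<lambda>x. f x = (g x :: nat))"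
  using poly_time_conj[OF poly_time_le poly_time_le, of f g g f] by (simp add: eq_iff)

lemma poly_time_Cons [poly_time_intros]: assumes "poly_time f" "poly_time g" shows "poly_time (\<lambda>x. f x # g x)"
proof -
  have "enc (a # b) = enc (a, b)" for a :: 'b and b by simp
  then show ?thesis using poly_time_pair[OF assms] unfolding poly_time_def by metis
qed

lemma poly_time_null [poly_time_intros]: assumes "poly_time g" shows "poly_time (\<lambda>x. g x = [])"
proof (rule poly_time_comp[OF poly_time_comp[of Not "\<lambda>xs. xs \<noteq> []", simplified] assms])
  show "poly_time Not" using poly_time_not[OF poly_time_id] by simp
  show "poly_time (\<lambda>xs::'b list. xs \<noteq> [])"
  proof (rule poly_timeI[where p = "[]" and e = "IsCell (Var 0)" and b = "\<lambda>x. sz x + 2"])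
    fix xs :: "'b list"
    have 1: "eval [] [enc xs] (Var 0) (enc xs) (sz xs)"
      using eval.Var[of 0 "[enc xs]" "[]"] by auto
    have "eval [] [enc xs] (IsCell (Var 0)) (enc (xs \<noteq> [])) (sz xs + sz (xs \<noteq> []))"
      using 1 by (cases xs) (auto intro!: eval.IsCell_Atom eval.IsCell_Cell simp del: bit_size.simps One_nat_def)
    then show "\<exists>c\<le>sz xs + 2. eval [] [enc xs] (IsCell (Var 0)) (enc (xs \<noteq> [])) c"
      using sz_bool[of "xs \<noteq> []"] by (meson add_left_mono)
  qed (intro poly_bounded_intros)
qed

lemma poly_time_hd [poly_time_intros]: assumes "poly_time g" shows "poly_time (\<lambda>x. hd (g x))"
proof (rule poly_time_comp[OF _ assms])
  \<comment> \<open>\<open>hd []\<close> is unspecified but is one fixed value; its encoding is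
    built into the program, which thereby computes the total function \<open>hd\<close>.\<close>
  obtain k where k: "\<And>env. eval [] env (const_exp (enc (hd [] :: 'b))) (enc (hd [] :: 'b)) k"
    using eval_const_exp by blast
  let ?e = "Ite (IsCell (Var 0)) (Left (Var 0)) (const_exp (enc (hd [] :: 'b)))"
  let ?b = "\<lambda>x. sz x + 2 + sz x + sz x + sz x + k + sz (hd [] :: 'b)"
  show "poly_time (hd :: 'b list \<Rightarrow> 'b)"
  proof (rule poly_timeI[where p = "[]" and e = ?e and b = ?b])
    fix xs :: "'b list"
    have 1: "eval [] [enc xs] (Var 0) (enc xs) (sz xs)"
      using eval.Var[of 0 "[enc xs]" "[]"] by auto
    show "\<exists>c\<le>?b xs. eval [] [enc xs] ?e (enc (hd xs)) c"
    proof (cases xs)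
      case Nil
      from Nil have "eval [] [enc xs] (IsCell (Var 0)) (Atom 0) (sz xs + bit_size (Atom 0))"
        using 1 by (intro eval.IsCell_Atom[where n = 0]) simp
      from eval.Ite_False[OF this k] have "eval [] [enc xs] ?e (enc (hd xs))
          (sz xs + bit_size (Atom 0) + k + sz (hd xs))" using Nil by simp
      then show ?thesis using Nil
        by (intro exI[of _ "sz xs + bit_size (Atom 0) + k + sz (hd xs)"]) auto
    next
      case (Cons y ys)
      from Cons have a: "eval [] [enc xs] (IsCell (Var 0)) (Atom 1) (sz xs + bit_size (Atom 1))"
        using 1 by (intro eval.IsCell_Cell[of _ _ _ "enc y" "enc ys"]) simp
      from Cons have "eval [] [enc xs] (Left (Var 0)) (enc y) (sz xs + sz y)"
        using 1 by (intro eval.Left[of _ _ _ _ "enc ys"]) simp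
      from eval.Ite_True[OF a _ this] have "eval [] [enc xs] ?e (enc (hd xs))
          (sz xs + bit_size (Atom 1) + (sz xs + sz y) + sz y)" using Cons by simp
      then show ?thesis using Cons
        by (intro exI[of _ "sz xs + bit_size (Atom 1) + (sz xs + sz y) + sz y"]) auto
    qed
  qed (intro poly_bounded_intros)
qed

text \<open>Loops exist only as recursion through \<open>Call\<close>. The argument is a triple
  \<open>(x, ys, a)\<close>: the recursive call replaces \<open>ys\<close> by its tail, and
  \<open>step\<close> then runs with \<open>(x, y, acc)\<close> as variable 0, where
  \<open>acc\<close> is the result of that call.\<close>

definition foldr_body :: "nat \<Rightarrow> exp \<Rightarrow> exp" where
  "foldr_body self step =
     Ite (IsCell (Left (Right (Var 0))))
       (Bind (MkCell (Left (Var 0)) (MkCell (Left (Left (Right (Var 0))))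
          (Call self (MkCell (Left (Var 0)) (MkCell (Right (Left (Right (Var 0)))) (Right (Right (Var 0))))))))
        step)
       (Right (Right (Var 0)))"

lemma eval_Var0: "eval p (v # env) (Var 0) v (bit_size v)"
  using eval.Var[of 0 "v # env" p] by simp

text \<open>\<open>B\<close> bounds the accumulators of all suffixes, so \<open>step\<close> need
  only be cheap on those, and each level of the recursion has the same cost bound. The coefficients
  40 and 10 are generous counts of the copies of data that one level produces.\<close>

lemma eval_foldr_body:
  fixes f :: "'a::encodable \<Rightarrow> 'b::encodable \<Rightarrow> 'c::encodable \<Rightarrow> 'c"
  assumes step: "\<And>y acc. y \<in> set ys \<Longrightarrow> sz acc \<le> B \<Longrightarrow> \<exists>c\<le>q. eval P [enc (x, y, acc)] step (enc (f x y acc)) c"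
    and self: "self < length P" "P ! self = foldr_body self step"
    and B: "\<And>zs us. ys = zs @ us \<Longrightarrow> sz (foldr (f x) us a) \<le> B"
    and M: "sz x + sz ys + sz a + 3 \<le> M"
  shows "\<exists>c \<le> (length ys + 1) * (40 * M + 10 * B + q).
     eval P [enc (x, ys, a)] (P ! self) (enc (foldr (f x) ys a)) c"
  using step B M
proof (induction ys)
  case Nil
  let ?v = "enc (x, [] :: 'b list, a)" and ?k = "bit_size (Atom 0)"
  note v = eval_Var0[of P ?v "[]"]
  have r: "eval P [?v] (Right (Var 0)) (enc ([] :: 'b list, a)) (bit_size ?v + sz ([] :: 'b list, a))"
    using v by (intro eval.Right[where ?v1.0 = "enc x"]) simp
  have rr: "eval P [?v] (Right (Right (Var 0))) (enc a) (bit_size ?v + sz ([] :: 'b list, a) + sz a)"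
    using r by (intro eval.Right[where ?v1.0 = "enc ([] :: 'b list)"]) simp
  have rl: "eval P [?v] (Left (Right (Var 0))) (Atom 0) (bit_size ?v + sz ([] :: 'b list, a) + ?k)"
    using r by (intro eval.Left[where ?v2.0 = "enc a"]) simp
  have "eval P [?v] (P ! self) (enc (foldr (f x) [] a)) (bit_size ?v + sz ([] :: 'b list, a) + ?k + ?k +
      (bit_size ?v + sz ([] :: 'b list, a) + sz a) + sz a)"
    unfolding self(2) foldr_body_def using eval.Ite_False[OF eval.IsCell_Atom[OF rl] rr] by simp
  moreover have "bit_size ?v + sz ([] :: 'b list, a) + ?k + ?k +
      (bit_size ?v + sz ([] :: 'b list, a) + sz a) + sz a \<le> (length ([] :: 'b list) + 1) * (40 * M + 10 * B + q)"
    using Nil.prems(3) by simp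
  ultimately show ?case by blast
next
  case (Cons y ys)
  let ?v = "enc (x, y # ys, a)" and ?r = "foldr (f x) ys a"
  have "\<exists>c \<le> (length ys + 1) * (40 * M + 10 * B + q).
     eval P [enc (x, ys, a)] (P ! self) (enc ?r) c"
  proof (rule Cons.IH)
    show "\<exists>c\<le>q. eval P [enc (x, y, acc)] step (enc (f x y acc)) c" if "y \<in> set ys" "sz acc \<le> B" for y acc
      using Cons.prems(1)[of y acc] that by simp
    show "sz (foldr (f x) us a) \<le> B" if "ys = zs @ us" for zs us
      using Cons.prems(2)[of "y # zs" us] that by simp
  qed (use Cons.prems(3) in simp)
  then obtain c where c: "c \<le> (length ys + 1) * (40 * M + 10 * B + q)"
    "eval P [enc (x, ys, a)] (P ! self) (enc ?r) c" by blast
  have rB: "sz ?r \<le> B" using Cons.prems(2)[of "[y]" ys] by simp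
  have fB: "sz (f x y ?r) \<le> B" using Cons.prems(2)[of "[]" "y # ys"] by simp
  obtain d where d: "d \<le> q" "eval P [enc (x, y, ?r)] step (enc (f x y ?r)) d"
    using Cons.prems(1)[of y ?r] rB by auto
  note v = eval_Var0[of P ?v "[]"]
  have l: "eval P [?v] (Left (Var 0)) (enc x) (bit_size ?v + sz x)"
    using v by (intro eval.Left[where ?v2.0 = "enc (y # ys, a)"]) simp
  have r: "eval P [?v] (Right (Var 0)) (enc (y # ys, a)) (bit_size ?v + sz (y # ys, a))"
    using v by (intro eval.Right[where ?v1.0 = "enc x"]) simp
  have rr: "eval P [?v] (Right (Right (Var 0))) (enc a) (bit_size ?v + sz (y # ys, a) + sz a)"
    using r by (intro eval.Right[where ?v1.0 = "enc (y # ys)"]) simp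
  have rl: "eval P [?v] (Left (Right (Var 0))) (enc (y # ys)) (bit_size ?v + sz (y # ys, a) + sz (y # ys))"
    using r by (intro eval.Left[where ?v2.0 = "enc a"]) simp
  have rll: "eval P [?v] (Left (Left (Right (Var 0)))) (enc y) (bit_size ?v + sz (y # ys, a) + sz (y # ys) + sz y)"
    using rl by (intro eval.Left[where ?v2.0 = "enc ys"]) simp
  have rlr: "eval P [?v] (Right (Left (Right (Var 0)))) (enc ys) (bit_size ?v + sz (y # ys, a) + sz (y # ys) + sz ys)"
    using rl by (intro eval.Right[where ?v1.0 = "enc y"]) simp
  have cond: "eval P [?v] (IsCell (Left (Right (Var 0)))) (Atom 1)
      (bit_size ?v + sz (y # ys, a) + sz (y # ys) + bit_size (Atom 1))"
    using rl by (intro eval.IsCell_Cell[where ?v1.0 = "enc y" and ?v2.0 = "enc ys"]) simp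
  have d': "eval P [enc (x, y, ?r), ?v] step (enc (f x y ?r)) d"
    using eval_env_append[OF d(2), of "[?v]"] by simp
  note call = eval.Call[OF eval.MkCell[OF l eval.MkCell[OF rlr rr]] self(1), folded enc_simps(3), OF c(2)]
  note ev = eval.Ite_True[OF cond _ eval.Bind[OF eval.MkCell[OF l eval.MkCell[OF rll call]], folded enc_simps(3), OF d']]
  have "\<exists>k \<le> 40 * M + 10 * B + q + c. eval P [?v] (P ! self) (enc (f x y ?r)) k"
    unfolding self(2) foldr_body_def
    by (intro exI conjI, rule_tac[2] ev) (use Cons.prems(3) rB fB d(1) in auto)
  then obtain k where k: "k \<le> 40 * M + 10 * B + q + c" "eval P [?v] (P ! self) (enc (f x y ?r)) k"
    by blast
  have "k \<le> (length (y # ys) + 1) * (40 * M + 10 * B + q)"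
    using k(1) c(1) by (simp add: algebra_simps)
  with k(2) show ?case by auto
qed

text \<open>Iterating a polynomial-time function can create values of exponential size, as repeated
  squaring does; the bound \<open>B\<close> on all intermediate accumulators excludes this.\<close>

lemma poly_time_foldr:
  fixes f :: "'a::encodable \<Rightarrow> 'b::encodable \<Rightarrow> 'c::encodable \<Rightarrow> 'c"
  assumes f: "poly_time (\<lambda>z. f (fst z) (fst (snd z)) (snd (snd z)))" and l: "poly_time l" and a: "poly_time a"
    and B: "poly_bounded B" "\<And>x zs ys. l x = zs @ ys \<Longrightarrow> sz (foldr (f x) ys (a x)) \<le> B x"
  shows "poly_time (\<lambda>x. foldr (f x) (l x) (a x))"
proof -
  from f l a obtain p ef el ea bf bl ba where b: "poly_bounded bf" "poly_bounded bl" "poly_bounded ba"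
    and ef: "\<And>z. \<exists>c\<le>bf z. eval p [enc z] ef (enc (f (fst z) (fst (snd z)) (snd (snd z)))) c"
    and el: "\<And>x. \<exists>c\<le>bl x. eval p [enc x] el (enc (l x)) c"
    and ea: "\<And>x. \<exists>c\<le>ba x. eval p [enc x] ea (enc (a x)) c"
    by (rule poly_time_E3) blast
  from b(1) obtain q where q: "\<And>z. bf z \<le> poly q (sz z)" by (rule poly_boundedE) blast
  define self where "self = length p"
  define P where "P = p @ [foldr_body self ef]"
  have P: "self < length P" "P ! self = foldr_body self ef"
    by (auto simp: P_def self_def nth_append)
  define M where "M x = sz x + sz (l x) + sz (a x) + 3" for x
  define K where "K x = (sz (l x) + 1) * (40 * M x + 10 * B x + poly q (M x + B x))" for x
  define main where "main = Call self (MkCell (Var 0) (MkCell el ea))"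
  have pbM: "poly_bounded M"
    unfolding M_def by (intro poly_bounded_intros poly_time_size l a)
  have pbK: "poly_bounded K"
    unfolding K_def by (intro poly_bounded_intros poly_time_size pbM B l a)
  show ?thesis
  proof (rule poly_timeI[where p = P and e = main])
    show "poly_bounded (\<lambda>x. bl x + ba x + 3 * M x + K x + B x)"
      by (intro poly_bounded_intros b pbM pbK B)
    fix x
    obtain cl where cl: "cl \<le> bl x" "eval P [enc x] el (enc (l x)) cl"
      using el[of x] eval_program_append unfolding P_def by blast
    obtain ca where ca: "ca \<le> ba x" "eval P [enc x] ea (enc (a x)) ca"
      using ea[of x] eval_program_append unfolding P_def by blast
    have "\<exists>c \<le> (length (l x) + 1) * (40 * M x + 10 * B x + poly q (M x + B x)).
       eval P [enc (x, l x, a x)] (P ! self) (enc (foldr (f x) (l x) (a x))) c"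
    proof (rule eval_foldr_body[OF _ P])
      fix y and acc :: 'c assume y: "y \<in> set (l x)" and acc: "sz acc \<le> B x"
      obtain c where c: "c \<le> bf (x, y, acc)" "eval p [enc (x, y, acc)] ef (enc (f x y acc)) c"
        using ef[of "(x, y, acc)"] by auto
      have "sz (x, y, acc) \<le> M x + B x"
        using sz_mem[OF y] acc by (simp add: M_def)
      with q[of "(x, y, acc)"] c(1) have "c \<le> poly q (M x + B x)"
        using poly_nat_mono order_trans by metis
      with c(2) show "\<exists>c\<le>poly q (M x + B x). eval P [enc (x, y, acc)] ef (enc (f x y acc)) c"
        unfolding P_def using eval_program_append by blast
    qed (auto simp: M_def intro: B)
    then obtain c where c: "c \<le> (length (l x) + 1) * (40 * M x + 10 * B x + poly q (M x + B x))"
       "eval P [enc (x, l x, a x)] (P ! self) (enc (foldr (f x) (l x) (a x))) c" by blast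
    from c(1) have cK: "c \<le> K x"
      unfolding K_def using length_le_sz[of "l x"] by (meson add_mono le_refl mult_le_mono1 order_trans)
    have Bx: "sz (foldr (f x) (l x) (a x)) \<le> B x" using B(2)[of x "[]" "l x"] by simp
    note ev = eval.Call[OF eval.MkCell[OF eval_Var0 eval.MkCell[OF cl(2) ca(2)]] P(1), folded enc_simps(3), OF c(2)]
    show "\<exists>c\<le>bl x + ba x + 3 * M x + K x + B x. eval P [enc x] main (enc (foldr (f x) (l x) (a x))) c"
      unfolding main_def
      by (intro exI conjI, rule_tac[2] ev) (use cK Bx cl ca in \<open>auto simp: M_def\<close>)
  qed
qed

text \<open>If one step enlarges the accumulator by an amount that depends only on \<open>x\<close>
  and the list element, the sizes add up along the list and cannot multiply.\<close>

lemma poly_time_foldr_additive: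
  fixes f :: "'a::encodable \<Rightarrow> 'b::encodable \<Rightarrow> 'c::encodable \<Rightarrow> 'c"
  assumes f: "poly_time (\<lambda>z. f (fst z) (fst (snd z)) (snd (snd z)))" and l: "poly_time l" and a: "poly_time a"
    and g: "poly_bounded g" "\<And>x y acc. y \<in> set (l x) \<Longrightarrow> sz (f x y acc) \<le> sz acc + g (x, y)"
  shows "poly_time (\<lambda>x. foldr (f x) (l x) (a x))"
proof -
  from g(1) obtain q where q: "\<And>z. g z \<le> poly q (sz z)" by (rule poly_boundedE) blast
  show ?thesis
  proof (rule poly_time_foldr[OF f l a])
    show "poly_bounded (\<lambda>x. sz (a x) + sz (l x) * poly q (1 + sz x + sz (l x)))"
      by (intro poly_bounded_intros poly_time_size l a)
    fix x zs ys assume lx: "l x = zs @ ys"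
    have "sz (foldr (f x) ys (a x)) \<le> sz (a x) + length ys * poly q (1 + sz x + sz (l x))"
      if "set ys \<subseteq> set (l x)" for ys
      using that
    proof (induction ys)
      case (Cons y ys)
      have "sz (x, y) \<le> 1 + sz x + sz (l x)" using sz_mem[of y "l x"] Cons.prems by simp
      then have "g (x, y) \<le> poly q (1 + sz x + sz (l x))"
        using q[of "(x, y)"] poly_nat_mono order_trans by metis
      moreover have "sz (f x y (foldr (f x) ys (a x))) \<le> sz (foldr (f x) ys (a x)) + g (x, y)"
        using Cons.prems by (intro g) auto
      moreover have "sz (foldr (f x) ys (a x)) \<le> sz (a x) + length ys * poly q (1 + sz x + sz (l x))"
        using Cons by simp
      ultimately show ?case by (simp only: foldr_Cons o_apply list.size) (simp add: algebra_simps)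
    qed simp
    from this[of ys] lx have "sz (foldr (f x) ys (a x)) \<le> sz (a x) + length ys * poly q (1 + sz x + sz (l x))"
      by simp
    moreover have "length ys \<le> sz (l x)"
      using length_le_sz[of "l x"] unfolding lx by simp
    ultimately show "sz (foldr (f x) ys (a x)) \<le> sz (a x) + sz (l x) * poly q (1 + sz x + sz (l x))"
      by (meson add_left_mono mult_le_mono1 order_trans)
  qed
qed

section \<open>List operations and finite tables\<close>

lemma poly_time_append [poly_time_intros]: assumes "poly_time f" "poly_time g" shows "poly_time (\<lambda>x. f x @ g x)"
proof -
  have "poly_time (\<lambda>x. foldr (\<lambda>y acc. y # acc) (f x) (g x))"
    by (rule poly_time_foldr_additive[where g = "\<lambda>z. sz z"]) (intro poly_time_intros assms poly_bounded_intros | simp)+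
  moreover have "foldr (\<lambda>y acc. y # acc) ys zs = ys @ zs" for ys zs :: "'b list"
    by (induction ys) auto
  ultimately show ?thesis by simp
qed

lemma poly_time_map [poly_time_intros]:
  assumes f: "poly_time (\<lambda>z. f (fst z) (snd z))" and l: "poly_time l" shows "poly_time (\<lambda>x. map (f x) (l x))"
proof -
  have "poly_time (\<lambda>z. (f (fst z) (fst (snd z))))"
    by (intro poly_time_comp2[OF f] poly_time_intros)
  then have "poly_time (\<lambda>x. foldr (\<lambda>y acc. f x y # acc) (l x) [])"
    by (intro poly_time_foldr_additive[where g = "\<lambda>z. 1 + sz (f (fst z) (snd z))"]) 
      (intro poly_time_intros l poly_bounded_intros poly_time_size f | simp)+
  moreover have "foldr (\<lambda>y acc. f x y # acc) ys [] = map (f x) ys" for x ys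
    by (induction ys) auto
  ultimately show ?thesis by simp
qed

lemma poly_time_filter [poly_time_intros]:
  assumes P: "poly_time (\<lambda>z. P (fst z) (snd z))" and l: "poly_time l" shows "poly_time (\<lambda>x. filter (P x) (l x))"
proof -
  have "poly_time (\<lambda>z. P (fst z) (fst (snd z)))"
    by (intro poly_time_comp2[OF P] poly_time_intros)
  then have "poly_time (\<lambda>x. foldr (\<lambda>y acc. if P x y then y # acc else acc) (l x) [])"
    by (intro poly_time_foldr_additive[where g = "\<lambda>z. sz z"]) 
      (intro poly_time_intros l poly_bounded_intros | simp)+
  moreover have "foldr (\<lambda>y acc. if P x y then y # acc else acc) ys [] = filter (P x) ys" for x ys
    by (induction ys) auto
  ultimately show ?thesis by simp
qed

lemma poly_time_sum_list [poly_time_intros]: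
  assumes f: "poly_time (\<lambda>z. f (fst z) (snd z))" and l: "poly_time l" shows "poly_time (\<lambda>x. \<Sum>y\<leftarrow>l x. f x y :: nat)"
proof -
  have "poly_time (\<lambda>z. f (fst z) (fst (snd z)))"
    by (intro poly_time_comp2[OF f] poly_time_intros)
  then have "poly_time (\<lambda>x. foldr (\<lambda>y acc. acc + f x y) (l x) 0)"
    by (intro poly_time_foldr_additive[where g = "\<lambda>z. sz (f (fst z) (snd z))"]) 
      (intro poly_time_intros l poly_bounded_intros poly_time_size f | simp del: enc_simps add: sz_nat_add)+
  moreover have "foldr (\<lambda>y acc. acc + f x y) ys 0 = (\<Sum>y\<leftarrow>ys. f x y)" for x ys
    by (induction ys) auto
  ultimately show ?thesis by simp
qed

lemma poly_time_ex [poly_time_intros]: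
  assumes f: "poly_time (\<lambda>z. P (fst z) (snd z))" and l: "poly_time l" shows "poly_time (\<lambda>x. \<exists>y\<in>set (l x). P x y)"
proof -
  have "poly_time (\<lambda>z. P (fst z) (fst (snd z)))"
    by (intro poly_time_comp2[OF f] poly_time_intros)
  moreover have "sz (a :: bool) \<le> sz b + 2" for a b using sz_bool[of a] by simp
  ultimately have "poly_time (\<lambda>x. foldr (\<lambda>y acc. P x y \<or> acc) (l x) False)"
    by (intro poly_time_foldr_additive[where g = "\<lambda>z. 2"]) 
      (intro poly_time_intros l poly_bounded_intros poly_time_size f | simp only: )+
  moreover have "foldr (\<lambda>y acc. P x y \<or> acc) ys False = (\<exists>y\<in>set ys. P x y)" for x ys
    by (induction ys) auto
  ultimately show ?thesis by simp
qed

lemma poly_time_all [poly_time_intros]: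
  assumes f: "poly_time (\<lambda>z. P (fst z) (snd z))" and l: "poly_time l" shows "poly_time (\<lambda>x. \<forall>y\<in>set (l x). P x y)"
  using poly_time_not[OF poly_time_ex, OF poly_time_not, OF f l] by simp

lemma poly_time_length [poly_time_intros]: "poly_time l \<Longrightarrow> poly_time (\<lambda>x. length (l x))"
  using poly_time_sum_list[of "\<lambda>_ _. 1" l] by (simp add: poly_time_const sum_list_triv)

lemma poly_time_concat [poly_time_intros]: assumes "poly_time l" shows "poly_time (\<lambda>x. concat (l x))"
proof -
  have "poly_time (\<lambda>x. foldr (\<lambda>y acc. y @ acc) (l x) [])"
  proof (rule poly_time_foldr_additive[where g = "\<lambda>z. sz z"])
    fix y acc :: "'b list" and x :: 'a
    show "sz (y @ acc) \<le> sz acc + sz (x, y)" using sz_append[of y acc] by simp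
  qed (intro poly_time_intros assms poly_bounded_intros)+
  moreover have "foldr (\<lambda>y acc. y @ acc) ys [] = concat ys" for ys :: "'b list list"
    by (induction ys) auto
  ultimately show ?thesis by simp
qed

lemma poly_time_mem [poly_time_intros]:
  assumes f: "poly_time f" and l: "poly_time l" shows "poly_time (\<lambda>x. (f x :: nat) \<in> set (l x))"
proof -
  have "poly_time (\<lambda>x. \<exists>y\<in>set (l x). y = f x)"
    by (intro poly_time_ex poly_time_eq poly_time_comp[OF f] poly_time_fst poly_time_snd poly_time_id l)
  then show ?thesis by simp
qed

text \<open>\<open>K\<close> is fixed before the input, so the program is a chain of
  \<open>K\<close> comparisons with hard-wired values; this is why \<open>T\<close> may be an
  arbitrary function.\<close>

lemma poly_time_table1:
  fixes T :: "nat \<Rightarrow> 'b::encodable"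
  assumes r: "poly_time r" shows "poly_time (\<lambda>x. if r x < K then T (r x) else d)"
proof (induction K)
  case (Suc K)
  have "(if r x < Suc K then T (r x) else d) = (if r x = K then T K else if r x < K then T (r x) else d)" for x
    by auto
  then show ?case by (simp only:) (intro poly_time_intros r Suc)
qed (simp add: poly_time_const)

lemma poly_time_table2:
  fixes T :: "nat \<Rightarrow> nat \<Rightarrow> 'b::encodable"
  assumes r: "poly_time r" "poly_time b" shows "poly_time (\<lambda>x. if r x < K \<and> b x < L then T (r x) (b x) else d)"
proof (induction K)
  case (Suc K)
  have "(if r x < Suc K \<and> b x < L then T (r x) (b x) else d) =
    (if r x = K then (if b x < L then T K (b x) else d) else if r x < K \<and> b x < L then T (r x) (b x) else d)" for x
    by (auto simp: less_Suc_eq)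
  then show ?case by (simp only:) (intro poly_time_intros r Suc poly_time_table1)
qed (simp add: poly_time_const)

text \<open>Programs call their main function at index 0, hence the shift by 1.\<close>

lemma poly_time_program:
  assumes "poly_time f"
  obtains p q where "\<And>x. \<exists>c \<le> poly q (sz x). runs p (enc x) (enc (f x)) c"
proof -
  from assms obtain p e b where b: "poly_bounded b" "\<And>x. \<exists>c\<le>b x. eval p [enc x] e (enc (f x)) c"
    by (rule poly_timeE) blast
  from b(1) obtain q where q: "\<And>z. b z \<le> poly q (sz z)" by (rule poly_boundedE) blast
  show thesis
  proof (rule that[where p = "shift_calls 1 e # map (shift_calls 1) p"])
    fix x
    obtain c where c: "c \<le> b x" "eval p [enc x] e (enc (f x)) c" using b(2) by blast
    from eval_link[OF c(2), of "[shift_calls 1 e]" "[]"] q[of x] c(1)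
    show "\<exists>c\<le>poly q (sz x). runs (shift_calls 1 e # map (shift_calls 1) p) (enc x) (enc (f x)) c"
      unfolding runs_def by (intro exI[of _ c]) auto
  qed
qed

section \<open>Multiplicative weights for fractional covers\<close>

text \<open>The weights are integers: after \<open>i\<close> steps, the usual weight \<open>(1 + 1 / k) ^ load\<close> is scaled by
  \<open>k ^ i\<close>.\<close>

locale mw_run =
  fixes V :: "'v set" and E :: "'v set set" and t k :: nat
    and w :: "nat \<Rightarrow> 'v \<Rightarrow> nat" and e :: "nat \<Rightarrow> 'v set"
  assumes finite_V: "finite V" and E_subset: "f \<in> E \<Longrightarrow> f \<subseteq> V" and card_E: "f \<in> E \<Longrightarrow> card f = t"
    and t_pos: "t > 0" and k_pos: "k > 0"
    and w_0: "v \<in> V \<Longrightarrow> w 0 v = 1"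
    and w_Suc: "v \<in> V \<Longrightarrow> w (Suc i) v = (if v \<in> e i then (k + 1) * w i v else k * w i v)"
    and e_in: "e i \<in> E"
    and e_min: "f \<in> E \<Longrightarrow> sum (w i) (e i) \<le> sum (w i) f"
begin

text \<open>The chosen edges \<open>e 0\<close>, ..., \<open>e (i - 1)\<close>, counted with
  multiplicity and divided by the largest load, form the fractional matching; \<open>load\<close> is
  its unnormalised value at a vertex.\<close>

definition load :: "nat \<Rightarrow> 'v \<Rightarrow> nat" where
  "load i v = (\<Sum>j<i. of_bool (v \<in> e j))"

abbreviation D :: "nat \<Rightarrow> nat" where
  "D i \<equiv> sum (w i) (e i)"

abbreviation total :: "nat \<Rightarrow> nat" where
  "total i \<equiv> sum (w i) V"

abbreviation max_load :: "nat \<Rightarrow> nat" where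
  "max_load i \<equiv> Max (load i ` V)"

abbreviation fractional :: "('v \<Rightarrow> real) \<Rightarrow> bool" where
  "fractional x \<equiv> (\<forall>v\<in>V. 0 \<le> x v) \<and> (\<forall>f\<in>E. 1 \<le> sum x f)"

lemma e_subset: "e i \<subseteq> V" and finite_e: "finite (e i)" and card_e: "card (e i) = t"
  using E_subset e_in card_E finite_V finite_subset by blast+

lemma V_nonempty: "V \<noteq> {}"
  using e_subset[of 0] card_e[of 0] t_pos by auto

lemma w_eq: "v \<in> V \<Longrightarrow> real (w i v) = real k ^ i * (1 + 1 / k) ^ load i v"
proof (induction i)
  case (Suc i)
  then show ?case using k_pos by (simp add: w_Suc load_def field_simps)
qed (simp add: w_0 load_def)

lemma w_pos: "v \<in> V \<Longrightarrow> w i v > 0"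
  by (induction i) (auto simp: w_0 w_Suc k_pos)

lemma D_pos: "D i > 0"
proof -
  have "e i \<noteq> {}" using card_e[of i] t_pos by auto
  then show ?thesis
    by (intro sum_pos finite_e w_pos) (auto intro: subsetD[OF e_subset])
qed

lemma total_Suc: "total (Suc i) = k * total i + D i"
proof -
  have "total (Suc i) = (\<Sum>v\<in>V. k * w i v + (if v \<in> e i then w i v else 0))"
    by (intro sum.cong) (auto simp: w_Suc)
  also have "\<dots> = k * total i + sum (w i) (V \<inter> e i)"
    using finite_V by (simp add: sum.distrib sum_distrib_left sum.inter_restrict)
  finally show ?thesis using e_subset[of i] by (simp add: Int_absorb1)
qed

lemma load_le: "v \<in> V \<Longrightarrow> load i v \<le> max_load i"
  using finite_V by auto

lemma max_load_attained: obtains u where "u \<in> V" "load i u = max_load i"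
proof -
  have "max_load i \<in> load i ` V" using finite_V V_nonempty by (intro Max_in) auto
  then show thesis using that by (metis imageE)
qed

lemma max_load_le: "max_load i \<le> i"
proof -
  have "load i v \<le> (\<Sum>j<i. 1)" for v
    unfolding load_def by (intro sum_mono) auto
  then show ?thesis using finite_V V_nonempty by auto
qed

section \<open>Duality between covers and the chosen edges\<close>

lemma load_swap: "(\<Sum>v\<in>V. x v * real (load i v)) = (\<Sum>j<i. sum x (e j))"
proof -
  have "(\<Sum>v\<in>V. x v * real (load i v)) = (\<Sum>v\<in>V. \<Sum>j<i. if v \<in> e j then x v else 0)"
    unfolding load_def of_nat_sum sum_distrib_left by (intro sum.cong) auto
  also have "\<dots> = (\<Sum>j<i. \<Sum>v\<in>V. if v \<in> e j then x v else 0)"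
    by (rule sum.swap)
  also have "\<dots> = (\<Sum>j<i. sum x (e j))"
    using finite_V e_subset by (simp add: sum.inter_restrict[symmetric] Int_absorb1 cong: sum.cong)
  finally show ?thesis .
qed

lemma sum_load: "(\<Sum>v\<in>V. load i v) = t * i"
proof -
  have "real (\<Sum>v\<in>V. load i v) = real (t * i)"
    using load_swap[of "\<lambda>_. 1" i] card_e by simp
  then show ?thesis by linarith
qed

text \<open>The chosen edges divided by \<open>max_load i\<close> are a fractional matching of value
  \<open>i / max_load i\<close>, which no fractional cover can undercut.\<close>

lemma weak_duality:
  fixes x :: "'v \<Rightarrow> real"
  assumes "fractional x" shows "real i \<le> real (max_load i) * sum x V"
proof -
  have "real i = (\<Sum>j<i. 1)" by simp
  also have "\<dots> \<le> (\<Sum>j<i. sum x (e j))"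
    using assms e_in by (intro sum_mono) auto
  also have "\<dots> = (\<Sum>v\<in>V. x v * real (load i v))" by (rule load_swap[symmetric])
  also have "\<dots> \<le> (\<Sum>v\<in>V. x v * real (max_load i))"
    using assms load_le by (intro sum_mono mult_left_mono) auto
  finally show ?thesis by (simp add: sum_distrib_right mult.commute)
qed

lemma fractional_ones: "fractional (\<lambda>_. 1)"
  using card_E t_pos by auto

lemma fractional_ge_1:
  fixes x :: "'v \<Rightarrow> real"
  assumes "fractional x" shows "1 \<le> sum x V"
proof -
  have "1 \<le> sum x (e 0)" using assms e_in by auto
  also have "\<dots> \<le> sum x V" using assms e_subset finite_V by (intro sum_mono2) auto
  finally show ?thesis .
qed

text \<open>Approximate complementary slackness. A vertex of maximal load has weight below
  \<open>D i / h\<close>, hence below \<open>t\<close> times the weight of any vertex of the set.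
  Weights being exponential in loads, the two loads differ by at most \<open>2 * k * t\<close>,
  which is at most a fraction \<open>\<delta>\<close> of the maximal load because \<open>i\<close>
  is large. So every vertex of the set has load at least \<open>(1 - \<delta>) * max_load i\<close>,
  while all loads together are \<open>t * i\<close>, and weak duality bounds
  \<open>i\<close>.\<close>

lemma card_saturated:
  fixes x :: "'v \<Rightarrow> real" and \<delta> :: real and i :: nat
  assumes x: "fractional x" and i: "2 * real k * t * card V \<le> \<delta> * i" "i > 0"
    and small: "\<And>v. v \<in> V \<Longrightarrow> h * w i v < D i"
  shows "(1 - \<delta>) * card {v \<in> V. D i \<le> t * h * w i v} \<le> t * sum x V"
proof -
  define S where "S = {v \<in> V. D i \<le> t * h * w i v}"
  let ?L = "max_load i" and ?b = "1 + 1 / real k"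
  have fS: "finite S" "S \<subseteq> V" using finite_V by (auto simp: S_def)
  have cV: "card V > 0" using finite_V V_nonempty by (simp add: card_gt_0_iff)
  \<comment> \<open>The all-ones cover shows that the maximal load is at least
    \<open>i / card V\<close>, so a large \<open>i\<close> makes it large.\<close>
  have L: "real i \<le> real ?L * card V" using weak_duality[OF fractional_ones] by simp
  have Lpos: "?L > 0"
  proof (rule ccontr)
    assume "\<not> ?L > 0"
    then have "?L = 0" by simp
    with L i(2) show False by simp
  qed
  have dL: "2 * real k * t \<le> \<delta> * ?L"
  proof -
    have "0 \<le> 2 * real k * t * card V" by simp
    with i(1) have "0 \<le> \<delta> * i" by linarith
    then have d: "\<delta> \<ge> 0" using i(2) by (simp add: zero_le_mult_iff)
    have "2 * real k * t * card V \<le> \<delta> * ?L * card V"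
      using i(1) mult_left_mono[OF L d] by (simp add: mult.assoc)
    then show ?thesis using cV by (simp add: mult_le_cancel_right)
  qed
  have "(1 - \<delta>) * ?L \<le> load i v" if v: "v \<in> S" for v
  proof -
    obtain u where u: "u \<in> V" "load i u = ?L"
      by (rule max_load_attained)
    have vV: "v \<in> V" using v fS by auto
    have "D i \<le> h * (t * w i v)" using v by (simp add: S_def ac_simps)
    with small[OF u(1)] have "h * w i u < h * (t * w i v)" by (rule less_le_trans)
    then have "w i u < t * w i v" by (rule mult_left_less_imp_less) simp
    then have "real (w i u) < real t * real (w i v)" by (metis of_nat_less_iff of_nat_mult)
    then have lt: "?b ^ ?L < t * ?b ^ load i v"
      using k_pos u(2) by (simp add: w_eq[OF u(1)] w_eq[OF vV] field_simps)
    have "?L \<le> load i v + 2 * k * t"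
    proof (rule ccontr)
      assume "\<not> ?L \<le> load i v + 2 * k * t"
      then have "?b ^ (load i v + 2 * k * t) \<le> ?b ^ ?L" by (intro power_increasing) auto
      moreover
      \<comment> \<open>A load difference of \<open>2 * k * t\<close> means a weight ratio of at
        least \<open>1 + 2 * t\<close>, beyond the factor \<open>t\<close> that separates the two
        weights.\<close>
      have B: "1 + real (2 * k * t) * (1 / k) \<le> ?b ^ (2 * k * t)"
        by (rule Bernoulli_inequality) (use k_pos in \<open>auto simp: field_simps\<close>)
      have "real (2 * k * t) * (1 / k) = 2 * real t" using k_pos by simp
      with B have "real t \<le> ?b ^ (2 * k * t)" by linarith
      then have "t * ?b ^ load i v \<le> ?b ^ (load i v + 2 * k * t)"
        unfolding power_add by (subst mult.commute, intro mult_left_mono) auto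
      ultimately show False using lt by linarith
    qed
    then have "real ?L \<le> real (load i v) + 2 * real k * t"
      by (metis of_nat_add of_nat_le_iff of_nat_mult of_nat_numeral)
    then show ?thesis using dL by (simp add: algebra_simps)
  qed
  then have "card S * ((1 - \<delta>) * ?L) \<le> (\<Sum>v\<in>S. real (load i v))"
    using sum_mono[of S "\<lambda>_. (1 - \<delta>) * ?L" "\<lambda>v. real (load i v)"] by simp
  also have "\<dots> \<le> (\<Sum>v\<in>V. real (load i v))" using fS finite_V by (intro sum_mono2) auto
  also have "\<dots> = real t * i" using sum_load[of i] by (metis of_nat_mult of_nat_sum)
  also have "\<dots> \<le> real t * (real ?L * sum x V)"
    using weak_duality[OF x, of i] by (intro mult_left_mono) auto
  finally have "((1 - \<delta>) * card S) * ?L \<le> (t * sum x V) * ?L" by (simp add: ac_simps)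
  then show ?thesis using Lpos unfolding S_def by (simp add: mult_le_cancel_right)
qed

text \<open>Every vertex weighs less than \<open>D i / h\<close>, and the at most \<open>t\<close>
  vertices of \<open>f\<close> below the threshold together weigh less than \<open>D i / h\<close>.
  With at most \<open>h - 1\<close> vertices above it, \<open>f\<close> would be lighter than the
  lightest edge.\<close>

lemma saturated_in_edge:
  assumes f: "f \<in> E" and small: "\<And>v. v \<in> V \<Longrightarrow> h * w i v < D i"
  shows "h \<le> card {v \<in> f. D i \<le> t * h * w i v}"
proof (rule ccontr)
  define S where "S = {v \<in> f. D i \<le> t * h * w i v}"
  assume "\<not> h \<le> card {v \<in> f. D i \<le> t * h * w i v}"
  then have S: "card S + 1 \<le> h" by (simp add: S_def)
  have ff: "finite f" "card f = t" "f \<subseteq> V" 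
    using E_subset[OF f] card_E[OF f] finite_subset[OF E_subset[OF f] finite_V] by auto
  have fin: "finite S" "finite (f - S)" "S \<subseteq> f" using ff by (auto simp: S_def)
  have a: "h * sum (w i) S \<le> card S * D i"
  proof -
    have "(\<Sum>v\<in>S. h * w i v) \<le> (\<Sum>v\<in>S. D i)"
      using fin ff by (intro sum_mono less_imp_le small) auto
    then show ?thesis by (simp add: sum_distrib_left)
  qed
  \<comment> \<open>Below the threshold there is a strict inequality between integers; writing it
    with \<open>D i - 1\<close> preserves the strictness when the factor \<open>t\<close> is
    cancelled.\<close>
  have b: "t * h * sum (w i) (f - S) \<le> card (f - S) * (D i - 1)"
  proof -
    have "(\<Sum>v\<in>f-S. t * h * w i v) \<le> (\<Sum>v\<in>f-S. D i - 1)"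
      by (intro sum_mono) (auto simp: S_def)
    then show ?thesis by (simp add: sum_distrib_left)
  qed
  also have "\<dots> \<le> t * (D i - 1)" using ff card_mono[of f "f - S"] by (intro mult_le_mono) auto
  finally have b': "h * sum (w i) (f - S) \<le> D i - 1" using t_pos by simp
  have "h * D i \<le> h * sum (w i) f" using e_min[OF f] by simp
  also have "\<dots> = h * sum (w i) S + h * sum (w i) (f - S)"
    using sum.subset_diff[OF fin(3) ff(1), of "w i"] by (simp add: algebra_simps)
  also have "\<dots> \<le> card S * D i + (D i - 1)" using a b' by linarith
  also have "\<dots> < (card S + 1) * D i" using D_pos[of i] by simp
  also have "\<dots> \<le> h * D i" using S by (intro mult_le_mono) auto
  finally show False by simp
qed

text \<open>The potential is \<open>total i / k ^ i\<close>, the sum of all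
  \<open>(1 + 1 / k) ^ load\<close>. If the normalised weights had value above
  \<open>r = sum x V + \<sigma>\<close> throughout the window, the potential would grow at most by
  the factor \<open>1 + 1 / (k * r)\<close> per step. By weak duality, however, some load reaches
  \<open>R / sum x V\<close>, which forces a faster growth since \<open>sum x V < r\<close>.\<close>

lemma near_optimal_aux:
  fixes x :: "'v \<Rightarrow> real" and \<sigma> :: real and R i0 :: nat
  assumes x: "fractional x" "sum x V \<le> real (card V)" and \<sigma>: "0 < \<sigma>" "\<sigma> \<le> 1"
    and k: "4 * real (card V) \<le> k * \<sigma>" and R: "4 * real (card V)^2 * (k * card V + i0) < \<sigma> * R"
  shows "\<exists>i. i0 \<le> i \<and> i < i0 + R \<and> total i \<le> (sum x V + \<sigma>) * D i"
proof (rule ccontr)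
  define n X r where "n = real (card V)" and "X = sum x V" and "r = X + \<sigma>"
  let ?b = "1 + 1 / real k"
  assume "\<not> ?thesis"
  then have no: "r * D i < total i" if "i0 \<le> i" "i < i0 + R" for i
    using that unfolding r_def X_def by force
  have X1: "1 \<le> X" "X \<le> n" using fractional_ge_1[OF x(1)] x(2) by (auto simp: X_def n_def)
  have kp: "real k > 0" using k_pos by simp
  have rp: "r > 0" "r \<ge> 1" using X1 \<sigma> by (auto simp: r_def)
  have Rp: "real R > 0"
  proof -
    have "0 \<le> 4 * real (card V)^2 * (k * card V + i0)" by simp
    with R have "0 < \<sigma> * R" by linarith
    with \<sigma> show ?thesis by (simp add: zero_less_mult_iff)
  qed
  define \<Phi> where "\<Phi> i = real (total i) / real k ^ i" for i
  have \<Phi>_Suc: "\<Phi> (Suc i) = \<Phi> i + real (D i) / (k * real k ^ i)" for i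
    using kp by (simp add: \<Phi>_def total_Suc add_divide_distrib)
  \<comment> \<open>Nothing is known about the steps before the window, so they are charged the
    trivial growth factor \<open>1 + 1 / k\<close> each.\<close>
  have \<Phi>0: "\<Phi> i \<le> n * ?b ^ i" for i
  proof -
    have "real (total i) \<le> (\<Sum>v\<in>V. real k ^ i * ?b ^ i)"
      unfolding of_nat_sum
    proof (intro sum_mono)
      fix v assume v: "v \<in> V"
      have "?b ^ load i v \<le> ?b ^ i"
        using order_trans[OF load_le[OF v] max_load_le] by (intro power_increasing) auto
      then show "real (w i v) \<le> real k ^ i * ?b ^ i"
        by (simp add: w_eq[OF v] mult_left_mono)
    qed
    then show ?thesis using kp by (simp add: \<Phi>_def n_def field_simps)
  qed
  have "\<Phi> (i0 + j) \<le> \<Phi> i0 * (1 + 1 / (k * r)) ^ j" if "j \<le> R" for j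
    using that
  proof (induction j)
    case (Suc j)
    have "real (D (i0 + j)) \<le> total (i0 + j) / r"
      using no[of "i0 + j"] Suc.prems rp by (simp add: field_simps)
    then have "real (D (i0 + j)) / (k * real k ^ (i0 + j)) \<le> total (i0 + j) / r / (k * real k ^ (i0 + j))"
      using kp by (intro divide_right_mono) auto
    also have "\<dots> = \<Phi> (i0 + j) * (1 / (k * r))"
      by (simp add: \<Phi>_def)
    finally have "\<Phi> (i0 + Suc j) \<le> \<Phi> (i0 + j) * (1 + 1 / (k * r))"
      using \<Phi>_Suc[of "i0 + j"] by (simp add: distrib_left)
    also have "\<dots> \<le> \<Phi> i0 * (1 + 1 / (k * r)) ^ j * (1 + 1 / (k * r))"
      using Suc kp rp by (intro mult_right_mono) auto
    finally show ?case by (simp add: mult_ac)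
  qed simp
  from this[of R] have "\<Phi> (i0 + R) \<le> \<Phi> i0 * (1 + 1 / (k * r)) ^ R" by simp
  also have "\<dots> \<le> (n * ?b ^ i0) * (1 + 1 / (k * r)) ^ R"
    using \<Phi>0 kp rp by (intro mult_right_mono) auto
  also have "\<dots> \<le> (exp n * exp (1 / k) ^ i0) * exp (1 / (k * r)) ^ R"
  proof (intro mult_mono power_mono exp_ge_add_one_self)
    show "n \<le> exp n" using exp_ge_add_one_self[of n] by linarith
  qed (use kp rp in \<open>auto simp: n_def\<close>)
  also have "\<dots> = exp (n + i0 / k + R / (k * r))"
    by (simp add: exp_of_nat_mult[symmetric] exp_add)
  finally have upper: "\<Phi> (i0 + R) \<le> exp (n + i0 / k + R / (k * r))" .
  let ?L = "max_load (i0 + R)"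
  obtain u where u: "u \<in> V" "load (i0 + R) u = ?L"
    by (rule max_load_attained)
  have "real (w (i0 + R) u) \<le> real (total (i0 + R))"
    unfolding of_nat_le_iff using u finite_V by (intro member_le_sum) auto
  then have "?b ^ ?L \<le> \<Phi> (i0 + R)"
    using kp u by (simp add: w_eq \<Phi>_def field_simps)
  moreover have "exp (R / X * (1 / k - (1 / k)^2)) \<le> ?b ^ ?L"
  proof -
    have "R \<le> ?L * X" using weak_duality[OF x(1), of "i0 + R"] unfolding X_def by simp
    then have "R / X \<le> ?L" using X1 by (simp add: field_simps)
    then have "R / X * (1 / k - (1 / k)^2) \<le> ?L * (1 / k - (1 / k)^2)"
      using k_pos by (intro mult_right_mono) (auto simp: power2_eq_square field_simps)
    also have "\<dots> \<le> ?L * ln ?b"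
      using k_pos by (intro mult_left_mono ln_one_plus_pos_lower_bound) auto
    finally have "exp (R / X * (1 / k - (1 / k)^2)) \<le> exp (?L * ln ?b)" by simp
    also have "\<dots> = ?b ^ ?L" using kp by (simp add: exp_of_nat_mult add_pos_pos)
    finally show ?thesis .
  qed
  ultimately have "exp (R / X * (1 / k - (1 / k)^2)) \<le> exp (n + i0 / k + R / (k * r))"
    using upper by linarith
  then have "R / X * (1 / k - (1 / k)^2) \<le> n + i0 / k + R / (k * r)" by simp
  then have *: "k * (R / X * (1 / k - (1 / k)^2)) \<le> k * (n + i0 / k + R / (k * r))"
    using kp by (intro mult_left_mono) auto
  have main: "R / X * (1 - 1 / k) \<le> k * n + i0 + R / r"
  proof -
    have "k * (R / X * (1 / k - (1 / k)^2)) = R / X * (k * (1 / k) - k * (1 / k) * (1 / k))"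
      unfolding power2_eq_square right_diff_distrib by (simp only: mult_ac)
    also have "\<dots> = R / X * (1 - 1 / k)" using kp by simp
    finally have "R / X * (1 - 1 / k) \<le> k * (n + i0 / k + R / (k * r))" using * by linarith
    then show ?thesis using kp by (simp add: distrib_left)
  qed
  \<comment> \<open>The advantage of rate \<open>1 / X\<close> over rate \<open>1 / r\<close> is at
    least \<open>R * \<sigma> / (X * (2 * n))\<close>. One half of it outweighs the second-order
    loss \<open>R / X * (1 / k)\<close>, by the choice of \<open>k\<close>; the other half exceeds
    the start-up terms \<open>k * n + i0\<close>, by the choice of \<open>R\<close>.\<close>
  have "R / X - R / r = R * \<sigma> / (X * r)"
    using X1 rp by (simp add: r_def field_simps)
  moreover have "X * r \<le> X * (2 * n)" using X1 \<sigma> by (intro mult_left_mono) (auto simp: r_def)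
  then have "R * \<sigma> / (X * r) \<ge> R * \<sigma> / (X * (2 * n))"
    using X1 rp \<sigma> Rp by (intro divide_left_mono) auto
  moreover have "R / X * (1 / k) \<le> R * \<sigma> / (X * (4 * n))"
  proof -
    have "1 / k \<le> \<sigma> / (4 * n)" using k X1 kp by (simp add: n_def field_simps)
    then have "R / X * (1 / k) \<le> R / X * (\<sigma> / (4 * n))" using X1 by (intro mult_left_mono) auto
    then show ?thesis by simp
  qed
  moreover have "k * n + i0 < R * \<sigma> / (X * (4 * n))"
  proof -
    have "(k * n + i0) * (X * (4 * n)) \<le> (k * n + i0) * (n * (4 * n))"
      using X1 by (intro mult_left_mono mult_right_mono) auto
    also have "\<dots> < R * \<sigma>" using R by (simp add: n_def power2_eq_square algebra_simps)
    finally show ?thesis using X1 by (subst pos_less_divide_eq) auto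
  qed
  moreover have "R * \<sigma> / (X * (2 * n)) = 2 * (R * \<sigma> / (X * (4 * n)))"
    by (simp add: field_simps)
  moreover have "R / X * (1 - 1 / k) = R / X - R / X * (1 / k)" by (simp only: right_diff_distrib mult_1_right)
  ultimately show False using main by linarith
qed

text \<open>The value of the normalised weights is \<open>total / D\<close>. The hypothesis
  \<open>best\<close> compares these quotients by cross-multiplication, so the value at
  \<open>i\<close> is at most that at the good step found by
  \<open>near_optimal_aux\<close>.\<close>

lemma near_optimal:
  fixes x :: "'v \<Rightarrow> real" and \<sigma> :: real and R i0 :: nat
  assumes x: "fractional x" and \<sigma>: "0 < \<sigma>" "\<sigma> \<le> 1"
    and k: "4 * real (card V) \<le> k * \<sigma>" and R: "4 * real (card V)^2 * (k * card V + i0) < \<sigma> * R"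
    and best: "\<And>j. i0 \<le> j \<Longrightarrow> j < i0 + R \<Longrightarrow> total i * D j \<le> total j * D i"
  shows "total i \<le> (sum x V + \<sigma>) * D i"
proof -
  \<comment> \<open>\<open>near_optimal_aux\<close> speaks of covers of value at most
    \<open>card V\<close>; a more expensive one is replaced by the all-ones cover.\<close>
  have "\<exists>x'. fractional x' \<and> sum x' V \<le> real (card V) \<and> sum x' V \<le> sum x V"
  proof (cases "sum x V \<le> real (card V)")
    case False
    then show ?thesis using fractional_ones by (intro exI[of _ "\<lambda>_. 1"]) simp
  qed (use x in blast)
  then obtain x' where x': "fractional x'" "sum x' V \<le> card V" "sum x' V \<le> sum x V" by blast
  obtain j where j: "i0 \<le> j" "j < i0 + R" "total j \<le> (sum x' V + \<sigma>) * D j"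
    using near_optimal_aux[OF x'(1,2) \<sigma> k R] by blast
  have "real (total i) * D j \<le> real (total j) * D i"
    using best[OF j(1,2)] by (metis of_nat_le_iff of_nat_mult)
  also have "\<dots> \<le> ((sum x' V + \<sigma>) * D j) * D i" using j(3) by (intro mult_right_mono) (auto intro: sum_nonneg)
  also have "\<dots> \<le> ((sum x V + \<sigma>) * D j) * D i" using x'(3) by (intro mult_right_mono) (auto intro: sum_nonneg)
  finally have "real (total i) * D j \<le> ((sum x V + \<sigma>) * D i) * D j" by (simp add: ac_simps)
  then show ?thesis using D_pos[of j] by (simp add: mult_le_cancel_right del: of_nat_sum)
qed

end

section \<open>Colourings of a small set\<close>

definition cover_factor :: "nat \<Rightarrow> real" where
  "cover_factor t = t / 2 + 2 * sqrt (t * ln t)"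

text \<open>Ceiling minus one instead of the floor, so that \<open>heavy t < cover_factor t\<close>
  holds also if the factor is an integer; the additive precision
  \<open>1 / heavy t - 1 / cover_factor t\<close> must be positive.\<close>

definition heavy :: "nat \<Rightarrow> nat" where
  "heavy t = nat (\<lceil>cover_factor t\<rceil> - 1)"

lemma ln_ge_half: assumes "t \<ge> 2" shows "1 / 2 \<le> ln (real t)"
proof -
  have "ln (1 / 2 :: real) \<le> 1 / 2 - 1" by (rule ln_le_minus_one) simp
  moreover have "ln (2 :: real) \<le> ln t" using assms by simp
  ultimately show ?thesis by (simp add: ln_div)
qed

lemma cover_factor_gt_2: assumes "t \<ge> 2" shows "cover_factor t > 2"
proof -
  have "2 * (1 / 2) \<le> real t * ln (real t)" using assms ln_ge_half by (intro mult_mono) auto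
  then have "1 \<le> sqrt (t * ln t)" by (simp add: real_le_rsqrt)
  then show ?thesis using assms unfolding cover_factor_def by linarith
qed

lemma heavy_less: "t \<ge> 2 \<Longrightarrow> heavy t < cover_factor t"
  and heavy_ge: "t \<ge> 2 \<Longrightarrow> cover_factor t \<le> heavy t + 1"
  and heavy_pos: "t \<ge> 2 \<Longrightarrow> heavy t \<ge> 1"
  using cover_factor_gt_2[of t] unfolding heavy_def by (linarith+)

text \<open>In a 2-colouring, a \<open>(t - 1)\<close>-set with \<open>r\<close> red and \<open>b\<close> blue elements is put into the cover if
  \<open>r\<close> is even or if the colouring is unbalanced on it.\<close>

definition bad :: "nat \<Rightarrow> nat \<Rightarrow> nat \<Rightarrow> bool" where
  "bad t r b \<longleftrightarrow> even r \<or> r + heavy t \<le> t \<or> b + heavy t \<le> t"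

text \<open>Divided by \<open>2 ^ (t - 1)\<close>, this is the probability that a random colouring
  makes a given \<open>(t - 1)\<close>-set bad.\<close>

definition bad_count :: "nat \<Rightarrow> nat" where
  "bad_count t = (\<Sum>r\<le>t - 1. ((t - 1) choose r) * of_bool (bad t r (t - 1 - r)))"

text \<open>The power series are compared term by term, using
  \<open>n! * 2 ^ n \<le> (2 * n)!\<close>. The left side is the moment generating function of a
  random sign.\<close>

lemma cosh_le: "(exp x + exp (- x)) / 2 \<le> exp (x\<^sup>2 / 2)" for x :: real
proof -
  have le: "fact n * 2 ^ n \<le> (fact (2 * n) :: real)" for n
  proof (induction n)
    case (Suc n)
    have "fact (Suc n) * 2 ^ Suc n = (2 * real n + 2) * (fact n * 2 ^ n)" by simp
    also have "\<dots> \<le> (2 * real n + 2) * fact (2 * n)" using Suc by (intro mult_left_mono) auto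
    also have "\<dots> \<le> (2 * real n + 2) * ((2 * real n + 1) * fact (2 * n))"
      by (intro mult_left_mono) (auto simp: distrib_right)
    also have "\<dots> = fact (2 * Suc n)" by (simp add: algebra_simps)
    finally show ?case .
  qed simp
  have c: "(\<lambda>n. if even n then x ^ n /\<^sub>R fact n else 0) sums cosh x"
    by (rule cosh_converges)
  then have "(\<lambda>n. if even (2 * n) then x ^ (2 * n) /\<^sub>R fact (2 * n) else 0) sums cosh x"
    by (subst sums_mono_reindex[of "\<lambda>n. 2 * n"]) (auto simp: strict_mono_def elim!: evenE)
  then have 1: "(\<lambda>n. x ^ (2 * n) /\<^sub>R fact (2 * n)) sums cosh x" by simp
  have 2: "(\<lambda>n. (x\<^sup>2 / 2) ^ n /\<^sub>R fact n) sums exp (x\<^sup>2 / 2)"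
    by (rule exp_converges)
  have "x ^ (2 * n) /\<^sub>R fact (2 * n) \<le> (x\<^sup>2 / 2) ^ n /\<^sub>R fact n" for n
  proof -
    have "(x\<^sup>2) ^ n / fact (2 * n) \<le> (x\<^sup>2) ^ n / (fact n * 2 ^ n)"
      using le[of n] by (intro divide_left_mono) auto
    moreover have "x ^ (2 * n) /\<^sub>R fact (2 * n) = (x\<^sup>2) ^ n / fact (2 * n)"
      unfolding power_mult[of x 2 n] by (simp add: divide_inverse)
    moreover have "(x\<^sup>2 / 2) ^ n /\<^sub>R fact n = (x\<^sup>2) ^ n / (fact n * 2 ^ n)"
      by (simp add: power_divide field_simps)
    ultimately show ?thesis by simp
  qed
  from sums_le[OF this 1 2] show ?thesis by (simp add: cosh_def)
qed

text \<open>Chernoff bound for the lower tail of the binomial distribution: each term is multiplied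
  by \<open>exp (2 * l * (a - r))\<close>, which is at least 1 in the tail, and the full sum is then
  a binomial power bounded by \<open>cosh_le\<close>. The choice \<open>l = 2 * s / m\<close>
  minimises the exponent \<open>m * l ^ 2 / 2 - 2 * l * s\<close>.\<close>

lemma sum_choose_le:
  fixes s :: real
  assumes "m > 0" "s = m / 2 - a" "s \<ge> 0" "a \<le> m"
  shows "(\<Sum>r\<le>a. real (m choose r)) \<le> 2 ^ m * exp (- 2 * s\<^sup>2 / m)"
proof -
  define l where "l = 2 * s / m"
  have l: "l \<ge> 0" using assms by (simp add: l_def)
  have "(\<Sum>r\<le>a. real (m choose r)) \<le> (\<Sum>r\<le>a. real (m choose r) * exp (l * (2 * (real a - real r))))"
    using l by (intro sum_mono) (simp add: mult_le_cancel_left1)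
  also have "\<dots> \<le> (\<Sum>r\<le>m. real (m choose r) * exp (l * (2 * (real a - real r))))"
    using assms by (intro sum_mono2) auto
  also have "\<dots> = (\<Sum>r\<le>m. exp (l * (2 * real a - m)) * (real (m choose r) * exp (- l) ^ r * exp l ^ (m - r)))"
  proof (intro sum.cong refl)
    fix r assume "r \<in> {..m}"
    then have "exp (l * (2 * (real a - real r))) = exp (l * (2 * real a - m)) * (exp (- l) ^ r * exp l ^ (m - r))"
      unfolding exp_of_nat_mult[symmetric] exp_add[symmetric] by (auto simp: of_nat_diff algebra_simps)
    then show "real (m choose r) * exp (l * (2 * (real a - real r))) =
        exp (l * (2 * real a - m)) * (real (m choose r) * exp (- l) ^ r * exp l ^ (m - r))"
      by simp
  qed
  also have "\<dots> = exp (l * (2 * real a - m)) * (exp (- l) + exp l) ^ m"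
    by (simp add: binomial_ring sum_distrib_left mult.assoc)
  also have "(exp (- l) + exp l) ^ m = 2 ^ m * ((exp l + exp (- l)) / 2) ^ m"
    by (simp add: power_divide add.commute)
  also have "\<dots> \<le> 2 ^ m * exp (l\<^sup>2 / 2) ^ m"
    by (intro mult_left_mono power_mono cosh_le) (auto intro: add_nonneg_nonneg)
  also have "exp (l\<^sup>2 / 2) ^ m = exp (m * l\<^sup>2 / 2)" by (simp add: exp_of_nat_mult[symmetric])
  finally have "(\<Sum>r\<le>a. real (m choose r)) \<le> 2 ^ m * (exp (l * (2 * real a - m)) * exp (m * l\<^sup>2 / 2))"
    by (simp add: mult_ac)
  also have "exp (l * (2 * real a - m)) * exp (m * l\<^sup>2 / 2) = exp (- 2 * s\<^sup>2 / m)"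
  proof -
    have a: "2 * real a - m = - 2 * s" using assms(2) by simp
    have "l * (2 * real a - m) + m * l\<^sup>2 / 2 = - 2 * s\<^sup>2 / m"
      unfolding a l_def using assms(1) by (simp add: power2_eq_square field_simps)
    then show ?thesis by (simp add: exp_add[symmetric])
  qed
  finally show ?thesis .
qed

text \<open>If the factor exceeds \<open>t\<close>, all sets may be bad. Otherwise half of the
  colourings give an even number, and each of the two unbalanced tails has probability at most
  \<open>exp (- 2 * ln t) = 1 / t ^ 2\<close>. Multiplied by \<open>t\<close> this is
  \<open>t / 2 + 2 / t\<close>, and \<open>2 / t\<close> is far below the square root term.\<close>

lemma bad_count_bound:
  assumes t: "t \<ge> 2" shows "real t * bad_count t < cover_factor t * 2 ^ (t - 1)"
proof (cases "real t < cover_factor t")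
  case True
  have "bad_count t \<le> (\<Sum>r\<le>t - 1. (t - 1) choose r)"
    unfolding bad_count_def by (intro sum_mono) auto
  also have "\<dots> = 2 ^ (t - 1)" by (rule choose_row_sum)
  finally have "real (bad_count t) \<le> 2 ^ (t - 1)"
    by (metis of_nat_le_iff of_nat_numeral of_nat_power)
  then have "real t * bad_count t \<le> real t * 2 ^ (t - 1)" by (intro mult_left_mono) auto
  also have "\<dots> < cover_factor t * 2 ^ (t - 1)" using True by simp
  finally show ?thesis .
next
  case False
  define d m a s where "d = 2 * sqrt (t * ln t)" and "m = t - 1" and "a = t - heavy t" and "s = m / 2 - real a"
  have hp: "heavy t \<le> t" using False heavy_less[OF t] by linarith
  have ln0: "1 / 2 \<le> ln (real t)" using t by (rule ln_ge_half)
  have d2: "d\<^sup>2 = 4 * (t * ln t)" and d0: "d > 0" using t ln0 by (auto simp: d_def power_mult_distrib)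
  \<comment> \<open>\<open>cover_factor t \<le> t\<close> means \<open>d \<le> t / 2\<close>, that
    is \<open>16 * ln t \<le> t\<close>. Hence \<open>t \<ge> 8\<close> and
    \<open>d \<ge> 3\<close>, so that the rounding losses below cost at most half of
    \<open>d\<close>.\<close>
  have dt: "d \<le> t / 2" using False by (simp add: cover_factor_def d_def)
  then have "d\<^sup>2 \<le> (t / 2)\<^sup>2" using d0 by (intro power_mono) auto
  then have "t * (16 * ln t) \<le> t * t" unfolding d2 by (simp add: power2_eq_square)
  then have "16 * ln t \<le> t" using t by (simp add: mult_le_cancel_left)
  then have t8: "real t \<ge> 8" using ln0 by linarith
  have "3\<^sup>2 \<le> d\<^sup>2"
  proof -
    have "8 * (1 / 2) \<le> t * ln t" using t8 ln0 by (intro mult_mono) auto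
    then show ?thesis unfolding d2 by simp
  qed
  then have d3: "d \<ge> 3" using d0 by (intro power2_le_imp_le[of 3 d]) auto
  have m: "m > 0" "real m = real t - 1" using t by (simp_all add: m_def of_nat_diff)
  have s: "s \<ge> d / 2"
  proof -
    have "heavy t \<ge> t / 2 + d - 1" using heavy_ge[OF t] by (simp add: cover_factor_def d_def)
    \<comment> \<open>Rounding in \<open>heavy t\<close> loses at most 1, and passing from
      \<open>t\<close> to \<open>m = t - 1\<close> loses another \<open>1 / 2\<close>.\<close>
    then have "s \<ge> d - 3 / 2" using hp m by (simp add: s_def a_def of_nat_diff field_simps)
    then show ?thesis using d3 by linarith
  qed
  have "(d / 2)\<^sup>2 \<le> s\<^sup>2" using s d0 by (intro power_mono) auto
  then have s2: "t * ln t \<le> s\<^sup>2" using d2 by (simp add: power2_eq_square)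
  have am: "a \<le> m" "s \<ge> 0" using heavy_pos[OF t] s d0 by (auto simp: a_def m_def)
  have "- 2 * s\<^sup>2 / m \<le> - 2 * ln t"
  proof -
    have "m * ln t \<le> t * ln t" using m ln0 by (intro mult_right_mono) auto
    then have "m * ln t \<le> s\<^sup>2" using s2 by linarith
    then have "ln t \<le> s\<^sup>2 / m" using m(1) by (subst pos_le_divide_eq) (simp_all only: of_nat_0_less_iff mult.commute)
    then show ?thesis by simp
  qed
  then have "exp (- 2 * s\<^sup>2 / m) \<le> exp (- 2 * ln t)" by simp
  also have "\<dots> = inverse (exp (ln t) ^ 2)"
    unfolding exp_double[symmetric] exp_minus[symmetric] by simp
  also have "\<dots> = 1 / t\<^sup>2" using t by (simp add: inverse_eq_divide)
  finally have "2 ^ m * exp (- 2 * s\<^sup>2 / m) \<le> 2 ^ m * (1 / t\<^sup>2)"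
    by (rule mult_left_mono) simp
  with sum_choose_le[OF m(1) s_def am(2,1)]
  have tail: "(\<Sum>r\<le>a. real (m choose r)) \<le> 2 ^ m * (1 / t\<^sup>2)" by (rule order_trans)
  have evens: "(\<Sum>r\<le>m. real (m choose r) * of_bool (even r)) = 2 ^ m / 2"
  proof -
    have "(\<Sum>r\<le>m. real (m choose r) * of_bool (even r)) = (\<Sum>r\<le>m. if even r then real (m choose r) else 0)"
      by (intro sum.cong) auto
    then show ?thesis using choose_even_sum[OF m(1), where ?'a = real] by linarith
  qed
  have "real (bad_count t) = (\<Sum>r\<le>m. real (m choose r) * of_bool (bad t r (m - r)))"
    by (simp add: bad_count_def m_def of_nat_sum)
  also have "\<dots> \<le> (\<Sum>r\<le>m. real (m choose r) * of_bool (even r) +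
      (real (m choose r) * of_bool (r \<le> a) + real (m choose r) * of_bool (m - r \<le> a)))"
    using hp by (intro sum_mono) (auto simp: bad_def a_def)
  also have "\<dots> = 2 ^ m / 2 + ((\<Sum>r\<le>m. real (m choose r) * of_bool (r \<le> a)) +
      (\<Sum>r\<le>m. real (m choose r) * of_bool (m - r \<le> a)))"
    by (simp only: sum.distrib evens)
  also have "(\<Sum>r\<le>m. real (m choose r) * of_bool (m - r \<le> a)) = (\<Sum>r\<le>m. real (m choose r) * of_bool (r \<le> a))"
  proof -
    have "(\<Sum>r\<le>m. real (m choose r) * of_bool (m - r \<le> a)) =
        (\<Sum>r\<le>m. real (m choose (m - r)) * of_bool (m - r \<le> a))"
      by (intro sum.cong refl) (simp only: binomial_symmetric[of _ m, symmetric] atMost_iff)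
    also have "\<dots> = (\<Sum>r\<le>m. real (m choose r) * of_bool (r \<le> a))"
      by (rule sum.reindex_bij_witness[of _ "\<lambda>r. m - r" "\<lambda>r. m - r"]) auto
    finally show ?thesis .
  qed
  also have "(\<Sum>r\<le>m. real (m choose r) * of_bool (r \<le> a)) = (\<Sum>r\<le>a. real (m choose r))"
    using am by (intro sum.mono_neutral_cong_right) auto
  finally have "real (bad_count t) \<le> 2 ^ m / 2 + 2 * (2 ^ m * (1 / t\<^sup>2))" using tail by linarith
  then have "t * real (bad_count t) \<le> t * (2 ^ m / 2 + 2 * (2 ^ m * (1 / t\<^sup>2)))"
    by (intro mult_left_mono) auto
  also have "\<dots> = (t / 2 + 2 / t) * 2 ^ m"
    using t by (simp add: power2_eq_square field_simps)
  also have "2 / real t < d" 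
  proof -
    have "2 / real t \<le> 1" using t8 by (simp add: field_simps)
    then show ?thesis using d3 by linarith
  qed
  then have "(t / 2 + 2 / t) * 2 ^ m < (t / 2 + d) * 2 ^ m" by (intro mult_strict_right_mono) auto
  finally show ?thesis by (simp add: cover_factor_def d_def m_def)
qed

section \<open>Colouring by conditional expectations\<close>

text \<open>Counts the colourings of \<open>j\<close> still uncoloured elements that make the set
  bad; counting keeps conditional probabilities integral.\<close>

fun completions :: "nat \<Rightarrow> nat \<Rightarrow> nat \<Rightarrow> nat \<Rightarrow> nat" where
  "completions t 0 r b = of_bool (bad t r b)"
| "completions t (Suc j) r b = completions t j (Suc r) b + completions t j r (Suc b)"

text \<open>\<open>2 ^ (t - 1)\<close> times the probability that a \<open>(t - 1)\<close>-set with \<open>r\<close> red and \<open>b\<close> blue elements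
  becomes bad when its other elements are coloured at random.  It is cut off to be a finite table,
  which a program can contain.\<close>

definition weight :: "nat \<Rightarrow> nat \<Rightarrow> nat \<Rightarrow> nat" where
  "weight t r b = (if r < t \<and> b < t then 2 ^ (r + b) * completions t (t - 1 - (r + b)) r b else 0)"

lemma completions_eq:
  "completions t j r b = (\<Sum>i\<le>j. (j choose i) * of_bool (bad t (r + i) (b + (j - i))))"
proof (induction j arbitrary: r b)
  case (Suc j)
  let ?f = "\<lambda>i. of_bool (bad t (r + i) (b + (Suc j - i))) :: nat"
  have "(\<Sum>i\<le>Suc j. (Suc j choose i) * ?f i) = ?f 0 + (\<Sum>i\<le>j. (Suc j choose Suc i) * ?f (Suc i))"
    by (simp only: sum.atMost_Suc_shift binomial_n_0 mult_1)
  also have "\<dots> = (\<Sum>i\<le>j. (j choose i) * ?f (Suc i)) + (?f 0 + (\<Sum>i\<le>j. (j choose Suc i) * ?f (Suc i)))"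
    by (simp only: binomial_Suc_Suc distrib_right sum.distrib add_ac)
  also have "?f 0 + (\<Sum>i\<le>j. (j choose Suc i) * ?f (Suc i)) = (\<Sum>i\<le>Suc j. (j choose i) * ?f i)"
    by (simp only: sum.atMost_Suc_shift binomial_n_0 mult_1)
  also have "\<dots> = (\<Sum>i\<le>j. (j choose i) * ?f i)" by simp
  also have "\<dots> = (\<Sum>i\<le>j. (j choose i) * of_bool (bad t (r + i) (Suc b + (j - i))))"
    by (intro sum.cong) (auto simp: Suc_diff_le)
  finally show ?case using Suc[of "Suc r" b] Suc[of r "Suc b"] by simp
qed simp

lemma weight_0: "t > 0 \<Longrightarrow> weight t 0 0 = bad_count t"
  by (simp add: weight_def completions_eq bad_count_def)

text \<open>A conditional expectation is the mean of its values for the two colours of one more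
  element; the power of two in \<open>weight\<close> absorbs the change of denominator.\<close>

lemma weight_split:
  assumes "r + b < t - 1" shows "weight t (Suc r) b + weight t r (Suc b) = 2 * weight t r b"
proof -
  have "t - 1 - (r + b) = Suc (t - 1 - (Suc r + b))" using assms by auto
  then show ?thesis using assms by (auto simp: weight_def algebra_simps)
qed

lemma weight_full:
  assumes "r + b = t - 1" "t > 0" shows "weight t r b = 2 ^ (t - 1) * of_bool (bad t r b)"
  using assms by (auto simp: weight_def)

definition cnt :: "'a list \<Rightarrow> 'a list \<Rightarrow> nat" where
  "cnt A U = length (filter (\<lambda>v. v \<in> set A) U)"

text \<open>\<open>2 ^ (t - 1)\<close> times the expected number of bad sets in \<open>S\<close>
  when the vertices outside \<open>R\<close> and \<open>B\<close> are coloured at random.\<close>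

definition col_cost :: "nat \<Rightarrow> 'a list list \<Rightarrow> 'a list \<Rightarrow> 'a list \<Rightarrow> nat" where
  "col_cost t S R B = (\<Sum>U\<leftarrow>S. weight t (cnt R U) (cnt B U))"

text \<open>Vertices already coloured are passed over because the algorithm runs through
  \<open>concat vs\<close>, where a vertex occurs once for each set that contains it.\<close>

definition col_step :: "nat \<Rightarrow> 'a list list \<Rightarrow> 'a \<Rightarrow> 'a list \<times> 'a list \<Rightarrow> 'a list \<times> 'a list" where
  "col_step t S v c =
     (if v \<in> set (fst c) \<or> v \<in> set (snd c) then c
      else if col_cost t S (v # fst c) (snd c) \<le> col_cost t S (fst c) (v # snd c)
      then (v # fst c, snd c) else (fst c, v # snd c))"

definition colouring :: "nat \<Rightarrow> 'a list list \<Rightarrow> 'a list \<Rightarrow> 'a list \<times> 'a list" where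
  "colouring t S vs = foldr (col_step t S) vs ([], [])"

lemma cnt_Cons:
  "distinct U \<Longrightarrow> v \<notin> set A \<Longrightarrow> cnt (v # A) U = cnt A U + of_bool (v \<in> set U)"
  unfolding cnt_def by (induction U) (auto simp: filter_empty_conv)

lemma cnt_eq_card: "distinct U \<Longrightarrow> cnt A U = card (set U \<inter> set A)"
  unfolding cnt_def by (subst distinct_card[symmetric]) (auto intro!: arg_cong[of _ _ card])

lemma cnt_add_le:
  assumes "distinct U" "set R \<inter> set B = {}" shows "cnt R U + cnt B U = card (set U \<inter> (set R \<union> set B))"
proof -
  have "card (set U \<inter> (set R \<union> set B)) = card ((set U \<inter> set R) \<union> (set U \<inter> set B))"
    by (simp add: Int_Un_distrib)
  also have "\<dots> = card (set U \<inter> set R) + card (set U \<inter> set B)"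
    using assms by (intro card_Un_disjoint) auto
  finally show ?thesis using assms by (simp add: cnt_eq_card)
qed

lemma col_cost_split:
  assumes S: "\<And>U. U \<in> set S \<Longrightarrow> distinct U \<and> length U = t - 1"
    and d: "set R \<inter> set B = {}" "v \<notin> set R" "v \<notin> set B"
  shows "col_cost t S (v # R) B + col_cost t S R (v # B) = 2 * col_cost t S R B"
proof -
  have "weight t (cnt (v # R) U) (cnt B U) + weight t (cnt R U) (cnt (v # B) U) =
      2 * weight t (cnt R U) (cnt B U)" if U: "U \<in> set S" for U
  proof (cases "v \<in> set U")
    case True
    have "card (set U \<inter> (set R \<union> set B)) < card (set U)"
      using True d by (intro psubset_card_mono) auto
    then have "cnt R U + cnt B U < t - 1"
      using S[OF U] cnt_add_le[of U R B] d by (simp add: distinct_card)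
    then show ?thesis using weight_split[of "cnt R U" "cnt B U" t] True d S[OF U]
      by (simp add: cnt_Cons)
  qed (use d S[OF U] in \<open>simp add: cnt_Cons\<close>)
  then have "(\<Sum>U\<leftarrow>S. weight t (cnt (v # R) U) (cnt B U) + weight t (cnt R U) (cnt (v # B) U)) =
     (\<Sum>U\<leftarrow>S. 2 * weight t (cnt R U) (cnt B U))"
    by (intro arg_cong[of _ _ sum_list] map_cong) auto
  then show ?thesis by (simp add: col_cost_def sum_list_addf sum_list_const_mult)
qed

text \<open>The cost starts at \<open>length S * bad_count t\<close>. By
  \<open>col_cost_split\<close> the cheaper of the two colours does not raise it. Once everything is
  coloured, each set contributes \<open>2 ^ (t - 1)\<close> or 0, so the cost counts the bad
  sets.\<close>

lemma colouring_spec: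
  assumes S: "\<And>U. U \<in> set S \<Longrightarrow> distinct U \<and> length U = t - 1 \<and> set U \<subseteq> set vs" and t: "t > 0"
  defines "c \<equiv> colouring t S vs"
  shows "set (fst c) \<inter> set (snd c) = {}" "set vs \<subseteq> set (fst c) \<union> set (snd c)"
    "length (filter (\<lambda>U. bad t (cnt (fst c) U) (cnt (snd c) U)) S) * 2 ^ (t - 1) \<le> length S * bad_count t"
proof -
  have "set (fst c') \<inter> set (snd c') = {} \<and> set us \<subseteq> set (fst c') \<union> set (snd c') \<and>
      col_cost t S (fst c') (snd c') \<le> length S * bad_count t"
    if "c' = foldr (col_step t S) us ([], [])" for us c'
    using that
  proof (induction us arbitrary: c')
    case Nil
    then show ?case using t by (simp add: col_cost_def cnt_def weight_0 sum_list_triv)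
  next
    case (Cons v us)
    define d where "d = foldr (col_step t S) us ([], [])"
    have c': "c' = col_step t S v d" using Cons.prems by (simp add: d_def)
    note IH = Cons.IH[OF d_def]
    show ?case
    proof (cases "v \<in> set (fst d) \<or> v \<in> set (snd d)")
      case True
      then show ?thesis using IH by (auto simp: c' col_step_def)
    next
      case False
      have "col_cost t S (v # fst d) (snd d) + col_cost t S (fst d) (v # snd d) = 2 * col_cost t S (fst d) (snd d)"
        using S False IH by (intro col_cost_split) auto
      then show ?thesis using IH False by (auto simp: c' col_step_def)
    qed
  qed
  from this[OF meta_eq_to_obj_eq[OF c_def[unfolded colouring_def]]]
  have c: "set (fst c) \<inter> set (snd c) = {}" "set vs \<subseteq> set (fst c) \<union> set (snd c)"
    "col_cost t S (fst c) (snd c) \<le> length S * bad_count t" by auto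
  then show "set (fst c) \<inter> set (snd c) = {}" "set vs \<subseteq> set (fst c) \<union> set (snd c)" by auto
  have "weight t (cnt (fst c) U) (cnt (snd c) U) =
      2 ^ (t - 1) * of_bool (bad t (cnt (fst c) U) (cnt (snd c) U))" if U: "U \<in> set S" for U
  proof (rule weight_full[OF _ t])
    have "set U \<inter> (set (fst c) \<union> set (snd c)) = set U" using S[OF U] c(2) by auto
    then show "cnt (fst c) U + cnt (snd c) U = t - 1"
      using cnt_add_le[of U "fst c" "snd c"] S[OF U] c(1) by (simp add: distinct_card)
  qed
  then have "col_cost t S (fst c) (snd c) =
      (\<Sum>U\<leftarrow>S. 2 ^ (t - 1) * of_bool (bad t (cnt (fst c) U) (cnt (snd c) U)))"
    unfolding col_cost_def by (intro arg_cong[of _ _ sum_list] map_cong) auto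
  also have "\<dots> = 2 ^ (t - 1) * (\<Sum>U\<leftarrow>S. of_bool (bad t (cnt (fst c) U) (cnt (snd c) U)))"
    by (rule sum_list_const_mult)
  also have "(\<Sum>U\<leftarrow>S. of_bool (bad t (cnt (fst c) U) (cnt (snd c) U))) =
      length (filter (\<lambda>U. bad t (cnt (fst c) U) (cnt (snd c) U)) S)"
    by (induction S) auto
  finally show "length (filter (\<lambda>U. bad t (cnt (fst c) U) (cnt (snd c) U)) S) * 2 ^ (t - 1) \<le> length S * bad_count t"
    using c(3) by (simp add: mult.commute)
qed

text \<open>If the colour class that should cover \<open>g\<close> avoids the saturated sets, which are at least
  \<open>heavy t\<close> many, then \<open>g\<close> is unbalanced, and any saturated subset of \<open>g\<close> is bad.\<close>

lemma bad_member_exists: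
  assumes g: "finite g" "card g = t" "g \<subseteq> R \<union> B" "R \<inter> B = {}" and t: "t \<ge> 2"
    and T: "T \<subseteq> nsets g (t - 1)" "heavy t \<le> card T"
  shows "\<exists>X\<in>T. bad t (card (X \<inter> R)) (card (X \<inter> B))"
proof (rule ccontr)
  assume no: "\<not> ?thesis"
  define r b where "r = card (g \<inter> R)" and "b = card (g \<inter> B)"
  have fin: "finite (g \<inter> R)" "finite (g \<inter> B)" "finite T"
    using g finite_subset[OF T(1)] by (auto simp: finite_imp_finite_nsets)
  have rb: "r + b = t"
  proof -
    have "g = (g \<inter> R) \<union> (g \<inter> B)" using g by auto
    then have "card g = r + b" unfolding r_def b_def using g fin
      by (subst card_Un_disjoint[symmetric]) auto
    then show ?thesis using g by simp
  qed
  have "T \<noteq> {}" using T(2) heavy_pos[OF t] by auto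
  then obtain X where X: "X \<in> T" by blast
  have Xg: "X \<subseteq> g" using X T by (auto simp: nsets_def)
  have le: "card (X \<inter> R) \<le> r" "card (X \<inter> B) \<le> b"
    unfolding r_def b_def using Xg fin by (auto intro!: card_mono)
  have form: "\<exists>v\<in>g. Y = g - {v}" if "Y \<in> T" for Y
  proof -
    have Y: "Y \<subseteq> g" "card Y = t - 1" "finite Y" using that T by (auto simp: nsets_def)
    then have "card (g - Y) = 1" using g t by (simp add: card_Diff_subset)
    then obtain v where "g - Y = {v}" by (rule card_1_singletonE)
    then show ?thesis using Y by (intro bexI[of _ v]) auto
  qed
  \<comment> \<open>Deleting \<open>v\<close> from \<open>g\<close> leaves \<open>r - 1\<close> red
    elements if \<open>v\<close> is red and \<open>r\<close> otherwise. Members of \<open>T\<close>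
    have an odd number of them, so the deleted element is always red if \<open>r\<close> is even and
    always blue if \<open>r\<close> is odd.\<close>
  have sub: "T \<subseteq> (\<lambda>v. g - {v}) ` (if even r then g \<inter> R else g \<inter> B)"
  proof
    fix Y assume Y: "Y \<in> T"
    then obtain v where v: "v \<in> g" "Y = g - {v}" using form by blast
    have nb: "odd (card (Y \<inter> R))" using no Y by (auto simp: bad_def)
    show "Y \<in> (\<lambda>v. g - {v}) ` (if even r then g \<inter> R else g \<inter> B)"
    proof (cases "v \<in> R")
      case True
      have "Y \<inter> R = (g \<inter> R) - {v}" using v by auto
      then have "card (Y \<inter> R) = r - 1" using True v fin by (simp add: r_def)
      moreover have "r > 0" unfolding r_def using True v fin by (auto simp: card_gt_0_iff)
      ultimately have "even r" using nb by auto
      then show ?thesis using True v by auto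
    next
      case False
      then have "Y \<inter> R = g \<inter> R" using v by auto
      then have "odd r" using nb by (simp add: r_def)
      then show ?thesis using False v g by auto
    qed
  qed
  show False
  proof (cases "even r")
    case True
    \<comment> \<open>This yields \<open>heavy t \<le> r = t - b\<close>, and \<open>X\<close> has
      at most \<open>b\<close> blue elements, so \<open>X\<close> is unbalanced.\<close>
    have "card T \<le> card ((\<lambda>v. g - {v}) ` (g \<inter> R))" using sub True fin by (intro card_mono) auto
    also have "\<dots> \<le> r" unfolding r_def using fin by (intro card_image_le)
    finally have "card (X \<inter> B) + heavy t \<le> t" using T(2) rb le by linarith
    then show False using no X by (auto simp: bad_def)
  next
    case False
    have "card T \<le> card ((\<lambda>v. g - {v}) ` (g \<inter> B))" using sub False fin by (intro card_mono) auto
    also have "\<dots> \<le> b" unfolding b_def using fin by (intro card_image_le)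
    finally have "card (X \<inter> R) + heavy t \<le> t" using T(2) rb le by linarith
    then show False using no X by (auto simp: bad_def)
  qed
qed

section \<open>The approximation algorithm\<close>

text \<open>The same set may be listed in different orders among the vertices and inside the edges,
  so membership is tested up to reordering.\<close>

definition memb :: "'a list \<Rightarrow> 'a list list \<Rightarrow> bool" where
  "memb U e \<longleftrightarrow> set U \<in> set ` set e"

definition wlen :: "('a list \<times> nat) list \<Rightarrow> 'a list list \<Rightarrow> nat" where
  "wlen W e = (\<Sum>p\<leftarrow>W. if memb (fst p) e then snd p else 0)"

definition lightest :: "('a list \<times> nat) list \<Rightarrow> 'a list list list \<Rightarrow> 'a list list" where
  "lightest W E = foldr (\<lambda>e b. if wlen W e < wlen W b then e else b) E (hd E)"

definition min_len :: "('a list \<times> nat) list \<Rightarrow> 'a list list list \<Rightarrow> nat" where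
  "min_len W E = wlen W (lightest W E)"

definition total_weight :: "('a list \<times> nat) list \<Rightarrow> nat" where
  "total_weight W = (\<Sum>p\<leftarrow>W. snd p)"

definition mw_step :: "nat \<Rightarrow> 'a list list list \<Rightarrow> ('a list \<times> nat) list \<Rightarrow> ('a list \<times> nat) list" where
  "mw_step k E W =
     map (\<lambda>p. (fst p, if memb (fst p) (lightest W E) then (k + 1) * snd p else k * snd p)) W"

text \<open>Compares the values \<open>total_weight / min_len\<close> of the two normalised covers,
  cross-multiplied to stay within the integers.\<close>

definition better ::
    "'a list list list \<Rightarrow> ('a list \<times> nat) list \<Rightarrow> ('a list \<times> nat) list \<Rightarrow> ('a list \<times> nat) list" where
  "better E W B = (if total_weight W * min_len B E < total_weight B * min_len W E then W else B)"

text \<open>The lists \<open>l1\<close> and \<open>l2\<close> only serve as unary counters.\<close>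

definition warm_up ::
    "nat \<Rightarrow> 'a list list list \<Rightarrow> 'a list list \<Rightarrow> nat list \<Rightarrow> ('a list \<times> nat) list" where
  "warm_up k E vs l1 = foldr (\<lambda>_. mw_step k E) l1 (map (\<lambda>U. (U, 1)) vs)"

text \<open>The warm-up steps do not compete: at an early step the weights may be a good cover, but
  too few edges have been chosen for \<open>card_saturated\<close>.\<close>

definition best_weights ::
    "nat \<Rightarrow> 'a list list list \<Rightarrow> 'a list list \<Rightarrow> nat list \<Rightarrow> nat list \<Rightarrow> ('a list \<times> nat) list" where
  "best_weights k E vs l1 l2 =
     snd (foldr (\<lambda>_ s. (mw_step k E (fst s), better E (fst s) (snd s))) l2
       (warm_up k E vs l1, warm_up k E vs l1))"

definition uncovered :: "'a list list \<Rightarrow> 'a list list list \<Rightarrow> 'a list list list" where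
  "uncovered C es = filter (\<lambda>e. \<not> (\<exists>U\<in>set C. memb U e)) es"

text \<open>With \<open>d\<close> the smallest edge weight, the test says that the normalised cover
  is at least \<open>1 / c\<close> at the vertex: \<open>c = heavy t\<close> selects the vertices
  taken at once, \<open>c = t * heavy t\<close> the non-negligible ones.\<close>

definition above :: "nat \<Rightarrow> nat \<Rightarrow> ('a list \<times> nat) list \<Rightarrow> 'a list list" where
  "above d c B = map fst (filter (\<lambda>p. d \<le> c * snd p) B)"

text \<open>Filtering \<open>vs\<close> instead of joining lists keeps every partial cover a sublist
  of \<open>vs\<close>: free of repetitions and bounded in size.\<close>

definition add_heavy :: "'a list list \<Rightarrow> 'a list list \<Rightarrow> 'a list list \<Rightarrow> 'a list list" where
  "add_heavy vs C H = filter (\<lambda>U. memb U C \<or> memb U H) vs"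

definition add_bad ::
    "nat \<Rightarrow> 'a list list \<Rightarrow> 'a list list \<Rightarrow> 'a list list \<Rightarrow> 'a list \<times> 'a list \<Rightarrow> 'a list list" where
  "add_bad t vs C S c =
     filter (\<lambda>U. memb U C \<or> memb U S \<and> bad t (cnt (fst c) U) (cnt (snd c) U)) vs"

definition extend ::
    "nat \<Rightarrow> 'a list list \<Rightarrow> 'a list list list \<Rightarrow> 'a list list \<Rightarrow> ('a list \<times> nat) list \<Rightarrow> 'a list list" where
  "extend t vs E C B =
     (if above (min_len B E) (heavy t) B = []
      then add_bad t vs C (above (min_len B E) (t * heavy t) B)
             (colouring t (above (min_len B E) (t * heavy t) B) (concat vs))
      else add_heavy vs C (above (min_len B E) (heavy t) B))"

text \<open>A counter of length \<open>c * length vs ^ d\<close>, built by \<open>d\<close> nested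
  passes over \<open>vs\<close>.\<close>

fun ticks :: "nat \<Rightarrow> 'a list \<Rightarrow> nat \<Rightarrow> nat list" where
  "ticks c vs 0 = replicate c 0"
| "ticks c vs (Suc d) = concat (map (\<lambda>_. ticks c vs d) vs)"

text \<open>With \<open>n\<close> vertices, precision \<open>\<sigma>\<close> and a fixed
  \<open>t\<close>, the parameters must satisfy \<open>4 * n \<le> k * \<sigma>\<close>, so
  \<open>k\<close> is linear in \<open>n\<close>; \<open>2 * k * t * n \<le> \<delta> * i\<close>,
  so the warm-up is quadratic; and \<open>4 * n ^ 2 * (k * n + i0) < \<sigma> * R\<close>, so the
  window has length of order \<open>n ^ 4\<close>.\<close>

definition cover_step ::
    "nat \<Rightarrow> nat \<Rightarrow> nat \<Rightarrow> nat \<Rightarrow> 'a list list \<Rightarrow> 'a list list list \<Rightarrow> 'a list list \<Rightarrow> 'a list list" where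
  "cover_step c0 c1 c2 t vs es C =
     (if uncovered C es = [] then C
      else extend t vs (uncovered C es) C
        (best_weights (c0 * length vs) (uncovered C es) vs (ticks c1 vs 2) (ticks c2 vs 4)))"

text \<open>The edge list also serves as the counter, since each round covers at least one new
  edge.\<close>

definition approx_cover ::
    "nat \<Rightarrow> nat \<Rightarrow> nat \<Rightarrow> nat \<Rightarrow> 'a list list \<Rightarrow> 'a list list list \<Rightarrow> 'a list list" where
  "approx_cover c0 c1 c2 t vs es = foldr (\<lambda>_. cover_step c0 c1 c2 t vs es) es []"

section \<open>From the list operations to the multiplicative weights locale\<close>

lemma length_ticks: "length (ticks c vs d) = c * length vs ^ d"
  by (induction d) (auto simp: length_concat o_def sum_list_triv)

lemma foldr_const: "foldr (\<lambda>_. f) xs a = (f ^^ length xs) a"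
  by (induction xs) auto

lemma lightest_in: assumes "E \<noteq> []" shows "lightest W E \<in> set E"
proof -
  have "foldr (\<lambda>e b. if wlen W e < wlen W b then e else b) E b \<in> insert b (set E)" for b
    by (induction E) auto
  from this[of "hd E"] show ?thesis
    unfolding lightest_def using assms by (simp add: insert_absorb)
qed

lemma lightest_min: assumes "e \<in> set E" shows "wlen W (lightest W E) \<le> wlen W e"
proof -
  have "\<forall>e\<in>set E. wlen W (foldr (\<lambda>e b. if wlen W e < wlen W b then e else b) E b) \<le> wlen W e" for b
    by (induction E) auto
  then show ?thesis
    unfolding lightest_def using assms by blast
qed

text \<open>The weights as a function of step and vertex, the form in which \<open>mw_run\<close>
  speaks of them.\<close>

fun wfun :: "nat \<Rightarrow> 'a list list list \<Rightarrow> 'a list list \<Rightarrow> nat \<Rightarrow> 'a list \<Rightarrow> nat" where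
  "wfun k E vs 0 U = 1"
| "wfun k E vs (Suc i) U =
     (if memb U (lightest (map (\<lambda>U. (U, wfun k E vs i U)) vs) E)
      then (k + 1) * wfun k E vs i U else k * wfun k E vs i U)"

definition wlist :: "nat \<Rightarrow> 'a list list list \<Rightarrow> 'a list list \<Rightarrow> nat \<Rightarrow> ('a list \<times> nat) list" where
  "wlist k E vs i = map (\<lambda>U. (U, wfun k E vs i U)) vs"

lemma mw_step_wlist: "mw_step k E (wlist k E vs i) = wlist k E vs (Suc i)"
  by (simp add: mw_step_def wlist_def)

lemma funpow_mw_step: "(mw_step k E ^^ i) (map (\<lambda>U. (U, 1)) vs) = wlist k E vs i"
proof (induction i)
  case (Suc i)
  then show ?case by (simp add: mw_step_wlist)
qed (simp add: wlist_def)

lemma warm_up_eq: "warm_up k E vs l1 = wlist k E vs (length l1)"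
  unfolding warm_up_def foldr_const funpow_mw_step ..

text \<open>An edge is replaced by the entries of \<open>vs\<close> that represent its elements, so
  that all edges are subsets of one vertex set even if their own lists are ordered
  differently.\<close>

definition members :: "'a list list \<Rightarrow> 'a list list \<Rightarrow> 'a list set" where
  "members vs e = {U \<in> set vs. memb U e}"

text \<open>The underlying \<open>t\<close>-set \<open>g\<close> is not part of the input of the
  algorithm, which sees only its subsets; it is needed for the analysis of the colouring.\<close>

definition blown_up :: "nat \<Rightarrow> 'a list list \<Rightarrow> 'a list list \<Rightarrow> bool" where
  "blown_up t vs e \<longleftrightarrow>
     (\<exists>g. finite g \<and> card g = t \<and> set ` set e = nsets g (t - 1) \<and> nsets g (t - 1) \<subseteq> set ` set vs)"

definition fractional_on :: "'a list list \<Rightarrow> 'a list list list \<Rightarrow> ('a list \<Rightarrow> real) \<Rightarrow> bool" where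
  "fractional_on vs es x \<longleftrightarrow> (\<forall>U\<in>set vs. 0 \<le> x U) \<and> (\<forall>e\<in>set es. 1 \<le> sum x (members vs e))"

locale blown_up_vertices =
  fixes vs :: "'a list list" and t :: nat
  assumes distinct_sets: "distinct (map set vs)" and t_ge_2: "t \<ge> 2"
    and vertex: "U \<in> set vs \<Longrightarrow> distinct U \<and> length U = t - 1"
begin

lemma distinct_vs: "distinct vs" and inj_sets: "inj_on set (set vs)"
  using distinct_sets by (auto simp: distinct_map)

lemma members_subset: "members vs e \<subseteq> set vs"
  by (auto simp: members_def)

lemma members_image:
  assumes "blown_up t vs e" shows "set ` members vs e = set ` set e"
proof -
  have "set ` members vs e = set ` set vs \<inter> set ` set e"
    unfolding members_def memb_def by blast
  moreover have "set ` set e \<subseteq> set ` set vs"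
    using assms unfolding blown_up_def by blast
  ultimately show ?thesis by (simp only: Int_absorb1)
qed

lemma card_members: assumes "blown_up t vs e" shows "card (members vs e) = t"
proof -
  obtain g where g: "finite g" "card g = t" "set ` set e = nsets g (t - 1)"
    using assms unfolding blown_up_def by blast
  have "card (members vs e) = card (set ` members vs e)"
    using inj_sets by (intro card_image[symmetric]) (auto simp: members_def inj_on_def)
  also have "\<dots> = card (nsets g (t - 1))" by (simp only: members_image[OF assms] g(3))
  also have "\<dots> = t choose (t - 1)" using g by (simp add: card_nsets)
  also have "\<dots> = t" using t_ge_2 by (subst binomial_symmetric) auto
  finally show ?thesis .
qed

lemma memb_iff: "U \<in> set vs \<Longrightarrow> set C \<subseteq> set vs \<Longrightarrow> memb U C \<longleftrightarrow> U \<in> set C"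
  using inj_sets unfolding memb_def inj_on_def by (auto simp: image_iff)

lemma wlen_map: "wlen (map (\<lambda>U. (U, f U)) vs) e = sum f (members vs e)"
proof -
  have "wlen (map (\<lambda>U. (U, f U)) vs) e = (\<Sum>U\<in>set vs. if memb U e then f U else 0)"
    unfolding wlen_def using distinct_vs by (simp add: o_def sum_list_distinct_conv_sum_set cong: if_cong)
  then show ?thesis by (simp add: members_def sum.inter_filter[symmetric])
qed

lemma total_weight_map: "total_weight (map (\<lambda>U. (U, f U)) vs) = sum f (set vs)"
  unfolding total_weight_def using distinct_vs by (simp add: o_def sum_list_distinct_conv_sum_set)

end

locale blown_up_edges = blown_up_vertices +
  fixes E :: "'a list list list" and k :: nat
  assumes E_nonempty: "E \<noteq> []" and E_blown_up: "e \<in> set E \<Longrightarrow> blown_up t vs e" and k_pos: "k > 0"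
begin

abbreviation "light i \<equiv> members vs (lightest (wlist k E vs i) E)"

sublocale mw: mw_run "set vs" "members vs ` set E" t k "wfun k E vs" light
proof
  fix i v f assume "f \<in> members vs ` set E"
  then show "sum (wfun k E vs i) (light i) \<le> sum (wfun k E vs i) f"
    using lightest_min[of _ E "wlist k E vs i"] by (auto simp: wlist_def wlen_map)
next
  fix v i assume "v \<in> set vs"
  then show "wfun k E vs (Suc i) v = (if v \<in> light i then (k + 1) * wfun k E vs i v else k * wfun k E vs i v)"
    by (simp add: members_def wlist_def)
qed (use E_nonempty E_blown_up k_pos t_ge_2 lightest_in in
    \<open>auto simp: card_members intro: subsetD[OF members_subset]\<close>)

lemma min_len_wlist: "min_len (wlist k E vs i) E = mw.D i"
  unfolding min_len_def by (simp add: wlist_def wlen_map)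

lemma total_wlist: "total_weight (wlist k E vs i) = mw.total i"
  by (simp add: wlist_def total_weight_map)

lemma best_weights_spec:
  assumes "l2 \<noteq> []"
  shows "\<exists>i. length l1 \<le> i \<and> best_weights k E vs l1 l2 = wlist k E vs i \<and>
    (\<forall>j. length l1 \<le> j \<longrightarrow> j < length l1 + length l2 \<longrightarrow> mw.total i * mw.D j \<le> mw.total j * mw.D i)"
proof -
  define i0 where "i0 = length l1"
  let ?f = "\<lambda>s. (mw_step k E (fst s), better E (fst s) (snd s))"
  let ?w = "wlist k E vs"
  have "\<exists>i\<ge>i0. (?f ^^ n) (?w i0, ?w i0) = (?w (i0 + n), ?w i) \<and>
      (\<forall>j. i0 \<le> j \<longrightarrow> j < i0 + n \<longrightarrow> mw.total i * mw.D j \<le> mw.total j * mw.D i)" for n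
  proof (induction n)
    case 0
    then show ?case by auto
  next
    case (Suc n)
    then obtain i where i: "i \<ge> i0" "(?f ^^ n) (?w i0, ?w i0) = (?w (i0 + n), ?w i)"
      "\<And>j. i0 \<le> j \<Longrightarrow> j < i0 + n \<Longrightarrow> mw.total i * mw.D j \<le> mw.total j * mw.D i" by blast
    have eq: "(?f ^^ Suc n) (?w i0, ?w i0) = (?w (i0 + Suc n), better E (?w (i0 + n)) (?w i))"
      using i(2) by (simp add: mw_step_wlist)
    show ?case
    proof (cases "mw.total (i0 + n) * mw.D i < mw.total i * mw.D (i0 + n)")
      case True
      have "mw.total (i0 + n) * mw.D j \<le> mw.total j * mw.D (i0 + n)" if j: "i0 \<le> j" "j < i0 + Suc n" for j
      proof (cases "j < i0 + n")
        case lt: True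
        \<comment> \<open>Transitivity of the comparison of quotients: the inequality is multiplied
          by \<open>mw.D i\<close>, which is positive and cancelled at the end.\<close>
        have "mw.total (i0 + n) * mw.D j * mw.D i \<le> mw.total i * mw.D (i0 + n) * mw.D j"
          using mult_right_mono[OF less_imp_le[OF True], of "mw.D j"] by (simp only: mult_ac)
        also have "\<dots> \<le> mw.total j * mw.D i * mw.D (i0 + n)"
          using mult_right_mono[OF i(3)[OF j(1) lt], of "mw.D (i0 + n)"] by (simp only: mult_ac)
        finally have "(mw.total (i0 + n) * mw.D j) * mw.D i \<le> (mw.total j * mw.D (i0 + n)) * mw.D i"
          by (simp only: mult_ac)
        then show ?thesis using mw.D_pos[of i] by (simp only: mult_le_cancel2)
      next
        case False
        then have "j = i0 + n" using j by simp
        then show ?thesis by simp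
      qed
      with True eq show ?thesis
        by (intro exI[of _ "i0 + n"]) (auto simp: better_def min_len_wlist total_wlist)
    next
      case False
      have "mw.total i * mw.D j \<le> mw.total j * mw.D i" if j: "i0 \<le> j" "j < i0 + Suc n" for j
        using i(3)[of j] j False by (cases "j = i0 + n") auto
      with False eq i(1) show ?thesis
        by (intro exI[of _ i]) (auto simp: better_def min_len_wlist total_wlist)
    qed
  qed
  from this[of "length l2"] show ?thesis
    unfolding best_weights_def warm_up_eq foldr_const i0_def[symmetric] by auto
qed

end

context blown_up_edges
begin

lemma frac_iff: "fractional_on vs E x \<longleftrightarrow> mw.fractional x"
  by (auto simp: fractional_on_def)

text \<open>Every edge weighs at least \<open>mw.D i\<close>, so division by it gives a fractional
  cover; setting it to 0 on \<open>H\<close> does not affect the edges that avoid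
  \<open>H\<close>.\<close>

lemma frac_wfun:
  fixes i :: nat
  assumes "\<And>U. U \<in> H \<Longrightarrow> U \<in> set vs" and es: "set es \<subseteq> set E" "\<And>e. e \<in> set es \<Longrightarrow> members vs e \<inter> H = {}"
  defines "x \<equiv> (\<lambda>U. if U \<in> H then 0 else wfun k E vs i U / mw.D i)"
  shows "fractional_on vs es x" "sum x (set vs) = (mw.total i - (\<Sum>U\<in>H. real (wfun k E vs i U))) / mw.D i"
proof -
  have "1 \<le> sum x (members vs e)" if e: "e \<in> set es" for e
  proof -
    have "mw.D i \<le> sum (wfun k E vs i) (members vs e)" using mw.e_min e es(1) by blast
    then have "1 \<le> real (sum (wfun k E vs i) (members vs e)) / mw.D i"
      using mw.D_pos[of i] by (subst pos_le_divide_eq) (auto simp del: of_nat_sum)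
    also have "\<dots> = sum x (members vs e)"
      unfolding of_nat_sum sum_divide_distrib x_def using es(2)[OF e] by (intro sum.cong) auto
    finally show ?thesis .
  qed
  moreover have "0 \<le> x U" for U
    by (simp only: x_def divide_nonneg_nonneg of_nat_0_le_iff order_refl split: if_split) simp
  ultimately show "fractional_on vs es x" by (simp add: fractional_on_def)
  have "sum x (set vs) = (\<Sum>U\<in>set vs - H. wfun k E vs i U / mw.D i)"
    unfolding x_def by (intro sum.mono_neutral_cong_right) auto
  also have "\<dots> = (\<Sum>U\<in>set vs - H. real (wfun k E vs i U)) / mw.D i"
    by (simp add: sum_divide_distrib)
  also have "(\<Sum>U\<in>set vs - H. real (wfun k E vs i U)) = mw.total i - (\<Sum>U\<in>H. real (wfun k E vs i U))"
    using assms(1) by (subst sum_diff) auto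
  finally show "sum x (set vs) = (mw.total i - (\<Sum>U\<in>H. real (wfun k E vs i U))) / mw.D i" .
qed

lemma set_above: "set (above d c (wlist k E vs i)) = {U \<in> set vs. d \<le> c * wfun k E vs i U}"
  by (auto simp: above_def wlist_def image_iff)

lemma set_add_heavy:
  assumes "set C \<subseteq> set vs" "set H \<subseteq> set vs" shows "set (add_heavy vs C H) = set C \<union> set H"
  using assms memb_iff by (auto simp: add_heavy_def)

definition near_opt :: "nat \<Rightarrow> real \<Rightarrow> bool" where
  "near_opt i \<sigma> \<longleftrightarrow> (\<forall>x. fractional_on vs E x \<longrightarrow> real (mw.total i) \<le> (sum x (set vs) + \<sigma>) * mw.D i)"

text \<open>Write \<open>h\<close> for \<open>heavy t\<close>, \<open>\<alpha>\<close> for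
  \<open>cover_factor t\<close> and \<open>b\<close> for the number of vertices in \<open>H\<close>.
  Zeroing the normalised weights on \<open>H\<close> gives a cover of the rest of value at most
  \<open>sum x (set vs) + (1 / h - 1 / \<alpha>) - b / h\<close>. Times \<open>\<alpha>\<close>, the
  error is \<open>\<alpha> / h - 1\<close>, exactly the surplus that one vertex of \<open>H\<close>
  earns beyond its own cost 1.\<close>

lemma add_heavy_step:
  assumes opt: "near_opt i (1 / heavy t - 1 / cover_factor t)"
    and E: "E = uncovered C es" and C: "set C \<subseteq> set vs"
    and H: "H = above (mw.D i) (heavy t) (wlist k E vs i)" "H \<noteq> []" and x: "fractional_on vs E x"
  defines "C' \<equiv> add_heavy vs C H"
  shows "\<exists>x'. fractional_on vs (uncovered C' es) x' \<and>
      card (set C') + cover_factor t * sum x' (set vs) \<le> card (set C) + cover_factor t * sum x (set vs)"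
    and "length (uncovered C' es) < length E"
proof -
  define \<sigma> h \<alpha> where "\<sigma> = 1 / real (heavy t) - 1 / cover_factor t" and "h = real (heavy t)" and "\<alpha> = cover_factor t"
  have h: "h \<ge> 1" "h < \<alpha>" using heavy_pos[OF t_ge_2] heavy_less[OF t_ge_2] by (auto simp: h_def \<alpha>_def)
  have HV: "set H \<subseteq> set vs" using H(1) set_above by auto
  have C': "set C' = set C \<union> set H" unfolding C'_def using C HV by (rule set_add_heavy)
  define b where "b = card (set H)"
  have b1: "b \<ge> 1" using H(2) by (simp add: b_def Suc_le_eq card_gt_0_iff)
  have Dp: "real (mw.D i) > 0" using mw.D_pos[of i] by (simp only: of_nat_0_less_iff)
  have bs: "b * (mw.D i / h) \<le> (\<Sum>U\<in>set H. real (wfun k E vs i U))"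
  proof -
    have "mw.D i / h \<le> wfun k E vs i U" if "U \<in> set H" for U
    proof -
      have "mw.D i \<le> heavy t * wfun k E vs i U" using that set_above H(1) by auto
      then have "real (mw.D i) \<le> h * wfun k E vs i U"
        unfolding h_def by (simp only: of_nat_mult[symmetric] of_nat_le_iff)
      then show ?thesis using h by (simp add: pos_divide_le_eq mult.commute)
    qed
    then show ?thesis using sum_mono[of "set H" "\<lambda>_. mw.D i / h"] by (simp add: b_def)
  qed
  have val: "sum x' (set vs) \<le> mw.total i / mw.D i - b / h"
    if "sum x' (set vs) = (mw.total i - (\<Sum>U\<in>set H. real (wfun k E vs i U))) / mw.D i" for x' :: "'a list \<Rightarrow> real"
  proof -
    have "sum x' (set vs) \<le> (mw.total i - b * (mw.D i / h)) / mw.D i"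
      unfolding that using bs Dp by (intro divide_right_mono) auto
    also have "\<dots> = mw.total i / mw.D i - b / h" using Dp h by (simp add: field_simps)
    finally show ?thesis .
  qed
  have opt': "mw.total i / mw.D i \<le> sum y (set vs) + \<sigma>" if "fractional_on vs E y" for y
    using opt that Dp unfolding near_opt_def \<sigma>_def by (simp add: pos_divide_le_eq)
  define x' where "x' = (\<lambda>U. if U \<in> set H then 0 else wfun k E vs i U / mw.D i)"
  have sub: "set (uncovered C' es) \<subseteq> set E" using C' by (auto simp: E uncovered_def)
  have disj: "members vs e \<inter> set H = {}" if "e \<in> set (uncovered C' es)" for e
    using that C' by (auto simp: uncovered_def members_def)
  have x': "fractional_on vs (uncovered C' es) x'" "sum x' (set vs) \<le> mw.total i / mw.D i - b / h"
    using frac_wfun[of "set H" "uncovered C' es" i, folded x'_def] HV sub disj val[of x'] by blast+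
  have "card (set C') \<le> card (set C) + b" unfolding C' b_def by (rule card_Un_le)
  moreover have "b + \<alpha> * sum x' (set vs) \<le> \<alpha> * sum x (set vs)"
  proof -
    have "\<alpha> * sum x' (set vs) \<le> \<alpha> * (sum x (set vs) + \<sigma> - b / h)"
      using x'(2) opt'[OF x] h by (intro mult_left_mono) auto
    also have "\<dots> = \<alpha> * sum x (set vs) + (\<alpha> / h - 1) - b * (\<alpha> / h)"
      using h by (simp add: \<sigma>_def h_def[symmetric] \<alpha>_def[symmetric] field_simps)
    also have "\<dots> = \<alpha> * sum x (set vs) - b - (real b - 1) * (\<alpha> / h - 1)"
      by (simp add: algebra_simps)
    finally have "\<alpha> * sum x' (set vs) \<le> \<alpha> * sum x (set vs) - b - (real b - 1) * (\<alpha> / h - 1)" .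
    moreover have "0 \<le> (real b - 1) * (\<alpha> / h - 1)" using b1 h by (intro mult_nonneg_nonneg) auto
    ultimately show ?thesis by linarith
  qed
  ultimately show "\<exists>x'. fractional_on vs (uncovered C' es) x' \<and>
      card (set C') + cover_factor t * sum x' (set vs) \<le> card (set C) + cover_factor t * sum x (set vs)"
    using x'(1) unfolding \<alpha>_def by (intro exI[of _ x']) auto
  \<comment> \<open>If \<open>H\<close> met no edge, the zeroed weights would cover all of
    \<open>E\<close> at a value lower by at least \<open>1 / h\<close>, contradicting near
    optimality up to \<open>1 / h - 1 / \<alpha>\<close>.\<close>
  have "\<exists>e\<in>set E. members vs e \<inter> set H \<noteq> {}"
  proof (rule ccontr)
    assume no: "\<not> ?thesis"
    have y: "fractional_on vs E x'" using frac_wfun(1)[of "set H" E i] HV no unfolding x'_def by auto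
    have "mw.total i / mw.D i \<le> mw.total i / mw.D i - b / h + \<sigma>" using opt'[OF y] x'(2) by linarith
    then have "b / h \<le> \<sigma>" by simp
    moreover have "1 / h \<le> b / h" using b1 h by (intro divide_right_mono) auto
    moreover have "0 < 1 / \<alpha>" using h by simp
    ultimately show False unfolding \<sigma>_def h_def \<alpha>_def by linarith
  qed
  then obtain e where e: "e \<in> set E" "\<exists>U\<in>set C'. memb U e" using C' by (auto simp: members_def)
  have "uncovered C' es = filter (\<lambda>e. \<not> (\<exists>U\<in>set C'. memb U e)) E"
    unfolding E uncovered_def filter_filter using C' by (intro filter_cong) auto
  then show "length (uncovered C' es) < length E" using e by (simp add: length_filter_less)
qed

text \<open>Each uncovered edge has at least \<open>heavy t\<close> members in \<open>S\<close> by
  \<open>saturated_in_edge\<close>, and \<open>bad_member_exists\<close> makes one of them bad. For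
  the size, \<open>card_saturated\<close> bounds \<open>S\<close> by
  \<open>t * sum x (set vs) / (1 - \<delta>)\<close>, the colouring keeps at most the fraction
  \<open>bad_count t / 2 ^ (t - 1)\<close> of it, and the second assumption on
  \<open>\<delta>\<close> was made to match this product.\<close>

lemma add_bad_step:
  assumes i: "2 * real k * t * card (set vs) \<le> \<delta> * i" "i > 0" and \<delta>: "\<delta> < 1"
      "real t * bad_count t \<le> (1 - \<delta>) * cover_factor t * 2 ^ (t - 1)"
    and E: "E = uncovered C es" and C: "set C \<subseteq> set vs"
    and no: "above (mw.D i) (heavy t) (wlist k E vs i) = []"
    and S: "S = above (mw.D i) (t * heavy t) (wlist k E vs i)"
    and c: "c = colouring t S (concat vs)" and x: "fractional_on vs E x"
  defines "C' \<equiv> add_bad t vs C S c"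
  shows "uncovered C' es = []"
    and "card (set C') \<le> card (set C) + cover_factor t * sum x (set vs)"
proof -
  have small: "heavy t * wfun k E vs i U < mw.D i" if "U \<in> set vs" for U
    using no set_above[of "mw.D i" "heavy t" i] that by (auto simp: not_le)
  have setS: "set S = {U \<in> set vs. mw.D i \<le> t * heavy t * wfun k E vs i U}" by (simp add: S set_above)
  have SV: "set S \<subseteq> set vs" using setS by auto
  have "above (mw.D i) (t * heavy t) (wlist k E vs i) =
      filter (\<lambda>U. mw.D i \<le> t * heavy t * wfun k E vs i U) vs"
    unfolding above_def wlist_def by (simp add: filter_map o_def)
  then have dS: "distinct S" using distinct_vs by (simp add: S)
  have Sv: "distinct U \<and> length U = t - 1 \<and> set U \<subseteq> set (concat vs)" if "U \<in> set S" for U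
    using vertex that SV by auto
  have tp: "t > 0" using t_ge_2 by simp
  note col = colouring_spec[of S t "concat vs", OF Sv tp, folded c]
  define bd where "bd U = bad t (cnt (fst c) U) (cnt (snd c) U)" for U
  have C': "set C' = set C \<union> {U \<in> set S. bd U}"
    unfolding C'_def add_bad_def bd_def using C SV memb_iff by auto
  show "uncovered C' es = []"
  proof (rule ccontr)
    assume "uncovered C' es \<noteq> []"
    then obtain e where e: "e \<in> set es" "\<And>U. U \<in> set C' \<Longrightarrow> \<not> memb U e"
      by (auto simp: uncovered_def filter_empty_conv)
    then have eE: "e \<in> set E" using C' by (auto simp: E uncovered_def)
    obtain g where g: "finite g" "card g = t" "set ` set e = nsets g (t - 1)"
      "nsets g (t - 1) \<subseteq> set ` set vs"
      using E_blown_up[OF eE] unfolding blown_up_def by blast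
    define T where "T = {U \<in> members vs e. mw.D i \<le> t * heavy t * wfun k E vs i U}"
    have TS: "T \<subseteq> set S" using members_subset by (auto simp: T_def setS)
    have "heavy t \<le> card T"
      unfolding T_def using eE small by (intro mw.saturated_in_edge) auto
    also have "card T = card (set ` T)"
      using inj_sets SV TS by (intro card_image[symmetric]) (meson inj_on_subset subset_trans)
    finally have hT: "heavy t \<le> card (set ` T)" .
    have Tg: "set ` T \<subseteq> nsets g (t - 1)"
      using members_image[OF E_blown_up[OF eE]] g(3) by (auto simp: T_def)
    \<comment> \<open>The colouring reaches only elements of listed sets. As
      \<open>t \<ge> 2\<close>, some \<open>w\<close> in \<open>g\<close> differs from
      \<open>v\<close>, and \<open>g - {w}\<close> is a listed set containing
      \<open>v\<close>.\<close>
    have gsub: "g \<subseteq> set (fst c) \<union> set (snd c)"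
    proof
      fix v assume v: "v \<in> g"
      have "card (g - {v}) = t - 1" using v g by simp
      then have "0 < card (g - {v})" using t_ge_2 by simp
      then have "g - {v} \<noteq> {}" by (metis card.empty less_irrefl)
      then obtain w where w: "w \<in> g - {v}" by blast
      have "g - {w} \<in> nsets g (t - 1)" using w g by (auto simp: nsets_def)
      then have "g - {w} \<in> set ` set vs" using g(4) by (rule subsetD[rotated])
      then obtain U where U: "U \<in> set vs" "g - {w} = set U" by (rule imageE)
      have "v \<in> set U" unfolding U(2)[symmetric] using v w by blast
      then have "v \<in> set (concat vs)" unfolding set_concat using U(1) by blast
      with col(2) show "v \<in> set (fst c) \<union> set (snd c)" by (rule subsetD)
    qed
    obtain U where U: "U \<in> T" "bad t (card (set U \<inter> set (fst c))) (card (set U \<inter> set (snd c)))"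
      using bad_member_exists[OF g(1,2) gsub col(1) t_ge_2 Tg hT] by auto
    then have "bd U" using Sv TS unfolding bd_def by (metis cnt_eq_card subsetD)
    then have "U \<in> set C'" using C' U(1) TS by auto
    then show False using e(2) U(1) by (auto simp: T_def members_def)
  qed
  have nb: "card {U \<in> set S. bd U} = length (filter bd S)"
    using dS by (simp add: distinct_card[symmetric])
  have "real (length (filter bd S) * 2 ^ (t - 1)) \<le> real (length S * bad_count t)"
    unfolding of_nat_le_iff using col(3) unfolding bd_def[abs_def] .
  then have b1: "real (length (filter bd S)) * 2 ^ (t - 1) \<le> real (length S) * bad_count t" by simp
  have lS: "length S = card {U \<in> set vs. mw.D i \<le> t * heavy t * wfun k E vs i U}"
    using dS setS by (metis distinct_card)
  have "(1 - \<delta>) * length S \<le> t * sum x (set vs)"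
    unfolding lS using x by (intro mw.card_saturated i small) (auto simp: frac_iff)
  then have b2: "(1 - \<delta>) * length S * bad_count t \<le> t * sum x (set vs) * bad_count t"
    by (intro mult_right_mono) auto
  have x0: "0 \<le> sum x (set vs)" using x by (auto simp: fractional_on_def intro: sum_nonneg)
  have "((1 - \<delta>) * 2 ^ (t - 1)) * length (filter bd S) \<le> (1 - \<delta>) * (real (length S) * bad_count t)"
    using mult_left_mono[OF b1, of "1 - \<delta>"] \<delta>(1) by (simp add: mult_ac)
  also have "\<dots> \<le> (t * bad_count t) * sum x (set vs)" using b2 by (simp add: mult_ac)
  also have "\<dots> \<le> ((1 - \<delta>) * cover_factor t * 2 ^ (t - 1)) * sum x (set vs)"
    using \<delta>(2) x0 by (intro mult_right_mono) auto
  finally have "((1 - \<delta>) * 2 ^ (t - 1)) * length (filter bd S)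
      \<le> ((1 - \<delta>) * 2 ^ (t - 1)) * (cover_factor t * sum x (set vs))" by (simp add: mult_ac)
  then have "length (filter bd S) \<le> cover_factor t * sum x (set vs)"
    by (rule mult_left_le_imp_le) (use \<delta>(1) in simp)
  moreover have "card (set C') \<le> card (set C) + length (filter bd S)"
    unfolding C' nb[symmetric] by (rule card_Un_le)
  ultimately show "card (set C') \<le> card (set C) + cover_factor t * sum x (set vs)" by linarith
qed

end

text \<open>How the constants of the algorithm depend on \<open>t\<close>: \<open>1 / heavy t - 1 / cover_factor t\<close> is the
  additive precision needed of the fractional covers, and \<open>\<delta>\<close> the relative precision needed of the
  number of saturated vertices.\<close>

definition good_constants :: "nat \<Rightarrow> nat \<Rightarrow> nat \<Rightarrow> nat \<Rightarrow> real \<Rightarrow> bool" where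
  "good_constants t c0 c1 c2 \<delta> \<longleftrightarrow>
     \<delta> < 1 \<and> real t * bad_count t \<le> (1 - \<delta>) * cover_factor t * 2 ^ (t - 1) \<and>
     4 \<le> c0 * (1 / heavy t - 1 / cover_factor t) \<and> c1 > 0 \<and> 2 * real c0 * t \<le> \<delta> * c1 \<and>
     4 * (real c0 + c1) < (1 / heavy t - 1 / cover_factor t) * c2"

lemma precision_pos: "t \<ge> 2 \<Longrightarrow> 0 < 1 / real (heavy t) - 1 / cover_factor t"
  and precision_le_1: "t \<ge> 2 \<Longrightarrow> 1 / real (heavy t) - 1 / cover_factor t \<le> 1"
proof -
  assume t: "t \<ge> 2"
  have h: "1 \<le> real (heavy t)" "heavy t < cover_factor t"
    using heavy_pos[OF t] heavy_less[OF t] by auto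
  then have "1 / cover_factor t < 1 / real (heavy t)" by (intro divide_strict_left_mono) auto
  then show "0 < 1 / real (heavy t) - 1 / cover_factor t" by simp
  have "1 / real (heavy t) \<le> 1" "0 \<le> 1 / cover_factor t" using h by auto
  then show "1 / real (heavy t) - 1 / cover_factor t \<le> 1" by linarith
qed

text \<open>The strictness of \<open>bad_count_bound\<close> leaves room for some
  \<open>\<delta> > 0\<close>, and \<open>precision_pos\<close> for the division by
  \<open>\<sigma>\<close>; then \<open>c0\<close>, \<open>c1\<close>, \<open>c2\<close> can be taken
  large enough one after the other.\<close>

lemma good_constants_exist:
  assumes t: "t \<ge> 2" shows "\<exists>c0 c1 c2 \<delta>. good_constants t c0 c1 c2 \<delta>"
proof -
  define \<alpha> \<sigma> q where "\<alpha> = cover_factor t" and "\<sigma> = 1 / heavy t - 1 / \<alpha>"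
    and "q = real t * bad_count t / (\<alpha> * 2 ^ (t - 1))"
  have \<sigma>: "\<sigma> > 0" unfolding \<sigma>_def \<alpha>_def by (rule precision_pos[OF t])
  have \<alpha>: "\<alpha> * 2 ^ (t - 1) > 0" using cover_factor_gt_2[OF t] by (simp add: \<alpha>_def)
  have q: "q < 1" "0 \<le> q"
    using bad_count_bound[OF t] \<alpha> by (auto simp: q_def \<alpha>_def pos_divide_less_eq)
  \<comment> \<open>\<open>q\<close> is the size of the bad part relative to what is allowed, so
    \<open>1 - q\<close> is the available slack; half of it is used, which also keeps
    \<open>\<delta>\<close> below 1.\<close>
  define \<delta> where "\<delta> = (1 - q) / 2"
  have \<delta>: "0 < \<delta>" "\<delta> < 1" "q \<le> 1 - \<delta>" using q by (auto simp: \<delta>_def field_simps)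
  have "real t * bad_count t = q * (\<alpha> * 2 ^ (t - 1))" 
    using \<alpha> unfolding q_def by (metis less_irrefl nonzero_divide_eq_eq)
  also have "\<dots> \<le> (1 - \<delta>) * (\<alpha> * 2 ^ (t - 1))" using \<delta> \<alpha> by (intro mult_right_mono) auto
  finally have 1: "real t * bad_count t \<le> (1 - \<delta>) * \<alpha> * 2 ^ (t - 1)" by (simp add: mult.assoc)
  obtain c0 :: nat where c0: "4 / \<sigma> \<le> c0" using real_arch_simple by blast
  obtain c1 :: nat where c1: "2 * real c0 * t / \<delta> \<le> c1" using real_arch_simple by blast
  obtain c2 :: nat where c2: "4 * (real c0 + Suc c1) / \<sigma> < c2" using reals_Archimedean2 by blast
  have "good_constants t c0 (Suc c1) c2 \<delta>"
    unfolding good_constants_def \<alpha>_def[symmetric] \<sigma>_def[symmetric]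
  proof (intro conjI)
    show "4 \<le> c0 * \<sigma>" using c0 \<sigma> by (simp add: pos_divide_le_eq)
    have "2 * real c0 * t \<le> \<delta> * c1" using c1 \<delta> by (simp add: pos_divide_le_eq mult.commute)
    also have "\<dots> \<le> \<delta> * Suc c1" using \<delta> by (intro mult_left_mono) auto
    finally show "2 * real c0 * t \<le> \<delta> * Suc c1" .
    show "4 * (real c0 + Suc c1) < \<sigma> * c2" using c2 \<sigma> by (simp add: pos_divide_less_eq mult.commute)
  qed (use \<delta> 1 in auto)
  then show ?thesis by blast
qed

lemma cover_step_cases: "cover_step c0 c1 c2 t vs es C = C \<or> (\<exists>P. cover_step c0 c1 c2 t vs es C = filter P vs)"
  unfolding cover_step_def extend_def add_bad_def add_heavy_def by auto

context blown_up_vertices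
begin

text \<open>Two measures: the number of uncovered edges drops, and \<open>card C\<close> plus the
  factor times the fractional optimum of the rest does not grow. When the colouring is used, no edge
  remains and the zero function is the new cover.\<close>

lemma cover_step_spec:
  assumes c: "good_constants t c0 c1 c2 \<delta>" and es: "\<And>e. e \<in> set es \<Longrightarrow> blown_up t vs e"
    and C: "set C \<subseteq> set vs"
  defines "C' \<equiv> cover_step c0 c1 c2 t vs es C"
  shows "uncovered C es \<noteq> [] \<Longrightarrow> length (uncovered C' es) < length (uncovered C es)"
    and "fractional_on vs (uncovered C es) x \<Longrightarrow> \<exists>x'. fractional_on vs (uncovered C' es) x' \<and>
      card (set C') + cover_factor t * sum x' (set vs) \<le> card (set C) + cover_factor t * sum x (set vs)"
proof -
  have "(uncovered C es \<noteq> [] \<longrightarrow> length (uncovered C' es) < length (uncovered C es)) \<and>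
    (\<forall>x. fractional_on vs (uncovered C es) x \<longrightarrow> (\<exists>x'. fractional_on vs (uncovered C' es) x' \<and>
      card (set C') + cover_factor t * sum x' (set vs) \<le> card (set C) + cover_factor t * sum x (set vs)))"
  proof (cases "uncovered C es = []")
    case True
    then show ?thesis by (auto simp: C'_def cover_step_def)
  next
    case False
    define E k l1 l2 where "E = uncovered C es" and "k = c0 * length vs"
      and "l1 = ticks c1 vs 2" and "l2 = ticks c2 vs 4"
    define n where "n = length vs"
    define \<sigma> where "\<sigma> = 1 / real (heavy t) - 1 / cover_factor t"
    have \<sigma>: "0 < \<sigma>" "\<sigma> \<le> 1" using precision_pos precision_le_1 t_ge_2 by (auto simp: \<sigma>_def)
    have c': "\<delta> < 1" "real t * bad_count t \<le> (1 - \<delta>) * cover_factor t * 2 ^ (t - 1)"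
      "4 \<le> c0 * \<sigma>" "c1 > 0" "2 * real c0 * t \<le> \<delta> * c1" "4 * (real c0 + c1) < \<sigma> * c2"
      using c by (auto simp: good_constants_def \<sigma>_def)
    have E: "E \<noteq> []" "\<And>e. e \<in> set E \<Longrightarrow> blown_up t vs e" using False es by (auto simp: E_def uncovered_def)
    have n: "n > 0"
    proof -
      obtain e where "e \<in> set E" using E(1) by (cases E) auto
      then have "card (members vs e) = t" by (intro card_members E)
      then have "members vs e \<noteq> {}" using t_ge_2 by auto
      then show ?thesis by (auto simp: members_def n_def)
    qed
    have c0: "c0 > 0" using c'(3) by (cases c0) auto
    have c2: "c2 > 0"
    proof (rule ccontr)
      assume "\<not> c2 > 0"
      then show False using c'(6) by simp
    qed
    interpret blown_up_edges vs t E k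
      by unfold_locales (use E n c0 in \<open>auto simp: k_def n_def\<close>)
    have cV: "card (set vs) = n" using distinct_vs by (simp add: n_def distinct_card)
    have len: "length l1 = c1 * n ^ 2" "length l2 = c2 * n ^ 4"
      by (simp_all add: l1_def l2_def length_ticks n_def del: ticks.simps)
    have l2: "l2 \<noteq> []" using len(2) c2 n by (metis length_0_conv mult_is_0 not_gr0 power_not_zero)
    obtain i where i: "length l1 \<le> i" "best_weights k E vs l1 l2 = wlist k E vs i"
      "\<And>j. length l1 \<le> j \<Longrightarrow> j < length l1 + length l2 \<Longrightarrow> mw.total i * mw.D j \<le> mw.total j * mw.D i"
      using best_weights_spec[OF l2, of l1] by blast
    have opt: "near_opt i \<sigma>"
      unfolding near_opt_def
    proof (intro allI impI)
      fix x assume x: "fractional_on vs E x"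
      show "real (mw.total i) \<le> (sum x (set vs) + \<sigma>) * mw.D i"
      proof (rule mw.near_optimal[where R = "length l2" and ?i0.0 = "length l1"])
        show "mw.fractional x" using x by (simp add: frac_iff)
        show "4 * real (card (set vs)) \<le> real k * \<sigma>"
          using mult_right_mono[OF c'(3), of "real n"] unfolding cV by (simp add: k_def n_def mult_ac)
        have "4 * real n ^ 2 * (real k * n + length l1) = (4 * (real c0 + c1)) * real n ^ 4"
          unfolding len k_def n_def[symmetric] by (simp add: power2_eq_square power4_eq_xxxx algebra_simps)
        also have "\<dots> < (\<sigma> * c2) * real n ^ 4" using c'(6) n by (intro mult_strict_right_mono) auto
        finally show "4 * (real (card (set vs)))\<^sup>2 * real (k * card (set vs) + length l1) < \<sigma> * real (length l2)"
          unfolding cV len by (simp add: mult.assoc)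
      qed (use \<sigma> i(3) in auto)
    qed
    have C'_eq: "C' = extend t vs E C (wlist k E vs i)"
    proof -
      have "best_weights (c0 * length vs) (uncovered C es) vs (ticks c1 vs 2) (ticks c2 vs 4) = wlist k E vs i"
        using i(2) by (simp only: E_def k_def l1_def l2_def)
      then show ?thesis using False by (simp only: C'_def cover_step_def if_False E_def)
    qed
    have f1: "fractional_on vs E (\<lambda>_. 1)" using mw.fractional_ones frac_iff by simp
    show ?thesis
    proof (cases "above (mw.D i) (heavy t) (wlist k E vs i) = []")
      case False
      note st = add_heavy_step[OF opt[unfolded \<sigma>_def] E_def C refl False]
      from False have "C' = add_heavy vs C (above (mw.D i) (heavy t) (wlist k E vs i))"
        by (simp add: C'_eq extend_def min_len_wlist)
      then show ?thesis using st(1) st(2)[OF f1] unfolding E_def[symmetric] by simp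
    next
      case True
      have "2 * real k * t * card (set vs) = (2 * real c0 * t) * real n ^ 2"
        unfolding cV k_def n_def[symmetric] by (simp add: power2_eq_square)
      also have "\<dots> \<le> (\<delta> * c1) * real n ^ 2" using c'(5) by (intro mult_right_mono) auto
      also have "\<dots> = \<delta> * real (length l1)" by (simp add: len)
      also have "\<dots> \<le> \<delta> * i"
      proof (rule mult_left_mono)
        have "0 \<le> 2 * real c0 * t" by simp
        then have "0 \<le> \<delta> * c1" using c'(5) by linarith
        then show "0 \<le> \<delta>" using c'(4) by (simp add: zero_le_mult_iff)
      qed (use i(1) in simp)
      finally have b: "2 * real k * t * card (set vs) \<le> \<delta> * i" .
      have "length l1 > 0" using len(1) c'(4) n by simp
      then have ip: "i > 0" using i(1) by linarith
      note st = add_bad_step[OF b ip c'(1,2) E_def C True refl refl]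
      from True have eq: "C' = add_bad t vs C (above (mw.D i) (t * heavy t) (wlist k E vs i))
          (colouring t (above (mw.D i) (t * heavy t) (wlist k E vs i)) (concat vs))"
        by (simp add: C'_eq extend_def min_len_wlist)
      have unc: "uncovered C' es = []" unfolding eq by (rule st(1)[OF f1])
      show ?thesis
      proof (intro conjI allI impI)
        show "length (uncovered C' es) < length (uncovered C es)" using unc \<open>uncovered C es \<noteq> []\<close> by simp
        fix x assume "fractional_on vs (uncovered C es) x"
        then have "card (set C') \<le> card (set C) + cover_factor t * sum x (set vs)"
          unfolding eq E_def[symmetric] by (rule st(2))
        moreover have "fractional_on vs (uncovered C' es) (\<lambda>_. 0)" by (simp add: unc fractional_on_def)
        ultimately show "\<exists>x'. fractional_on vs (uncovered C' es) x' \<and>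
          card (set C') + cover_factor t * sum x' (set vs) \<le> card (set C) + cover_factor t * sum x (set vs)"
          by (intro exI[of _ "\<lambda>_. 0"]) auto
      qed
    qed
  qed
  then show "uncovered C es \<noteq> [] \<Longrightarrow> length (uncovered C' es) < length (uncovered C es)"
    and "fractional_on vs (uncovered C es) x \<Longrightarrow> \<exists>x'. fractional_on vs (uncovered C' es) x' \<and>
      card (set C') + cover_factor t * sum x' (set vs) \<le> card (set C) + cover_factor t * sum x (set vs)"
    by blast+
qed

text \<open>After \<open>length es\<close> rounds no edge is uncovered. The second measure of
  \<open>cover_step_spec\<close> starts at \<open>cover_factor t * sum x (set vs)\<close> and ends
  with at least the size of the cover.\<close>

lemma approx_cover_spec:
  assumes c: "good_constants t c0 c1 c2 \<delta>" and es: "\<And>e. e \<in> set es \<Longrightarrow> blown_up t vs e"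
  defines "C \<equiv> approx_cover c0 c1 c2 t vs es"
  shows "distinct C" "set C \<subseteq> set vs" "\<And>e. e \<in> set es \<Longrightarrow> \<exists>U\<in>set C. memb U e"
    "fractional_on vs es x \<Longrightarrow> card (set C) \<le> cover_factor t * sum x (set vs)"
proof -
  define Cs where "Cs j = (cover_step c0 c1 c2 t vs es ^^ j) []" for j
  have Cs_Suc: "Cs (Suc j) = cover_step c0 c1 c2 t vs es (Cs j)" for j by (simp add: Cs_def)
  have C: "C = Cs (length es)" by (simp add: C_def approx_cover_def foldr_const Cs_def)
  have wf: "distinct (Cs j) \<and> set (Cs j) \<subseteq> set vs" for j
  proof (induction j)
    case (Suc j)
    then show ?case using cover_step_cases[of c0 c1 c2 t vs es "Cs j"] distinct_vs
      unfolding Cs_Suc by auto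
  qed (simp add: Cs_def)
  have step1: "uncovered (Cs j) es \<noteq> [] \<Longrightarrow> length (uncovered (Cs (Suc j)) es) < length (uncovered (Cs j) es)" for j
    unfolding Cs_Suc using wf[of j] by (intro cover_step_spec(1)[OF c es]) auto
  have step2: "fractional_on vs (uncovered (Cs j) es) x \<Longrightarrow> \<exists>x'. fractional_on vs (uncovered (Cs (Suc j)) es) x' \<and>
      card (set (Cs (Suc j))) + cover_factor t * sum x' (set vs) \<le> card (set (Cs j)) + cover_factor t * sum x (set vs)"
    for j and x :: "'a list \<Rightarrow> real"
    unfolding Cs_Suc using wf[of j] by (intro cover_step_spec(2)[OF c es]) auto
  have len: "length (uncovered (Cs j) es) \<le> length es - j" for j
  proof (induction j)
    case 0
    then show ?case by (simp add: uncovered_def)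
  next
    case (Suc j)
    show ?case
    proof (cases "uncovered (Cs j) es = []")
      case True
      then show ?thesis by (simp add: Cs_Suc cover_step_def)
    next
      case False
      then show ?thesis using step1[of j] Suc by linarith
    qed
  qed
  have unc: "uncovered C es = []" using len[of "length es"] by (simp add: C)
  show "distinct C" "set C \<subseteq> set vs" using wf by (auto simp: C)
  show "\<exists>U\<in>set C. memb U e" if "e \<in> set es" for e
    using unc that by (auto simp: uncovered_def filter_empty_conv)
  assume x: "fractional_on vs es x"
  have "\<exists>x'. fractional_on vs (uncovered (Cs j) es) x' \<and>
      card (set (Cs j)) + cover_factor t * sum x' (set vs) \<le> cover_factor t * sum x (set vs)" for j
  proof (induction j)
    case 0
    have "uncovered (Cs 0) es = es" by (simp add: uncovered_def Cs_def)
    then show ?case using x by (intro exI[of _ x]) (simp add: Cs_def)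
  next
    case (Suc j)
    then obtain x' where x': "fractional_on vs (uncovered (Cs j) es) x'"
      "card (set (Cs j)) + cover_factor t * sum x' (set vs) \<le> cover_factor t * sum x (set vs)" by blast
    obtain x'' where "fractional_on vs (uncovered (Cs (Suc j)) es) x''"
      "card (set (Cs (Suc j))) + cover_factor t * sum x'' (set vs)
        \<le> card (set (Cs j)) + cover_factor t * sum x' (set vs)"
      using step2[OF x'(1)] by blast
    with x'(2) show ?case by (intro exI[of _ x'']) linarith
  qed
  then obtain x' where x': "fractional_on vs (uncovered C es) x'"
    "card (set C) + cover_factor t * sum x' (set vs) \<le> cover_factor t * sum x (set vs)"
    unfolding C by blast
  have "0 \<le> cover_factor t * sum x' (set vs)"
    using x'(1) cover_factor_gt_2[OF t_ge_2] by (intro mult_nonneg_nonneg sum_nonneg) (auto simp: fractional_on_def)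
  with x'(2) show "card (set C) \<le> cover_factor t * sum x (set vs)" by linarith
qed

end

section \<open>Running time of the algorithm\<close>

lemma poly_time_div [poly_time_intros]: "poly_time f \<Longrightarrow> poly_time g \<Longrightarrow> poly_time (\<lambda>x. f x div g x :: nat)"
  using poly_time_op[of f g Divide] by simp

lemma poly_time_even [poly_time_intros]: assumes "poly_time f" shows "poly_time (\<lambda>x. even (f x :: nat))"
proof -
  have "even n \<longleftrightarrow> 2 * (n div 2) = n" for n :: nat by (metis dvd_mult_div_cancel dvd_triv_left)
  then show ?thesis by (simp only:) (intro poly_time_intros assms)
qed

lemma poly_time_memb [poly_time_intros]:
  fixes f :: "'x::encodable \<Rightarrow> nat list"
  assumes "poly_time f" "poly_time e" shows "poly_time (\<lambda>x. memb (f x) (e x))"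
proof -
  have "memb U e \<longleftrightarrow> (\<exists>U'\<in>set e. (\<forall>v\<in>set U. v \<in> set U') \<and> (\<forall>v\<in>set U'. v \<in> set U))" for U :: "nat list" and e
    unfolding memb_def by blast
  then show ?thesis by (simp only:) (intro poly_time_intros poly_time_comp[OF assms(1)] poly_time_comp[OF assms(2)] assms)
qed

lemma poly_time_wlen [poly_time_intros]:
  fixes W :: "'x::encodable \<Rightarrow> (nat list \<times> nat) list"
  assumes "poly_time W" "poly_time e" shows "poly_time (\<lambda>x. wlen (W x) (e x))"
  unfolding wlen_def by (intro poly_time_intros poly_time_comp[OF assms(1)] poly_time_comp[OF assms(2)] assms)

lemma poly_time_lightest [poly_time_intros]:
  fixes W :: "'x::encodable \<Rightarrow> (nat list \<times> nat) list"
  assumes "poly_time W" "poly_time E" shows "poly_time (\<lambda>x. lightest (W x) (E x))"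
  unfolding lightest_def
  by (rule poly_time_foldr_additive[where g = "\<lambda>z. sz z"])
    ((intro poly_time_intros poly_bounded_intros poly_time_comp[OF assms(1)] poly_time_comp[OF assms(2)] assms)+, simp)

lemma poly_time_min_len [poly_time_intros]:
  fixes W :: "'x::encodable \<Rightarrow> (nat list \<times> nat) list"
  assumes "poly_time W" "poly_time E" shows "poly_time (\<lambda>x. min_len (W x) (E x))"
  unfolding min_len_def by (intro poly_time_intros assms)

lemma poly_time_total_weight [poly_time_intros]:
  fixes W :: "'x::encodable \<Rightarrow> (nat list \<times> nat) list"
  assumes "poly_time W" shows "poly_time (\<lambda>x. total_weight (W x))"
  unfolding total_weight_def by (intro poly_time_intros assms)

lemma poly_time_mw_step [poly_time_intros]:
  fixes W :: "'x::encodable \<Rightarrow> (nat list \<times> nat) list"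
  assumes "poly_time k" "poly_time E" "poly_time W" shows "poly_time (\<lambda>x. mw_step (k x) (E x) (W x))"
  unfolding mw_step_def
  by (intro poly_time_intros poly_time_comp[OF assms(1)] poly_time_comp[OF assms(2)] poly_time_comp[OF assms(3)] assms)

lemma poly_time_better [poly_time_intros]:
  fixes W :: "'x::encodable \<Rightarrow> (nat list \<times> nat) list"
  assumes "poly_time E" "poly_time W" "poly_time B" shows "poly_time (\<lambda>x. better (E x) (W x) (B x))"
  unfolding better_def by (intro poly_time_intros assms)

lemma wfun_le: "wfun k E vs i U \<le> (k + 1) ^ i"
proof (induction i arbitrary: U)
  case (Suc i)
  have "k * wfun k E vs i U \<le> (k + 1) * wfun k E vs i U" by simp
  moreover have "(k + 1) * wfun k E vs i U \<le> (k + 1) * (k + 1) ^ i"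
    using Suc by (rule mult_le_mono2)
  ultimately show ?case by auto
qed simp

text \<open>The weights are at most \<open>(k + 1) ^ i\<close>: exponential in value, but of bit
  length linear in the number of steps, so the scaling by \<open>k ^ i\<close> is
  affordable.\<close>

lemma sz_wlist:
  fixes vs :: "nat list list"
  assumes "i \<le> m" shows "sz (wlist k E vs i) \<le> 1 + sz vs * (sz vs + m * sz (k + 1) + 4)"
proof -
  have "sz (wlist k E vs i) \<le> 1 + length (wlist k E vs i) * (sz vs + m * sz (k + 1) + 3 + 1)"
  proof (rule sz_list_bound)
    fix p assume "p \<in> set (wlist k E vs i)"
    then obtain U where U: "U \<in> set vs" "p = (U, wfun k E vs i U)" by (auto simp: wlist_def)
    have "sz (wfun k E vs i U) \<le> sz ((k + 1) ^ i)" by (intro sz_nat_mono wfun_le)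
    also have "\<dots> \<le> 2 + i * sz (k + 1)" by (rule sz_nat_power)
    also have "\<dots> \<le> 2 + m * sz (k + 1)" using assms by (intro add_left_mono mult_le_mono1)
    finally show "sz p \<le> sz vs + m * sz (k + 1) + 3"
      unfolding U(2) sz_pair using sz_mem[OF U(1)] by linarith
  qed
  also have "\<dots> \<le> 1 + sz vs * (sz vs + m * sz (k + 1) + 4)"
    using length_le_sz[of vs] by (intro add_left_mono mult_le_mono) (auto simp: wlist_def simp del: enc_simps)
  finally show ?thesis .
qed

text \<open>One step enlarges every entry of the accumulator, so growth is not additive for
  arbitrary accumulators. The size bound instead uses that only the lists \<open>wlist\<close> are
  reached.\<close>

lemma poly_time_warm_up [poly_time_intros]:
  fixes vs :: "'x::encodable \<Rightarrow> nat list list"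
  assumes "poly_time k" "poly_time E" "poly_time vs" "poly_time l" shows "poly_time (\<lambda>x. warm_up (k x) (E x) (vs x) (l x))"
  unfolding warm_up_def
proof (rule poly_time_foldr)
  show "poly_bounded (\<lambda>x. 1 + sz (vs x) * (sz (vs x) + sz (l x) * sz (k x + 1) + 4))"
    by (intro poly_bounded_intros poly_time_size poly_time_intros assms)
  fix x zs ys assume l: "l x = zs @ ys"
  have "foldr (\<lambda>_. mw_step (k x) (E x)) ys (map (\<lambda>U. (U, 1)) (vs x)) = wlist (k x) (E x) (vs x) (length ys)"
    by (simp only: foldr_const funpow_mw_step)
  moreover have "length ys \<le> sz (l x)" using length_le_sz[of "l x"] by (simp add: l)
  ultimately show "sz (foldr (\<lambda>_. mw_step (k x) (E x)) ys (map (\<lambda>U. (U, 1)) (vs x)))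
      \<le> 1 + sz (vs x) * (sz (vs x) + sz (l x) * sz (k x + 1) + 4)"
    by (simp only: sz_wlist)
qed (intro poly_time_intros poly_time_comp[OF assms(1)] poly_time_comp[OF assms(2)] assms)+

text \<open>\<open>poly_time\<close> quantifies over all inputs, also those that encode no blown-up
  hypergraph, so sizes must be bounded outside the locale in which \<open>best_weights_spec\<close>
  is proved.\<close>

lemma best_weights_reachable:
  fixes k :: nat and E :: "'a list list list"
  shows "\<exists>i. i \<le> i0 + n \<and>
    ((\<lambda>s. (mw_step k E (fst s), better E (fst s) (snd s))) ^^ n) (wlist k E vs i0, wlist k E vs i0) =
      (wlist k E vs (i0 + n), wlist k E vs i)"
proof (induction n)
  case (Suc n)
  then obtain i where "i \<le> i0 + n"
    "((\<lambda>s. (mw_step k E (fst s), better E (fst s) (snd s))) ^^ n) (wlist k E vs i0, wlist k E vs i0) =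
      (wlist k E vs (i0 + n), wlist k E vs i)" by blast
  moreover have "better E (wlist k E vs (i0 + n)) (wlist k E vs i) \<in> {wlist k E vs (i0 + n), wlist k E vs i}"
    unfolding better_def by simp
  ultimately have "\<exists>j\<in>{i0 + n, i}. ((\<lambda>s. (mw_step k E (fst s), better E (fst s) (snd s))) ^^ Suc n)
      (wlist k E vs i0, wlist k E vs i0) = (wlist k E vs (i0 + Suc n), wlist k E vs j)"
    by (simp add: mw_step_wlist)
  with \<open>i \<le> i0 + n\<close> show ?case by (metis add_Suc_right insertE le_SucI order_refl singletonD)
qed auto

lemma poly_time_best_weights [poly_time_intros]:
  fixes vs :: "'x::encodable \<Rightarrow> nat list list"
  assumes "poly_time k" "poly_time E" "poly_time vs" "poly_time l1" "poly_time l2"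
  shows "poly_time (\<lambda>x. best_weights (k x) (E x) (vs x) (l1 x) (l2 x))"
  unfolding best_weights_def
proof (intro poly_time_snd, rule poly_time_foldr)
  let ?b = "\<lambda>x. 1 + sz (vs x) * (sz (vs x) + (sz (l1 x) + sz (l2 x)) * sz (k x + 1) + 4)"
  show "poly_bounded (\<lambda>x. 1 + (?b x + ?b x))"
    by (intro poly_bounded_intros poly_time_size poly_time_intros assms)
  fix x zs ys assume l: "l2 x = zs @ ys"
  let ?s = "foldr (\<lambda>_ s. (mw_step (k x) (E x) (fst s), better (E x) (fst s) (snd s))) ys
      (warm_up (k x) (E x) (vs x) (l1 x), warm_up (k x) (E x) (vs x) (l1 x))"
  obtain i where i: "i \<le> length (l1 x) + length ys" "?s =
     (wlist (k x) (E x) (vs x) (length (l1 x) + length ys), wlist (k x) (E x) (vs x) i)"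
    using best_weights_reachable[of "length (l1 x)" "length ys" "k x" "E x" "vs x"]
    unfolding foldr_const warm_up_eq by blast
  have le: "length (l1 x) + length ys \<le> sz (l1 x) + sz (l2 x)"
    using length_le_sz[of "l1 x"] length_le_sz[of "l2 x"] by (simp add: l)
  show "sz ?s \<le> 1 + (?b x + ?b x)"
    unfolding i(2) sz_pair
    using sz_wlist[OF le, of "k x" "E x" "vs x"] sz_wlist[OF order_trans[OF i(1) le], of "k x" "E x" "vs x"]
    by linarith
qed (intro poly_time_intros poly_time_comp[OF assms(1)] poly_time_comp[OF assms(2)] assms)+

lemma poly_time_uncovered [poly_time_intros]:
  fixes C :: "'x::encodable \<Rightarrow> nat list list"
  assumes "poly_time C" "poly_time es" shows "poly_time (\<lambda>x. uncovered (C x) (es x))"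
  unfolding uncovered_def by (intro poly_time_intros poly_time_comp[OF assms(1)] poly_time_comp[OF assms(2)] assms)

lemma poly_time_above [poly_time_intros]:
  fixes B :: "'x::encodable \<Rightarrow> (nat list \<times> nat) list"
  assumes "poly_time d" "poly_time B" shows "poly_time (\<lambda>x. above (d x) c (B x))"
  unfolding above_def by (intro poly_time_intros poly_time_comp[OF assms(1)] poly_time_comp[OF assms(2)] assms)

lemma poly_time_add_heavy [poly_time_intros]:
  fixes C :: "'x::encodable \<Rightarrow> nat list list"
  assumes "poly_time vs" "poly_time C" "poly_time H" shows "poly_time (\<lambda>x. add_heavy (vs x) (C x) (H x))"
  unfolding add_heavy_def by (intro poly_time_intros poly_time_comp[OF assms(2)] poly_time_comp[OF assms(3)] assms)

lemma poly_time_cnt [poly_time_intros]: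
  fixes A :: "'x::encodable \<Rightarrow> nat list"
  assumes "poly_time A" "poly_time U" shows "poly_time (\<lambda>x. cnt (A x) (U x))"
  unfolding cnt_def by (intro poly_time_intros poly_time_comp[OF assms(1)] assms)

lemma poly_time_weight [poly_time_intros]: "poly_time r \<Longrightarrow> poly_time b \<Longrightarrow> poly_time (\<lambda>x. weight t (r x) (b x))"
  unfolding weight_def by (rule poly_time_table2)

lemma poly_time_bad [poly_time_intros]: "poly_time r \<Longrightarrow> poly_time b \<Longrightarrow> poly_time (\<lambda>x. bad t (r x) (b x))"
  unfolding bad_def by (intro poly_time_intros)

lemma poly_time_col_cost [poly_time_intros]:
  fixes S :: "'x::encodable \<Rightarrow> nat list list"
  assumes "poly_time S" "poly_time R" "poly_time B" shows "poly_time (\<lambda>x. col_cost t (S x) (R x) (B x))"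
  unfolding col_cost_def by (intro poly_time_intros poly_time_comp[OF assms(2)] poly_time_comp[OF assms(3)] assms)

lemma poly_time_col_step [poly_time_intros]:
  fixes S :: "'x::encodable \<Rightarrow> nat list list"
  assumes "poly_time S" "poly_time v" "poly_time c" shows "poly_time (\<lambda>x. col_step t (S x) (v x) (c x))"
  unfolding col_step_def by (intro poly_time_intros assms)

lemma poly_time_colouring [poly_time_intros]:
  fixes S :: "'x::encodable \<Rightarrow> nat list list"
  assumes "poly_time S" "poly_time l" shows "poly_time (\<lambda>x. colouring t (S x) (l x))"
  unfolding colouring_def
proof (rule poly_time_foldr_additive[where g = "\<lambda>z. sz z"])
  fix x y and c :: "nat list \<times> nat list"
  show "sz (col_step t (S x) y c) \<le> sz c + sz (x, y)"
    by (cases c) (auto simp: col_step_def)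
qed (intro poly_time_intros poly_bounded_intros poly_time_comp[OF assms(1)] assms)+

lemma poly_time_add_bad [poly_time_intros]:
  fixes C :: "'x::encodable \<Rightarrow> nat list list"
  assumes "poly_time vs" "poly_time C" "poly_time S" "poly_time c" shows "poly_time (\<lambda>x. add_bad t (vs x) (C x) (S x) (c x))"
  unfolding add_bad_def
  by (intro poly_time_intros poly_time_comp[OF assms(2)] poly_time_comp[OF assms(3)] poly_time_comp[OF assms(4)] assms)

lemma poly_time_extend [poly_time_intros]:
  fixes C :: "'x::encodable \<Rightarrow> nat list list"
  assumes "poly_time vs" "poly_time E" "poly_time C" "poly_time B" shows "poly_time (\<lambda>x. extend t (vs x) (E x) (C x) (B x))"
  unfolding extend_def by (intro poly_time_intros assms)

lemma poly_time_ticks [poly_time_intros]: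
  assumes "poly_time vs" shows "poly_time (\<lambda>x. ticks c (vs x) d)"
proof (induction d)
  case (Suc d)
  then show ?case unfolding ticks.simps by (intro poly_time_intros poly_time_comp[OF Suc] assms)
qed (simp add: poly_time_const)

lemma poly_time_cover_step [poly_time_intros]:
  fixes C :: "'x::encodable \<Rightarrow> nat list list"
  assumes "poly_time vs" "poly_time es" "poly_time C" shows "poly_time (\<lambda>x. cover_step c0 c1 c2 t (vs x) (es x) (C x))"
  unfolding cover_step_def by (intro poly_time_intros assms)

lemma poly_time_approx_cover: "poly_time (\<lambda>x :: nat list list \<times> nat list list list. approx_cover c0 c1 c2 t (fst x) (snd x))"
  unfolding approx_cover_def
proof (rule poly_time_foldr_additive[where g = "\<lambda>z. sz z"])
  fix x :: "nat list list \<times> nat list list list" and y :: "nat list list" and C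
  consider "cover_step c0 c1 c2 t (fst x) (snd x) C = C"
    | P where "cover_step c0 c1 c2 t (fst x) (snd x) C = filter P (fst x)"
    using cover_step_cases by blast
  then show "sz (cover_step c0 c1 c2 t (fst x) (snd x) C) \<le> sz C + sz (x, y)"
  proof cases
    case (2 P)
    have "sz (filter P (fst x)) \<le> sz x" using sz_filter[of P "fst x"] sz_fst[of x] by linarith
    then show ?thesis unfolding 2 sz_pair by linarith
  qed simp
qed (intro poly_time_intros poly_bounded_intros)+

section \<open>Covers of blown-up hypergraphs\<close>

text \<open>Describes decoded inputs and, over any vertex type, the lists chosen for the existential
  bound, so that both claims share one analysis.\<close>

definition lists_hypergraph :: "'a list list \<Rightarrow> 'a list list list \<Rightarrow> 'a set hypergraph \<Rightarrow> bool" where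
  "lists_hypergraph vs es H \<longleftrightarrow>
     distinct (map set vs) \<and> (\<forall>U\<in>set vs. distinct U) \<and> set ` set vs = verts H \<and>
     (\<lambda>e. set ` set e) ` set es = edges H"

lemma approx_cover_blowup:
  assumes t: "t \<ge> 2" and c: "good_constants t c0 c1 c2 \<delta>"
    and G: "finite_hypergraph G" "uniform t G" and L: "lists_hypergraph vs es (blowup (t - 1) G)"
  defines "C \<equiv> approx_cover c0 c1 c2 t vs es"
  shows "distinct C" "set C \<subseteq> set vs" "vertex_cover (blowup (t - 1) G) (set ` set C)"
    "fractional_cover (blowup (t - 1) G) x \<Longrightarrow>
      card (set ` set C) \<le> cover_factor t * sum x (verts (blowup (t - 1) G))"
proof -
  let ?H = "blowup (t - 1) G"
  have V: "set ` set vs = verts ?H" and Ed: "(\<lambda>e. set ` set e) ` set es = edges ?H"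
    using L by (auto simp: lists_hypergraph_def)
  have "distinct U \<and> length U = t - 1" if "U \<in> set vs" for U
  proof -
    have "set U \<in> verts ?H" using V that by blast
    then have "card (set U) = t - 1" by (auto simp: blowup_def nsets_def)
    moreover have "distinct U" using L that by (auto simp: lists_hypergraph_def)
    ultimately show ?thesis by (simp add: distinct_card)
  qed
  then interpret blown_up_vertices vs t
    using t L by unfold_locales (auto simp: lists_hypergraph_def)
  have es: "blown_up t vs e" if "e \<in> set es" for e
  proof -
    have "set ` set e \<in> edges ?H" using Ed that by blast
    then obtain g where g: "g \<in> edges G" "set ` set e = nsets g (t - 1)" by (auto simp: blowup_def)
    then have "g \<subseteq> verts G" "card g = t" "finite (verts G)"
      using G by (auto simp: finite_hypergraph_def uniform_def)
    moreover have "nsets g (t - 1) \<subseteq> verts ?H"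
      using g(1) \<open>g \<subseteq> verts G\<close> by (auto simp: blowup_def nsets_def)
    ultimately show ?thesis
      unfolding blown_up_def V using g(2) by (intro exI[of _ g]) (auto intro: finite_subset)
  qed
  note C = approx_cover_spec[of c0 c1 c2 \<delta> es, OF c es, folded C_def]
  show "distinct C" "set C \<subseteq> set vs" using C by auto
  have inj: "inj_on set (set C)" using C(2) inj_sets by (meson inj_on_subset)
  show "vertex_cover ?H (set ` set C)"
    unfolding vertex_cover_def
  proof (intro conjI ballI)
    show "set ` set C \<subseteq> verts ?H" using C(2) V by blast
    fix f assume "f \<in> edges ?H"
    then obtain e where "e \<in> set es" "f = set ` set e" using Ed by blast
    then show "set ` set C \<inter> f \<noteq> {}" using C(3)[of e] unfolding memb_def by blast
  qed
  assume x: "fractional_cover ?H x"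
  have fr: "fractional_on vs es (\<lambda>U. x (set U))"
    unfolding fractional_on_def
  proof (intro conjI ballI)
    show "0 \<le> x (set U)" if "U \<in> set vs" for U
      using x V that by (auto simp: fractional_cover_def)
    fix e assume e: "e \<in> set es"
    then have "set ` set e \<in> edges ?H" using Ed by blast
    then have "1 \<le> sum x (set ` set e)" using x by (auto simp: fractional_cover_def)
    also have "\<dots> = sum x (set ` members vs e)" using members_image[OF es[OF e]] by simp
    also have "\<dots> = (\<Sum>U\<in>members vs e. x (set U))"
      by (rule sum.reindex_cong[OF inj_on_subset[OF inj_sets members_subset]]) auto
    finally show "1 \<le> (\<Sum>U\<in>members vs e. x (set U))" .
  qed
  have "real (card (set ` set C)) = card (set C)" using inj by (simp add: card_image)
  also have "\<dots> \<le> cover_factor t * (\<Sum>U\<in>set vs. x (set U))" using C(4)[OF _ fr] by simp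
  also have "(\<Sum>U\<in>set vs. x (set U)) = sum x (verts ?H)"
    unfolding V[symmetric] by (rule sum.reindex_cong[OF inj_sets refl refl, symmetric])
  finally show "card (set ` set C) \<le> cover_factor t * sum x (verts ?H)" .
qed

section \<open>List representations and elementary facts on covers\<close>

lemma finite_list_of_lists:
  assumes "finite A" "\<And>X. X \<in> A \<Longrightarrow> finite X"
  shows "\<exists>xs. distinct (map set xs) \<and> (\<forall>U\<in>set xs. distinct U) \<and> set ` set xs = A"
proof -
  obtain Xs where Xs: "set Xs = A" "distinct Xs" using finite_distinct_list[OF assms(1)] by blast
  have "\<exists>l. \<forall>X\<in>A. set (l X) = X \<and> distinct (l X)"
    using assms(2) finite_distinct_list by (intro bchoice) blast
  then obtain l where l: "\<And>X. X \<in> A \<Longrightarrow> set (l X) = X \<and> distinct (l X)" by blast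
  have "map (set \<circ> l) Xs = Xs" using l Xs(1) by (intro map_idI) auto
  then have "distinct (map set (map l Xs)) \<and> (\<forall>U\<in>set (map l Xs). distinct U) \<and> set ` set (map l Xs) = A"
    using l Xs by (auto simp: image_iff)
  then show ?thesis by blast
qed

lemma finite_blowup:
  assumes "finite_hypergraph G" shows "finite (verts (blowup k G))" "finite (edges (blowup k G))"
    "e \<in> edges (blowup k G) \<Longrightarrow> e \<subseteq> verts (blowup k G)" "U \<in> verts (blowup k G) \<Longrightarrow> finite U"
proof -
  have V: "finite (verts G)" "\<And>e. e \<in> edges G \<Longrightarrow> e \<subseteq> verts G"
    using assms by (auto simp: finite_hypergraph_def)
  then show "finite (verts (blowup k G))" by (simp add: blowup_def finite_imp_finite_nsets)
  have "edges G \<subseteq> Pow (verts G)" using V(2) by blast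
  then have "finite (edges G)" using V(1) by (meson finite_Pow_iff finite_subset)
  moreover have "edges (blowup k G) = (\<lambda>e. nsets e k) ` edges G" by (auto simp: blowup_def)
  ultimately show "finite (edges (blowup k G))" by simp
  show "U \<in> verts (blowup k G) \<Longrightarrow> finite U" by (auto simp: blowup_def nsets_def)
  assume "e \<in> edges (blowup k G)"
  then obtain f where f: "f \<in> edges G" "e = nsets f k" by (auto simp: blowup_def)
  then show "e \<subseteq> verts (blowup k G)"
    using nsets_mono[OF V(2)[OF f(1)], of k] by (auto simp: blowup_def nsets_def)
qed

lemma lists_hypergraph_exist:
  assumes "finite_hypergraph G" shows "\<exists>vs es. lists_hypergraph vs es (blowup k G)"
proof -
  note fin = finite_blowup[OF assms, where k = k]
  obtain vs where vs: "distinct (map set vs)" "\<forall>U\<in>set vs. distinct U" "set ` set vs = verts (blowup k G)"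
    using finite_list_of_lists[OF fin(1)] fin(4) by blast
  have "\<exists>l. set ` set l = e" if e: "e \<in> edges (blowup k G)" for e
  proof -
    have "finite e" "\<And>X. X \<in> e \<Longrightarrow> finite X" using fin(1,3,4) e by (blast intro: finite_subset)+
    then show ?thesis using finite_list_of_lists[of e] by blast
  qed
  then obtain l where l: "\<And>e. e \<in> edges (blowup k G) \<Longrightarrow> set ` set (l e) = e" by metis
  obtain es where "set es = edges (blowup k G)" using finite_list[OF fin(2)] by blast
  then have "(\<lambda>e. set ` set e) ` set (map l es) = edges (blowup k G)" using l by (auto simp: image_iff)
  then show ?thesis using vs unfolding lists_hypergraph_def by blast
qed

lemma cover_number_le:
  assumes "finite (verts H)" "vertex_cover H C" shows "cover_number H \<le> card C"
proof -
  have "finite {C. vertex_cover H C}"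
    using assms(1) by (rule finite_subset[OF _ finite_Pow_iff[THEN iffD2], rotated]) (auto simp: vertex_cover_def)
  then have "finite {card C | C. vertex_cover H C}" by simp
  then show ?thesis unfolding cover_number_def using assms(2) by (intro Min_le) auto
qed

lemma cover_number_attained:
  assumes "finite (verts H)" "vertex_cover H C0" shows "\<exists>C. vertex_cover H C \<and> card C = cover_number H"
proof -
  have "finite {C. vertex_cover H C}"
    using assms(1) by (rule finite_subset[OF _ finite_Pow_iff[THEN iffD2], rotated]) (auto simp: vertex_cover_def)
  then have "finite {card C | C. vertex_cover H C}" "{card C | C. vertex_cover H C} \<noteq> {}"
    using assms(2) by auto
  from Min_in[OF this] show ?thesis unfolding cover_number_def by auto
qed

text \<open>Used twice: it makes the set under the infimum nonempty, and it lets a guarantee against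
  fractional covers be compared with a minimum cover.\<close>

lemma fractional_cover_indicator:
  assumes "vertex_cover H C" "finite (verts H)" "\<And>e. e \<in> edges H \<Longrightarrow> e \<subseteq> verts H"
  shows "fractional_cover H (\<lambda>v. of_bool (v \<in> C))" "(\<Sum>v\<in>verts H. of_bool (v \<in> C)) = real (card C)"
proof -
  have "1 \<le> (\<Sum>v\<in>e. of_bool (v \<in> C) :: real)" if e: "e \<in> edges H" for e
  proof -
    obtain v where v: "v \<in> C" "v \<in> e" using assms(1) e unfolding vertex_cover_def by blast
    have "finite e" using assms(2,3) e by (blast intro: finite_subset)
    then show ?thesis using v member_le_sum[of v e "\<lambda>v. of_bool (v \<in> C) :: real"] by simp
  qed
  then show "fractional_cover H (\<lambda>v. of_bool (v \<in> C))" by (simp add: fractional_cover_def)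
  have "verts H \<inter> C = C" using assms(1) by (auto simp: vertex_cover_def)
  then show "(\<Sum>v\<in>verts H. of_bool (v \<in> C)) = real (card C)"
    using assms(2) by (simp add: sum.If_cases of_bool_def Collect_mem_eq)
qed

section \<open>Decoding inputs and encoding outputs\<close>

lemma encodes_nat_set_iff:
  "encodes_set encodes_nat v U \<longleftrightarrow> (\<exists>us. distinct us \<and> set us = U \<and> v = enc us)"
proof -
  have "list_all2 encodes_nat vs xs \<longleftrightarrow> vs = map Atom xs" for vs xs
    by (induction vs arbitrary: xs) (auto simp: encodes_nat_def list_all2_Cons1 Cons_eq_map_conv)
  moreover have "foldr Cell (map Atom us) (Atom 0) = enc us" for us by (induction us) auto
  ultimately show ?thesis unfolding encodes_set_def by auto
qed

lemma list_of_encodings: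
  assumes "list_all2 R vs Xs" "\<And>v X. R v X \<Longrightarrow> \<exists>u. P u X \<and> v = enc u"
  shows "\<exists>us. list_all2 P us Xs \<and> foldr Cell vs (Atom 0) = enc us"
  using assms(1)
proof (induction rule: list_all2_induct)
  case (Cons v vs X Xs)
  then obtain u us where "P u X" "v = enc u" "list_all2 P us Xs" "foldr Cell vs (Atom 0) = enc us"
    using assms(2) by blast
  then show ?case by (intro exI[of _ "u # us"]) simp
qed (auto intro: exI[of _ "[]"])

lemma encodes_set_of_sets:
  assumes "encodes_set (encodes_set encodes_nat) v A"
  shows "\<exists>us. distinct (map set us) \<and> (\<forall>U\<in>set us. distinct U) \<and> set ` set us = A \<and> v = enc us"
proof -
  obtain vs Xs where Xs: "distinct Xs" "set Xs = A" "list_all2 (encodes_set encodes_nat) vs Xs"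
    "v = foldr Cell vs (Atom 0)" using assms unfolding encodes_set_def[of "encodes_set encodes_nat"] by blast
  obtain us where us: "list_all2 (\<lambda>u X. distinct u \<and> set u = X) us Xs" "v = enc us"
    using list_of_encodings[OF Xs(3), of "\<lambda>u X. distinct u \<and> set u = X"] encodes_nat_set_iff Xs(4) by auto
  from us(1) have "map set us = Xs \<and> (\<forall>U\<in>set us. distinct U)"
    by (induction rule: list_all2_induct) auto
  then show ?thesis using Xs(1,2) us(2) by (intro exI[of _ us]) (auto simp flip: set_map)
qed

lemma encodes_set_of_sets_of_sets:
  assumes "encodes_set (encodes_set (encodes_set encodes_nat)) v A"
  shows "\<exists>es. (\<lambda>e. set ` set e) ` set es = A \<and> v = enc es"
proof -
  obtain vs Xs where Xs: "set Xs = A" "list_all2 (encodes_set (encodes_set encodes_nat)) vs Xs"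
    "v = foldr Cell vs (Atom 0)"
    using assms unfolding encodes_set_def[of "encodes_set (encodes_set encodes_nat)"] by blast
  obtain es where es: "list_all2 (\<lambda>e X. set ` set e = X) es Xs" "v = enc es"
    using list_of_encodings[OF Xs(2), of "\<lambda>e X. set ` set e = X"] encodes_set_of_sets Xs(3) by metis
  from es(1) have "map (\<lambda>e. set ` set e) es = Xs"
    by (induction rule: list_all2_induct) auto
  then show ?thesis using Xs(1) es(2) by (metis set_map)
qed

text \<open>A hypergraph has many encodings, one for each choice of orders; each of them is
  \<open>enc\<close> of some pair of lists, and the algorithm is correct for every such
  pair.\<close>

lemma encodes_blowup:
  assumes "encodes_hypergraph (encodes_set encodes_nat) inp H"
  shows "\<exists>vs es. lists_hypergraph vs es H \<and> inp = enc (vs, es)"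
proof -
  obtain a b where ab: "inp = Cell a b" "encodes_set (encodes_set encodes_nat) a (verts H)"
    "encodes_set (encodes_set (encodes_set encodes_nat)) b (edges H)"
    using assms unfolding encodes_hypergraph_def by blast
  obtain vs where "distinct (map set vs)" "\<forall>U\<in>set vs. distinct U" "set ` set vs = verts H" "a = enc vs"
    using encodes_set_of_sets[OF ab(2)] by blast
  moreover obtain es where "(\<lambda>e. set ` set e) ` set es = edges H" "b = enc es"
    using encodes_set_of_sets_of_sets[OF ab(3)] by blast
  ultimately show ?thesis unfolding lists_hypergraph_def ab(1) by (intro exI[of _ vs] exI[of _ es]) simp
qed

lemma encodes_set_image:
  assumes "distinct (map set C)" "\<forall>U\<in>set C. distinct U"
  shows "encodes_set (encodes_set encodes_nat) (enc C) (set ` set C)"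
proof -
  have "list_all2 (encodes_set encodes_nat) (map enc C) (map set C)"
    using assms(2) by (auto simp: list_all2_conv_all_nth encodes_nat_set_iff)
  moreover have "enc C = foldr Cell (map enc C) (Atom 0)" by (induction C) auto
  ultimately show ?thesis using assms(1) unfolding encodes_set_def[of "encodes_set encodes_nat"]
    by (intro exI[of _ "map enc C"] exI[of _ "map set C"]) simp
qed

lemma cover_number_le_fractional:
  assumes t: "t \<ge> 2" and G: "finite_hypergraph G" "uniform t G"
  shows "real (cover_number (blowup (t - 1) G)) \<le> cover_factor t * fractional_cover_number (blowup (t - 1) G)"
proof -
  let ?H = "blowup (t - 1) G"
  obtain c0 c1 c2 \<delta> where c: "good_constants t c0 c1 c2 \<delta>" using good_constants_exist[OF t] by blast
  obtain vs es where L: "lists_hypergraph vs es ?H" using lists_hypergraph_exist[OF G(1)] by blast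
  define C where "C = set ` set (approx_cover c0 c1 c2 t vs es)"
  note cover = approx_cover_blowup[OF t c G L, folded C_def]
  have \<alpha>: "cover_factor t > 0" using cover_factor_gt_2[OF t] by simp
  have le: "real (cover_number ?H) \<le> card C"
    using cover_number_le[OF finite_blowup(1)[OF G(1)] cover(3)] by simp
  have "fractional_cover ?H (\<lambda>v. of_bool (v \<in> C))"
    using fractional_cover_indicator[OF cover(3)] finite_blowup[OF G(1)] by blast
  \<comment> \<open>One and the same algorithmic cover is compared with all fractional covers, so
    the quotient is a lower bound of the set under the infimum.\<close>
  then have "cover_number ?H / cover_factor t \<le> fractional_cover_number ?H"
    unfolding fractional_cover_number_def
  proof (intro cInf_greatest)
    fix s assume "s \<in> {\<Sum>v\<in>verts ?H. x v | x. fractional_cover ?H x}"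
    then obtain x where x: "fractional_cover ?H x" "s = sum x (verts ?H)" by blast
    have "real (cover_number ?H) \<le> cover_factor t * s" 
      unfolding x(2) using cover(4)[OF x(1)] le by linarith
    then show "cover_number ?H / cover_factor t \<le> s" using \<alpha> by (simp add: pos_divide_le_eq mult.commute)
  qed blast
  then show ?thesis using \<alpha> by (simp add: pos_divide_le_eq mult.commute)
qed

lemma cover_approx_blowup:
  assumes t: "t \<ge> 2"
  shows "poly_time_cover_approx (encodes_set encodes_nat)
    {blowup (t - 1) G | G :: nat hypergraph. finite_hypergraph G \<and> uniform t G} (cover_factor t)"
proof -
  obtain c0 c1 c2 \<delta> where c: "good_constants t c0 c1 c2 \<delta>" using good_constants_exist[OF t] by blast
  obtain p q where pq: "\<And>x :: nat list list \<times> nat list list list. \<exists>c \<le> poly q (sz x).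
      runs p (enc x) (enc (approx_cover c0 c1 c2 t (fst x) (snd x))) c"
    using poly_time_program[OF poly_time_approx_cover] by blast
  show ?thesis
    unfolding poly_time_cover_approx_def
  proof (intro exI[of _ p] exI[of _ q] ballI allI impI)
    fix H :: "nat set hypergraph" and inp
    assume "H \<in> {blowup (t - 1) G | G :: nat hypergraph. finite_hypergraph G \<and> uniform t G}"
      and inp: "encodes_hypergraph (encodes_set encodes_nat) inp H"
    then obtain G :: "nat hypergraph" where G: "finite_hypergraph G" "uniform t G" and H: "H = blowup (t - 1) G"
      by blast
    obtain vs es where L: "lists_hypergraph vs es H" and inp_eq: "inp = enc (vs, es)"
      using encodes_blowup[OF inp] by blast
    define C where "C = approx_cover c0 c1 c2 t vs es"
    note cover = approx_cover_blowup[OF t c G L[unfolded H], folded C_def H]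
    obtain k where k: "k \<le> poly q (bit_size inp)" "runs p inp (enc C) k"
      using pq[of "(vs, es)"] by (auto simp: inp_eq C_def simp del: enc_simps)
    have "distinct (map set C)" "\<forall>U\<in>set C. distinct U"
      using L cover(1,2) by (auto simp: lists_hypergraph_def distinct_map intro: inj_on_subset)
    then have out: "encodes_set (encodes_set encodes_nat) (enc C) (set ` set C)" by (rule encodes_set_image)
    have fin: "finite (verts H)" "\<And>e. e \<in> edges H \<Longrightarrow> e \<subseteq> verts H"
      using finite_blowup[OF G(1)] unfolding H by blast+
    obtain C' where C': "vertex_cover H C'" "card C' = cover_number H"
      using cover_number_attained[OF fin(1) cover(3)] by blast
    \<comment> \<open>The guarantee against fractional covers is applied to the indicator of a
      minimum cover.\<close>
    have "real (card (set ` set C)) \<le> cover_factor t * cover_number H"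
      using cover(4)[OF fractional_cover_indicator(1)[OF C'(1) fin]] fractional_cover_indicator(2)[OF C'(1) fin] C'(2)
      by simp
    with k out cover(3) show "\<exists>out c C. runs p inp out c \<and> c \<le> poly q (bit_size inp) \<and>
        encodes_set (encodes_set encodes_nat) out C \<and> vertex_cover H C \<and>
        real (card C) \<le> cover_factor t * real (cover_number H)"
      by blast
  qed
qed

theorem theorem1p1:
  fixes t :: nat
  assumes "t \<ge> 2"
  shows "(\<forall>G :: 'a hypergraph. finite_hypergraph G \<and> uniform t G \<longrightarrow>
            real (cover_number (blowup (t - 1) G))
              \<le> (t / 2 + 2 * sqrt (t * ln t)) * fractional_cover_number (blowup (t - 1) G)) \<and>
         poly_time_cover_approx (encodes_set encodes_nat)
            {blowup (t - 1) G | G :: nat hypergraph. finite_hypergraph G \<and> uniform t G}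
            (t / 2 + 2 * sqrt (t * ln t))"
  using cover_number_le_fractional[OF assms] cover_approx_blowup[OF assms]
  unfolding cover_factor_def by blast

end
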